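(* Let $G=(V(G),E(G))$ be a finite simple graph. Suppose that $G_1=(V(G_1),E(G_1))$ and $G_2=(V(G_2),E(G_2))$ are two induced subgraphs which form a splitting of $G$ along an edge $e$. If $G_1$ is bipartite, then for all $i,j\ge 0$ $$\beta_{i,j}(\mathbb{K}[E(G)]/I_G)=\sum_{\substack{i_1+i_2=i\\ j_1+j_2=j}}\beta_{i_1,j_1}(\mathbb{K}[E(G_1)]/I_{G_1})\,\beta_{i_2,j_2}(\mathbb{K}[E(G_2)]/I_{G_2}).$$
   Context: $\mathbb{K}$ is an algebraically closed field of characteristic zero. For a finite simple graph $G$ with vertices $V(G)=\{x_1,\ldots,x_n\}$ and edges $E(G)=\{e_1,\ldots,e_q\}$, the toric ideal $I_G$ is the kernel of the $\mathbb{K}$-algebra homomorphism $\mathbb{K}[E(G)]=\mathbb{K}[e_1,\ldots,e_q]\to\mathbb{K}[x_1,\ldots,x_n]$ sending $e_i=\{x_{i,1},x_{i,2}\}$ to $x_{i,1}x_{i,2}$. It is homogeneous for the standard grading $\deg e_i=1$. For a graded module $M$ over a standard graded polynomial ring $R$, $\beta_{i,j}(M)=\dim_{\mathbb{K}}\operatorname{Tor}_i^R(M,\mathbb{K})_j$; here the Betti numbers of $\mathbb{K}[E(G)]/I_G$ and $\mathbb{K}[E(G_r)]/I_{G_r}$ ($r=1,2$) are taken over $\mathbb{K}[E(G)]$ and $\mathbb{K}[E(G_r)]$ respectively. Splitting: let $W_1,W_2\subseteq V(G)$ with $W_1\cup W_2=V(G)$, let $G_i$ be the induced subgraph of $G$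 on $W_i$, let $Y=W_1\cap W_2$ and let $H$ be the induced subgraph on $Y$. Then $G_1$ and $G_2$ form a splitting of $G$ along $H$ if removing the vertices $Y$ from $G$ yields two disconnected pieces, i.e. no edge of $G$ joins a vertex of $W_1\setminus Y$ to a vertex of $W_2\setminus Y$. It is a splitting along an edge $e$ if $H$ consists of the single edge $e$ and its two endpoints. *)

theory Defs
  imports Complex_Main "HOL-Library.Poly_Mapping" "HOL-Computational_Algebra.Polynomial"
begin

section \<open>Graphs and splittings\<close>

definition simple_graph :: "'v set \<Rightarrow> 'v set set \<Rightarrow> bool" where
  "simple_graph V E \<longleftrightarrow> finite V \<and> (\<forall>f\<in>E. f \<subseteq> V \<and> card f = 2)"

definition induced_edges :: "'v set set \<Rightarrow> 'v set \<Rightarrow> 'v set set" where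
  "induced_edges E W = {f \<in> E. f \<subseteq> W}"

definition bipartite_graph :: "'v set \<Rightarrow> 'v set set \<Rightarrow> bool" where
  "bipartite_graph V E \<longleftrightarrow>
     (\<exists>A B. A \<union> B = V \<and> A \<inter> B = {} \<and> (\<forall>f\<in>E. \<exists>a\<in>A. \<exists>b\<in>B. f = {a, b}))"

text \<open>
  The induced subgraphs on \<open>W1\<close> and \<open>W2\<close> form a splitting of \<open>(V, E)\<close> along the induced
  subgraph on \<open>W1 \<inter> W2\<close>.
\<close>

definition splitting :: "'v set \<Rightarrow> 'v set set \<Rightarrow> 'v set \<Rightarrow> 'v set \<Rightarrow> bool" where
  "splitting V E W1 W2 \<longleftrightarrow> W1 \<subseteq> V \<and> W2 \<subseteq> V \<and> W1 \<union> W2 = V \<and>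
     (\<forall>u \<in> W1 - (W1 \<inter> W2). \<forall>w \<in> W2 - (W1 \<inter> W2). {u, w} \<notin> E)"

definition splitting_along_edge ::
    "'v set \<Rightarrow> 'v set set \<Rightarrow> 'v set \<Rightarrow> 'v set \<Rightarrow> 'v set \<Rightarrow> bool" where
  "splitting_along_edge V E W1 W2 e \<longleftrightarrow> splitting V E W1 W2 \<and>
     W1 \<inter> W2 = e \<and> induced_edges E (W1 \<inter> W2) = {e}"


section \<open>Polynomial rings\<close>

text \<open>
  A polynomial with variables of type \<open>'x\<close> is a finitely supported map from monomials to
  coefficients, a monomial being a finitely supported map from variables to exponents.
  The ring \<open>K[S]\<close> is the subring of polynomials that involve only variables from \<open>S\<close>.
\<close>

type_synonym ('x, 'k) polynomial = "('x \<Rightarrow>\<^sub>0 nat) \<Rightarrow>\<^sub>0 'k"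

definition poly_ring :: "'x set \<Rightarrow> ('x, 'k::zero) polynomial set" where
  "poly_ring S = {p. \<forall>m \<in> Poly_Mapping.keys p. Poly_Mapping.keys m \<subseteq> S}"

definition poly_var :: "'x \<Rightarrow> ('x, 'k::zero_neq_one) polynomial" where
  "poly_var x = Poly_Mapping.single (Poly_Mapping.single x 1) 1"

definition poly_const :: "'k::zero \<Rightarrow> ('x, 'k) polynomial" where
  "poly_const c = Poly_Mapping.single 0 c"

definition monom_degree :: "('x \<Rightarrow>\<^sub>0 nat) \<Rightarrow> nat" where
  "monom_degree m = (\<Sum>x \<in> Poly_Mapping.keys m. Poly_Mapping.lookup m x)"

definition homogeneous :: "nat \<Rightarrow> ('x, 'k::zero) polynomial \<Rightarrow> bool" where
  "homogeneous d p \<longleftrightarrow> (\<forall>m \<in> Poly_Mapping.keys p. monom_degree m = d)"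


section \<open>Toric ideals of graphs\<close>

text \<open>The \<open>K\<close>-algebra homomorphism with \<open>f \<mapsto> (\<Prod>v\<in>f. x\<^sub>v)\<close> for every edge \<open>f\<close>.\<close>

definition edge_hom :: "('v set, 'k::comm_ring_1) polynomial \<Rightarrow> ('v, 'k) polynomial" where
  "edge_hom p = (\<Sum>m \<in> Poly_Mapping.keys p. poly_const (Poly_Mapping.lookup p m) *
     (\<Prod>f \<in> Poly_Mapping.keys m. (\<Prod>v\<in>f. poly_var v) ^ Poly_Mapping.lookup m f))"

definition toric_ideal :: "'v set set \<Rightarrow> ('v set, 'k::comm_ring_1) polynomial set" where
  "toric_ideal E = {p \<in> poly_ring E. edge_hom p = 0}"


section \<open>Graded free resolutions\<close>

text \<open>
  Elements of a free \<open>'r\<close>-module with basis inside \<open>nat\<close> are finitely supported coordinate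
  vectors.  \<open>vec_scale\<close> is scalar multiplication, and \<open>lin_ext f\<close> is the linear map that
  sends the basis element \<open>b\<close> to \<open>f b\<close>.
\<close>

definition vec_scale :: "'r::comm_ring_1 \<Rightarrow> (nat \<Rightarrow>\<^sub>0 'r) \<Rightarrow> (nat \<Rightarrow>\<^sub>0 'r)" where
  "vec_scale c v = Poly_Mapping.map (\<lambda>a. c * a) v"

definition lin_ext :: "(nat \<Rightarrow> (nat \<Rightarrow>\<^sub>0 'r::comm_ring_1)) \<Rightarrow> (nat \<Rightarrow>\<^sub>0 'r) \<Rightarrow> (nat \<Rightarrow>\<^sub>0 'r)" where
  "lin_ext f v = (\<Sum>b \<in> Poly_Mapping.keys v. vec_scale (Poly_Mapping.lookup v b) (f b))"

text \<open>
  Data of a complex \<open>\<dots> \<rightarrow> F\<^sub>2 \<rightarrow> F\<^sub>1 \<rightarrow> F\<^sub>0 \<rightarrow> R/I\<close> of graded free modules: \<open>F\<^sub>i\<close> has basis \<open>gens i\<close>,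
  the basis element \<open>b\<close> of \<open>F\<^sub>i\<close> has degree \<open>gdeg i b\<close>, its image in \<open>F\<^sub>i\<^sub>-\<^sub>1\<close> is
  \<open>bdry (i - 1) b\<close> (so \<open>bdry i\<close> describes \<open>F\<^sub>i\<^sub>+\<^sub>1 \<rightarrow> F\<^sub>i\<close>), and for \<open>i = 0\<close> its image in \<open>R/I\<close> is
  the class of \<open>aug b\<close>.
\<close>

record (overloaded) ('x, 'k::zero) free_complex =
  gens :: "nat \<Rightarrow> nat set"
  gdeg :: "nat \<Rightarrow> nat \<Rightarrow> nat"
  bdry :: "nat \<Rightarrow> nat \<Rightarrow> (nat \<Rightarrow>\<^sub>0 ('x, 'k) polynomial)"
  aug :: "nat \<Rightarrow> ('x, 'k) polynomial"

definition free_mod :: "'x set \<Rightarrow> nat set \<Rightarrow> (nat \<Rightarrow>\<^sub>0 ('x, 'k::zero) polynomial) set" where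
  "free_mod S B = {v. Poly_Mapping.keys v \<subseteq> B \<and> (\<forall>b. Poly_Mapping.lookup v b \<in> poly_ring S)}"

definition homogeneous_vec ::
    "(nat \<Rightarrow> nat) \<Rightarrow> nat \<Rightarrow> (nat \<Rightarrow>\<^sub>0 ('x, 'k::zero) polynomial) \<Rightarrow> bool" where
  "homogeneous_vec dg d v \<longleftrightarrow>
     (\<forall>b \<in> Poly_Mapping.keys v. \<exists>k. dg b + k = d \<and> homogeneous k (Poly_Mapping.lookup v b))"

definition aug_map ::
    "(nat \<Rightarrow> ('x, 'k::comm_ring_1) polynomial) \<Rightarrow> (nat \<Rightarrow>\<^sub>0 ('x, 'k) polynomial) \<Rightarrow> ('x, 'k) polynomial" where
  "aug_map a v = (\<Sum>b \<in> Poly_Mapping.keys v. Poly_Mapping.lookup v b * a b)"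

text \<open>
  \<open>F\<close> is a graded free resolution of the \<open>R\<close>-module \<open>R/I\<close>, where \<open>R = K[S]\<close> has the standard
  grading and \<open>I\<close> is a homogeneous ideal.  Each \<open>F\<^sub>i\<close> has finitely many basis elements in each
  degree; for finite \<open>S\<close> such resolutions always exist.
\<close>

definition graded_free_resolution ::
    "'x set \<Rightarrow> ('x, 'k::comm_ring_1) polynomial set \<Rightarrow> ('x, 'k) free_complex \<Rightarrow> bool" where
  "graded_free_resolution S I F \<longleftrightarrow>
     (\<forall>i d. finite {b \<in> gens F i. gdeg F i b = d}) \<and>
     (\<forall>i. \<forall>b \<in> gens F (Suc i). bdry F i b \<in> free_mod S (gens F i) \<and>
        homogeneous_vec (gdeg F i) (gdeg F (Suc i) b) (bdry F i b)) \<and>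
     (\<forall>b \<in> gens F 0. aug F b \<in> poly_ring S \<and> homogeneous (gdeg F 0 b) (aug F b)) \<and>
     (\<forall>p \<in> poly_ring S. \<exists>v \<in> free_mod S (gens F 0). p - aug_map (aug F) v \<in> I) \<and>
     {v \<in> free_mod S (gens F 0). aug_map (aug F) v \<in> I} =
       lin_ext (bdry F 0) ` free_mod S (gens F 1) \<and>
     (\<forall>i. {v \<in> free_mod S (gens F (Suc i)). lin_ext (bdry F i) v = 0} =
       lin_ext (bdry F (Suc i)) ` free_mod S (gens F (i + 2)))"


section \<open>Tor and graded Betti numbers\<close>

text \<open>
  With \<open>K = R/(S)\<close>, the module \<open>F\<^sub>i \<otimes>\<^sub>R K\<close> is the \<open>K\<close>-vector space on the basis of \<open>F\<^sub>i\<close>, and tensoring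
  replaces every matrix entry of the differential by its constant coefficient.
  \<open>tensor_part F i j\<close> is the degree \<open>j\<close> component of \<open>F\<^sub>i \<otimes>\<^sub>R K\<close>, and \<open>tensor_diff F i\<close> is the
  differential \<open>F\<^sub>i\<^sub>+\<^sub>1 \<otimes>\<^sub>R K \<rightarrow> F\<^sub>i \<otimes>\<^sub>R K\<close>.
\<close>

definition tensor_part ::
    "('x, 'k::comm_ring_1) free_complex \<Rightarrow> nat \<Rightarrow> nat \<Rightarrow> (nat \<Rightarrow>\<^sub>0 'k) set" where
  "tensor_part F i j = {w. Poly_Mapping.keys w \<subseteq> {b \<in> gens F i. gdeg F i b = j}}"

definition tensor_diff ::
    "('x, 'k::comm_ring_1) free_complex \<Rightarrow> nat \<Rightarrow> (nat \<Rightarrow>\<^sub>0 'k) \<Rightarrow> (nat \<Rightarrow>\<^sub>0 'k)" where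
  "tensor_diff F i =
     lin_ext (\<lambda>b. Poly_Mapping.map (\<lambda>p. Poly_Mapping.lookup p 0) (bdry F i b))"

definition tensor_cycles ::
    "('x, 'k::comm_ring_1) free_complex \<Rightarrow> nat \<Rightarrow> nat \<Rightarrow> (nat \<Rightarrow>\<^sub>0 'k) set" where
  "tensor_cycles F i j =
     {w \<in> tensor_part F i j. case i of 0 \<Rightarrow> True | Suc i' \<Rightarrow> tensor_diff F i' w = 0}"

definition tensor_boundaries ::
    "('x, 'k::comm_ring_1) free_complex \<Rightarrow> nat \<Rightarrow> nat \<Rightarrow> (nat \<Rightarrow>\<^sub>0 'k) set" where
  "tensor_boundaries F i j = tensor_diff F i ` tensor_part F (Suc i) j"

lemma lookup_vec_scale [simp]:
  "Poly_Mapping.lookup (vec_scale c v) b = c * Poly_Mapping.lookup v b"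
  by (auto simp: vec_scale_def Poly_Mapping.map.rep_eq when_def)

lemma vector_space_vec_scale: "vector_space (vec_scale :: 'k::field \<Rightarrow> (nat \<Rightarrow>\<^sub>0 'k) \<Rightarrow> _)"
  by unfold_locales (auto intro!: poly_mapping_eqI simp: lookup_add algebra_simps)

text \<open>
  \<open>graded_betti S I i j\<close> is \<open>dim\<^sub>K Tor\<^sub>i\<^sup>R(R/I, K)\<^sub>j\<close> for \<open>R = K[S]\<close>: \<open>Tor\<close> is the homology of \<open>F \<otimes>\<^sub>R K\<close>
  for a chosen graded free resolution \<open>F\<close>.  The spaces involved are finite-dimensional, so the
  dimension of cycles modulo boundaries is the difference of the dimensions.
\<close>

definition tor_dim :: "('x, 'k::field) free_complex \<Rightarrow> nat \<Rightarrow> nat \<Rightarrow> nat" where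
  "tor_dim F i j = vector_space.dim vec_scale (tensor_cycles F i j) -
     vector_space.dim vec_scale (tensor_boundaries F i j)"

definition graded_betti ::
    "'x set \<Rightarrow> ('x, 'k::field) polynomial set \<Rightarrow> nat \<Rightarrow> nat \<Rightarrow> nat" where
  "graded_betti S I i j = tor_dim (SOME F. graded_free_resolution S I F) i j"

end

theory Submission
  imports Defs "HOL-Library.Nat_Bijection"
begin

text \<open>
  Write \<open>R\<^sub>r = K[E\<^sub>r]\<close> and \<open>R = K[E]\<close>, so that \<open>R\<close> is the tensor product of \<open>R\<^sub>1\<close> and \<open>R\<^sub>2\<close> over
  \<open>K[e]\<close>. Since \<open>G\<^sub>1\<close> is bipartite, two monomials with equal vertex degrees are linked by
  binomials of \<open>I\<^sub>1\<close> and \<open>I\<^sub>2\<close> after multiplication of their \<open>E\<^sub>2\<close>-parts by powers of \<open>e\<close>, and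
  hence \<open>R/I\<close> is the tensor product of \<open>R\<^sub>1/I\<^sub>1\<close> and \<open>R\<^sub>2/I\<^sub>2\<close> over \<open>K[e]\<close>. The semigroup ring
  \<open>R\<^sub>2/I\<^sub>2\<close> is free over \<open>K[e]\<close>, so the tensor product over \<open>K[e]\<close> of minimal resolutions of
  \<open>R\<^sub>1/I\<^sub>1\<close> and \<open>R\<^sub>2/I\<^sub>2\<close> is again exact. It is a minimal resolution of \<open>R/I\<close>, and counting its
  generators gives the formula, as Tor does not depend on the resolution.
\<close>

text \<open>Two base changes carry the exactness. \<open>R\<close> is a polynomial ring over
  \<open>R\<^sub>2\<close>, so the second resolution extended to \<open>R\<close> stays exact and
  resolves the quotient of \<open>R\<close> by the extension of \<open>I\<^sub>2\<close>. This
  quotient is free over \<open>R\<^sub>1\<close>, because a vertex degree can be divided by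
  \<open>e\<close> only finitely often and exponents can be cancelled; so the first resolution
  tensored with it is exact as well. Both are instances of \<open>monomial_decomp\<close>, one with
  \<open>J = 0\<close>, the other with \<open>J\<close> the extension of \<open>I\<^sub>2\<close>.
  No quotient ring or module is formed: ideals are described by coefficients of their elements, and
  exactness modulo \<open>J\<close> by representatives. The bipartite hypothesis is needed to place
  the coefficients of an element of \<open>I\<close> in \<open>I\<^sub>1\<close>. Betti numbers are
  defined by an arbitrarily chosen resolution, hence the comparison theorem, and by subtraction of
  dimensions, hence the care for finite-dimensional graded pieces.\<close>

abbreviation lookup :: "('a \<Rightarrow>\<^sub>0 'b::zero) \<Rightarrow> 'a \<Rightarrow> 'b" where "lookup \<equiv> Poly_Mapping.lookup"
abbreviation keys :: "('a \<Rightarrow>\<^sub>0 'b::zero) \<Rightarrow> 'a set" where "keys \<equiv> Poly_Mapping.keys"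
abbreviation single :: "'a \<Rightarrow> 'b \<Rightarrow> ('a \<Rightarrow>\<^sub>0 'b::zero)" where "single \<equiv> Poly_Mapping.single"

section \<open>Linear extension\<close>

lemma sum_keys_superset:
  assumes "finite A" "keys p \<subseteq> A" "\<And>k. f k 0 = 0"
  shows "(\<Sum>k\<in>keys p. f k (lookup p k)) = (\<Sum>k\<in>A. f k (lookup p k))"
  using assms by (intro sum.mono_neutral_left) (auto simp: in_keys_iff)

lemma poly_mapping_expand: "p = (\<Sum>k\<in>keys p. single k (lookup p k))"
proof (rule poly_mapping_eqI)
  fix j
  show "lookup p j = lookup (\<Sum>k\<in>keys p. single k (lookup p k)) j"
    by (cases "j \<in> keys p") (auto simp: lookup_sum lookup_single when_def in_keys_iff)
qed

text \<open>Stated for commutative rings, so that one set of lemmas serves both the free modules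
  over polynomial rings and the vector spaces obtained after tensoring with
  \<open>K\<close>.\<close>

interpretation vec: module "vec_scale :: 'r::comm_ring_1 \<Rightarrow> (nat \<Rightarrow>\<^sub>0 'r) \<Rightarrow> _"
  by unfold_locales (auto intro!: poly_mapping_eqI simp: lookup_add algebra_simps)

lemma vec_scale_single [simp]: "vec_scale c (single b a) = single b (c * a)"
  by (auto intro!: poly_mapping_eqI simp: lookup_single when_def)

lemma lin_ext_superset:
  assumes "finite A" "keys v \<subseteq> A"
  shows "lin_ext f v = (\<Sum>b\<in>A. vec_scale (lookup v b) (f b))"
  unfolding lin_ext_def by (rule sum_keys_superset) (use assms in auto)

lemma lookup_lin_ext: "lookup (lin_ext f v) c = (\<Sum>b\<in>keys v. lookup v b * lookup (f b) c)"
  by (simp add: lin_ext_def lookup_sum)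

lemma lin_ext_add: "lin_ext f (v + w) = lin_ext f v + lin_ext f w"
  unfolding lin_ext_def by (rule setsum_keys_plus_distrib) (auto simp: vec.scale_left_distrib)

lemma lin_ext_zero [simp]: "lin_ext f 0 = 0"
  by (simp add: lin_ext_def)

lemma lin_ext_single [simp]: "lin_ext f (single b c) = vec_scale c (f b)"
  by (simp add: lin_ext_def)

lemma keys_vec_scale: "keys (vec_scale c v) \<subseteq> keys v"
  by (auto simp: in_keys_iff)

lemma lin_ext_scale: "lin_ext f (vec_scale c v) = vec_scale c (lin_ext f v)"
  by (subst lin_ext_superset[OF _ keys_vec_scale])
     (auto simp: lin_ext_def vec.scale_sum_right)

lemma vec_scale_minus_one: "vec_scale (-1) v = - v"
  by simp

lemma lin_ext_uminus: "lin_ext f (- v) = - lin_ext f v"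
  using lin_ext_scale[of f "-1" v] by simp

lemma lin_ext_diff: "lin_ext f (v - w) = lin_ext f v - lin_ext f w"
  using lin_ext_add[of f v "-w"] by (simp add: lin_ext_uminus)

lemma lin_ext_sum: "lin_ext f (sum g A) = (\<Sum>x\<in>A. lin_ext f (g x))"
  by (induction A rule: infinite_finite_induct) (auto simp: lin_ext_add)

lemma lin_ext_lin_ext: "lin_ext g (lin_ext f v) = lin_ext (\<lambda>b. lin_ext g (f b)) v"
  unfolding lin_ext_def[of f v] by (simp add: lin_ext_sum lin_ext_scale) (simp add: lin_ext_def)

lemma lin_ext_cong: "(\<And>b. b \<in> keys v \<Longrightarrow> f b = g b) \<Longrightarrow> lin_ext f v = lin_ext g v"
  by (simp add: lin_ext_def)

lemma lin_ext_fun_add: "lin_ext (\<lambda>b. f b + g b) v = lin_ext f v + lin_ext g v"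
  by (simp add: lin_ext_def vec.scale_right_distrib sum.distrib)

lemma lin_ext_fun_diff: "lin_ext (\<lambda>b. f b - g b) v = lin_ext f v - lin_ext g v"
  by (simp add: lin_ext_def vec.scale_right_diff_distrib sum_subtractf)

lemma lin_ext_fun_scale: "lin_ext (\<lambda>b. vec_scale c (f b)) v = vec_scale c (lin_ext f v)"
  by (simp add: lin_ext_def vec.scale_sum_right mult.commute)

lemma lin_ext_fun_zero [simp]: "lin_ext (\<lambda>b. 0) v = 0"
  by (simp add: lin_ext_def)

lemma lin_ext_ident [simp]: "lin_ext (\<lambda>b. single b 1) v = v"
  by (simp add: lin_ext_def flip: poly_mapping_expand)

text \<open>The augmentation is a linear map into a free module of rank one, so its linearity is
  inherited from \<open>lin_ext\<close>.\<close>

lemma aug_map_eq_lin_ext: "aug_map a v = lookup (lin_ext (\<lambda>b. single 0 (a b)) v) 0"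
  by (simp add: aug_map_def lookup_lin_ext)

lemma aug_map_zero [simp]: "aug_map a 0 = 0"
  by (simp add: aug_map_def)

lemma aug_map_add: "aug_map a (v + w) = aug_map a v + aug_map a w"
  by (simp add: aug_map_eq_lin_ext lin_ext_add lookup_add)

lemma aug_map_diff: "aug_map a (v - w) = aug_map a v - aug_map a w"
  by (simp add: aug_map_eq_lin_ext lin_ext_diff lookup_minus)

lemma aug_map_sum: "aug_map f (sum g A) = (\<Sum>x\<in>A. aug_map f (g x))"
  by (induction A rule: infinite_finite_induct) (auto simp: aug_map_add)

lemma aug_map_scale: "aug_map a (vec_scale c v) = c * aug_map a v"
  by (simp add: aug_map_eq_lin_ext lin_ext_scale)

lemma aug_map_single [simp]: "aug_map a (single b c) = c * a b"
  by (simp add: aug_map_eq_lin_ext)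

lemma aug_map_lin_ext: "aug_map a (lin_ext f v) = aug_map (\<lambda>b. aug_map a (f b)) v"
  unfolding lin_ext_def[of f v] by (simp add: aug_map_sum aug_map_scale) (simp add: aug_map_def)

section \<open>Polynomial subrings and submodules\<close>

lemma poly_ring_0 [simp]: "0 \<in> poly_ring S"
  by (simp add: poly_ring_def)

lemma poly_ring_1 [simp]: "1 \<in> poly_ring S"
  by (simp add: poly_ring_def)

lemma poly_ring_single: "c = 0 \<or> keys m \<subseteq> S \<Longrightarrow> single m c \<in> poly_ring S"
  by (auto simp: poly_ring_def)

lemma poly_ring_add: "p \<in> poly_ring S \<Longrightarrow> q \<in> poly_ring S \<Longrightarrow> p + q \<in> poly_ring S"
  using keys_add[of p q] by (auto simp: poly_ring_def)

lemma poly_ring_uminus: "p \<in> poly_ring S \<Longrightarrow> - p \<in> poly_ring S" for p :: "('x, 'k::ab_group_add)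
    polynomial"
  by (simp add: poly_ring_def)

lemma poly_ring_diff: "p \<in> poly_ring S \<Longrightarrow> q \<in> poly_ring S \<Longrightarrow> p - q \<in> poly_ring S" for p :: "('x,
    'k::ab_group_add) polynomial"
  using keys_diff[of p q] by (auto simp: poly_ring_def)

lemma poly_ring_mult: "p \<in> poly_ring S \<Longrightarrow> q \<in> poly_ring S \<Longrightarrow> p * q \<in> poly_ring S"
proof -
  assume pq: "p \<in> poly_ring S" "q \<in> poly_ring S"
  have "keys m \<subseteq> S" if m: "m \<in> keys (p * q)" for m
  proof -
    obtain a b where "m = a + b" "a \<in> keys p" "b \<in> keys q"
      using keys_mult[of p q] m by blast
    then show ?thesis using pq keys_add[of a b] unfolding poly_ring_def by blast
  qed
  then show ?thesis by (simp add: poly_ring_def)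
qed

lemma poly_ring_sum: "(\<And>x. x \<in> A \<Longrightarrow> f x \<in> poly_ring S) \<Longrightarrow> sum f A \<in> poly_ring S"
  by (induction A rule: infinite_finite_induct) (auto intro: poly_ring_add)

lemma poly_ring_mono: "S \<subseteq> T \<Longrightarrow> poly_ring S \<subseteq> poly_ring T"
  by (auto simp: poly_ring_def)

text \<open>All rings \<open>K[S]\<close> are subrings of one polynomial type, so a module is a set
  of vectors and only the scalars are confined to \<open>K[S]\<close>. The same vector can be viewed
  over \<open>E1\<close>, \<open>E2\<close> or their union without a coercion.\<close>

definition submodule :: "'x set \<Rightarrow> (nat \<Rightarrow>\<^sub>0 ('x, 'k::comm_ring_1) polynomial) set \<Rightarrow> bool" where
  "submodule S N \<longleftrightarrow> 0 \<in> N \<and> (\<forall>v\<in>N. \<forall>w\<in>N. v + w \<in> N) \<and> (\<forall>p\<in>poly_ring S. \<forall>v\<in>N. vec_scale p v \<in> N)"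

lemma submodule_sum:
  assumes "submodule S N" "\<And>x. x \<in> A \<Longrightarrow> f x \<in> N"
  shows "sum f A \<in> N"
  using assms(2)
  by (induction A rule: infinite_finite_induct) (use assms(1) in \<open>auto simp: submodule_def\<close>)

lemma submodule_diff: "submodule S N \<Longrightarrow> v \<in> N \<Longrightarrow> w \<in> N \<Longrightarrow> v - w \<in> N"
proof -
  assume N: "submodule S N" "v \<in> N" "w \<in> N"
  have "(-1 :: ('a, 'b) polynomial) \<in> poly_ring S" by (simp add: poly_ring_uminus)
  then have "vec_scale (-1) w \<in> N" using N unfolding submodule_def by blast
  then show ?thesis using N unfolding submodule_def by (metis diff_conv_add_uminus
      vec_scale_minus_one)
qed

lemma submodule_lin_ext:
  assumes "submodule S N" "\<And>b. b \<in> keys v \<Longrightarrow> f b \<in> N" "\<And>b. lookup v b \<in> poly_ring S"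
  shows "lin_ext f v \<in> N"
  unfolding lin_ext_def
  by (rule submodule_sum[OF assms(1)]) (use assms in \<open>auto simp: submodule_def\<close>)

lemma submodule_free_mod: "submodule S (free_mod S B :: (nat \<Rightarrow>\<^sub>0 ('x, 'k::comm_ring_1) polynomial)
    set)"
  unfolding submodule_def
proof (intro conjI ballI)
  show "(0 :: nat \<Rightarrow>\<^sub>0 ('x, 'k) polynomial) \<in> free_mod S B" by (simp add: free_mod_def)
next
  fix v w :: "nat \<Rightarrow>\<^sub>0 ('x, 'k) polynomial"
  assume "v \<in> free_mod S B" "w \<in> free_mod S B"
  then show "v + w \<in> free_mod S B"
    using keys_add[of v w] by (auto simp: free_mod_def lookup_add intro: poly_ring_add)
next
  fix p :: "('x, 'k) polynomial" and v :: "nat \<Rightarrow>\<^sub>0 ('x, 'k) polynomial"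
  assume "p \<in> poly_ring S" "v \<in> free_mod S B"
  then show "vec_scale p v \<in> free_mod S B"
    using keys_vec_scale[of p v] by (auto simp: free_mod_def intro: poly_ring_mult)
qed

lemma zero_free_mod [simp]: "0 \<in> free_mod S B"
  by (simp add: free_mod_def)

lemma free_mod_single: "b \<in> B \<Longrightarrow> p \<in> poly_ring S \<Longrightarrow> single b p \<in> free_mod S B"
  by (auto simp: free_mod_def lookup_single when_def)

lemma free_mod_mono: "S \<subseteq> S' \<Longrightarrow> B \<subseteq> B' \<Longrightarrow> free_mod S B \<subseteq> free_mod S' B'"
  using poly_ring_mono[of S S'] unfolding free_mod_def by blast

lemma lin_ext_free_mod:
  assumes "v \<in> free_mod S B" "\<And>b. b \<in> B \<Longrightarrow> f b \<in> free_mod S C"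
  shows "lin_ext f v \<in> free_mod S C"
  by (rule submodule_lin_ext[OF submodule_free_mod]) (use assms in \<open>auto simp: free_mod_def\<close>)

lemma aug_map_poly_ring:
  assumes "v \<in> free_mod S B" "\<And>b. b \<in> B \<Longrightarrow> a b \<in> poly_ring S"
  shows "aug_map a v \<in> poly_ring S"
  unfolding aug_map_def
  by (rule poly_ring_sum) (use assms in \<open>auto simp: free_mod_def intro: poly_ring_mult\<close>)

section \<open>Homogeneous parts\<close>

lemma monom_degree_add: "monom_degree (m + n) = monom_degree m + monom_degree n"
  unfolding monom_degree_def by (rule setsum_keys_plus_distrib) auto

lemma monom_degree_0 [simp]: "monom_degree 0 = 0"
  by (simp add: monom_degree_def)

lemma monom_degree_single [simp]: "monom_degree (single x n) = n"
  by (simp add: monom_degree_def)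

lemma monom_degree_eq_0_iff [simp]: "monom_degree m = 0 \<longleftrightarrow> m = 0"
  by (metis finite_keys in_keys_iff keys_eq_empty monom_degree_0 monom_degree_def
      subsetI subset_antisym sum_eq_0_iff empty_iff)

lemma homogeneous_0_eq: "homogeneous 0 p \<Longrightarrow> p = single 0 (lookup p 0)"
  by (rule poly_mapping_eqI) (force simp: homogeneous_def in_keys_iff lookup_single when_def)

text \<open>Serves three purposes: homogeneous components of polynomials, the part of a monomial in
  given edges, and the terms of a polynomial of a given type.\<close>

definition restr :: "('a \<Rightarrow> bool) \<Rightarrow> ('a \<Rightarrow>\<^sub>0 'b::zero) \<Rightarrow> ('a \<Rightarrow>\<^sub>0 'b)" where
  "restr P p = Poly_Mapping.mapp (\<lambda>k c. if P k then c else 0) p"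

lemma lookup_restr [simp]: "lookup (restr P p) k = (if P k then lookup p k else 0)"
  by (auto simp: restr_def lookup_mapp when_def in_keys_iff)

lemma keys_restr: "keys (restr P p) = {k \<in> keys p. P k}"
  by (auto simp: in_keys_iff split: if_splits)

lemma restr_zero [simp]: "restr P 0 = 0"
  by (rule poly_mapping_eqI) auto

lemma restr_add: "restr P (p + q) = restr P p + restr P q"
  by (rule poly_mapping_eqI) (auto simp: lookup_add)

lemma restr_diff: "restr P (p - q) = restr P p - restr P q" for p :: "'a \<Rightarrow>\<^sub>0 'b::ab_group_add"
  by (rule poly_mapping_eqI) (auto simp: lookup_minus)

lemma restr_sum: "restr P (sum f A) = (\<Sum>x\<in>A. restr P (f x))"
  by (induction A rule: infinite_finite_induct) (auto simp: restr_add)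

lemma restr_single: "restr P (single k c) = (if P k then single k c else 0)"
  by (rule poly_mapping_eqI) (auto simp: lookup_single when_def)

lemma restr_poly_ring: "p \<in> poly_ring S \<Longrightarrow> restr P p \<in> poly_ring S"
  by (auto simp: poly_ring_def keys_restr)

lemma poly_mult_expand:
  "p * q = (\<Sum>m\<in>keys p. \<Sum>n\<in>keys q. single (m + n) (lookup p m * lookup q n))"
  by (subst (1) poly_mapping_expand[of p], subst (1) poly_mapping_expand[of q])
     (simp add: sum_product mult_single)

text \<open>In the applications \<open>q\<close> is homogeneous and \<open>P\<close> prescribes a
  degree, so whether a product of terms is kept depends only on the factor from
  \<open>p\<close>.\<close>

lemma restr_mult:
  assumes "\<And>m n. m \<in> keys p \<Longrightarrow> n \<in> keys q \<Longrightarrow> P (m + n) \<longleftrightarrow> Q m"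
  shows "restr P (p * q) = restr Q p * q"
proof -
  have "restr P (p * q) = (\<Sum>m\<in>keys p. if Q m then \<Sum>n\<in>keys q. single (m + n)
      (lookup p m * lookup q n) else 0)"
    unfolding poly_mult_expand[of p q] restr_sum
    by (intro sum.cong refl) (auto simp: restr_single assms)
  also have "\<dots> = restr Q p * q"
    unfolding poly_mult_expand[of "restr Q p" q] keys_restr
    by (auto simp: sum.inter_filter intro!: sum.cong)
  finally show ?thesis .
qed

text \<open>The degree \<open>d\<close> component in the sum of the shifted modules
  \<open>R(-dg b)\<close>.\<close>

definition hom_part :: "(nat \<Rightarrow> nat) \<Rightarrow> nat \<Rightarrow> (nat \<Rightarrow>\<^sub>0 ('x, 'k::zero) polynomial) \<Rightarrow> (nat \<Rightarrow>\<^sub>0 ('x, 'k)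
    polynomial)" where
  "hom_part dg d v = Poly_Mapping.mapp (\<lambda>b. restr (\<lambda>m. dg b + monom_degree m = d)) v"

lemma lookup_hom_part: "lookup (hom_part dg d v) b = restr (\<lambda>m. dg b + monom_degree m = d)
    (lookup v b)"
  by (auto simp: hom_part_def lookup_mapp when_def in_keys_iff)

lemma homogeneous_vec_iff:
  "homogeneous_vec dg d v \<longleftrightarrow> (\<forall>b. \<forall>m\<in>keys (lookup v b). dg b + monom_degree m = d)"
proof
  assume v: "homogeneous_vec dg d v"
  show "\<forall>b. \<forall>m\<in>keys (lookup v b). dg b + monom_degree m = d"
  proof (intro allI ballI)
    fix b m assume m: "m \<in> keys (lookup v b)"
    then have "b \<in> keys v" by (auto simp: in_keys_iff)
    with v m show "dg b + monom_degree m = d"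
      by (auto simp: homogeneous_vec_def homogeneous_def)
  qed
next
  assume v: "\<forall>b. \<forall>m\<in>keys (lookup v b). dg b + monom_degree m = d"
  show "homogeneous_vec dg d v"
    unfolding homogeneous_vec_def
  proof
    fix b assume "b \<in> keys v"
    then obtain m where "m \<in> keys (lookup v b)"
      by (metis in_keys_iff keys_eq_empty subsetI subset_antisym empty_iff)
    with v show "\<exists>k. dg b + k = d \<and> homogeneous k (lookup v b)"
      by (metis add_left_cancel homogeneous_def)
  qed
qed

lemma homogeneous_hom_part [simp]: "homogeneous_vec dg d (hom_part dg d v)"
  by (auto simp: homogeneous_vec_iff lookup_hom_part keys_restr)

lemma hom_part_eq: "homogeneous_vec dg d v \<Longrightarrow> hom_part dg d v = v"
  by (intro poly_mapping_eqI) (fastforce simp: lookup_hom_part homogeneous_vec_iff in_keys_iff)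

lemma hom_part_zero [simp]: "hom_part dg d 0 = 0"
  by (rule poly_mapping_eqI) (simp add: lookup_hom_part)

lemma hom_part_free_mod: "v \<in> free_mod S B \<Longrightarrow> hom_part dg d v \<in> free_mod S B"
  by (auto simp: free_mod_def lookup_hom_part in_keys_iff intro: restr_poly_ring)
     (metis in_keys_iff restr_zero subsetD)

lemma hom_part_expand:
  fixes v :: "nat \<Rightarrow>\<^sub>0 ('x, 'k::comm_monoid_add) polynomial"
  obtains D where "finite D" "v = (\<Sum>d\<in>D. hom_part dg d v)"
proof
  let ?D = "\<Union>b\<in>keys v. (\<lambda>m. dg b + monom_degree m) ` keys (lookup v b)"
  show "finite ?D" by auto
  show "v = (\<Sum>d\<in>?D. hom_part dg d v)"
  proof (intro poly_mapping_eqI)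
    fix b m
    have "lookup (lookup (\<Sum>d\<in>?D. hom_part dg d v) b) m
        = (\<Sum>d\<in>?D. if d = dg b + monom_degree m then lookup (lookup v b) m else 0)"
      by (auto simp: lookup_sum lookup_hom_part intro!: sum.cong)
    also have "\<dots> = (if dg b + monom_degree m \<in> ?D then lookup (lookup v b) m else 0)"
      by (rule sum.delta) (rule \<open>finite ?D\<close>)
    also have "\<dots> = lookup (lookup v b) m"
    proof (cases "lookup (lookup v b) m = 0")
      case False
      then have "m \<in> keys (lookup v b)" "b \<in> keys v" by (auto simp: in_keys_iff)
      then show ?thesis by auto
    qed auto
    finally show "lookup (lookup v b) m = lookup (lookup (\<Sum>d\<in>?D. hom_part dg d v) b) m" by simp
  qed
qed

text \<open>A map whose value at each basis element has the degree of that element preserves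
  degrees. Arbitrary preimages can thereby be replaced by homogeneous ones.\<close>

lemma hom_part_lin_ext:
  assumes "\<And>b. b \<in> keys v \<Longrightarrow> homogeneous_vec dg (dg' b) (f b)"
  shows "hom_part dg d (lin_ext f v) = lin_ext f (hom_part dg' d v)"
proof (rule poly_mapping_eqI)
  fix c
  have "lookup (hom_part dg d (lin_ext f v)) c
      = (\<Sum>b\<in>keys v. restr (\<lambda>m. dg c + monom_degree m = d) (lookup v b * lookup (f b) c))"
    by (simp add: lookup_hom_part lookup_lin_ext restr_sum)
  also have "\<dots> = (\<Sum>b\<in>keys v. restr (\<lambda>m. dg' b + monom_degree m = d) (lookup v b) * lookup (f b) c)"
  proof (intro sum.cong refl restr_mult)
    fix b m n assume "b \<in> keys v" "n \<in> keys (lookup (f b) c)"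
    then have "dg c + monom_degree n = dg' b" using assms by (auto simp: homogeneous_vec_iff)
    then show "(dg c + monom_degree (m + n) = d) = (dg' b + monom_degree m = d)"
      by (auto simp: monom_degree_add)
  qed
  also have "\<dots> = (\<Sum>b\<in>keys v. lookup (vec_scale (lookup (hom_part dg' d v) b) (f b)) c)"
    by (simp add: lookup_hom_part)
  also have "\<dots> = lookup (lin_ext f (hom_part dg' d v)) c"
    by (subst lin_ext_superset[where A = "keys v"])
       (auto simp: lookup_sum in_keys_iff lookup_hom_part)
  finally show "lookup (hom_part dg d (lin_ext f v)) c = lookup (lin_ext f (hom_part dg' d v)) c" .
qed

lemma aug_map_hom_part:
  assumes "\<And>b. b \<in> keys v \<Longrightarrow> homogeneous (dg b) (a b)"
  shows "restr (\<lambda>m. monom_degree m = d) (aug_map a v) = aug_map a (hom_part dg d v)"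
proof -
  have "restr (\<lambda>m. monom_degree m = d) (aug_map a v)
      = (\<Sum>b\<in>keys v. restr (\<lambda>m. dg b + monom_degree m = d) (lookup v b) * a b)"
    unfolding aug_map_def restr_sum
  proof (intro sum.cong refl restr_mult)
    fix b m n assume "b \<in> keys v" "n \<in> keys (a b)"
    then have "monom_degree n = dg b" using assms by (auto simp: homogeneous_def)
    then show "(monom_degree (m + n) = d) = (dg b + monom_degree m = d)"
      by (auto simp: monom_degree_add)
  qed
  also have "\<dots> = aug_map a (hom_part dg d v)"
    unfolding aug_map_def
    by (subst sum_keys_superset[where A = "keys v" and f = "\<lambda>b c. c * a b"])
       (auto simp: in_keys_iff lookup_hom_part)
  finally show ?thesis .
qed

lemma homogeneous_lin_ext:
  assumes "\<And>b. b \<in> keys v \<Longrightarrow> homogeneous_vec dg (dg' b) (f b)" "homogeneous_vec dg' d v"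
  shows "homogeneous_vec dg d (lin_ext f v)"
  by (metis assms hom_part_eq hom_part_lin_ext homogeneous_hom_part)

lemma homogeneous_vec_add: "homogeneous_vec dg d v \<Longrightarrow> homogeneous_vec dg d w \<Longrightarrow>
    homogeneous_vec dg d (v + w)"
  unfolding homogeneous_vec_iff lookup_add by (auto dest!: subsetD[OF keys_add])

lemma homogeneous_vec_diff: "homogeneous_vec dg d v \<Longrightarrow> homogeneous_vec dg d w \<Longrightarrow>
    homogeneous_vec dg d (v - w)"
  for v :: "nat \<Rightarrow>\<^sub>0 ('x, 'k::ab_group_add) polynomial"
  unfolding homogeneous_vec_iff lookup_minus by (auto dest!: subsetD[OF keys_diff])

lemma homogeneous_vec_zero [simp]: "homogeneous_vec dg d 0"
  by (simp add: homogeneous_vec_def)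

lemma homogeneous_vec_single: "homogeneous k p \<Longrightarrow> dg b + k = d \<Longrightarrow> homogeneous_vec dg d (single b p)"
  by (auto simp: homogeneous_vec_def)

lemma homogeneous_vec_scale:
  assumes "homogeneous k p" "homogeneous_vec dg d v"
  shows "homogeneous_vec dg (k + d) (vec_scale p v)"
  unfolding homogeneous_vec_iff lookup_vec_scale
proof (intro allI ballI)
  fix b m assume "m \<in> keys (p * lookup v b)"
  then obtain m1 m2 where "m = m1 + m2" "m1 \<in> keys p" "m2 \<in> keys (lookup v b)"
    using keys_mult by blast
  then show "dg b + monom_degree m = k + d"
    using assms by (auto simp: monom_degree_add homogeneous_def homogeneous_vec_iff)
qed

section \<open>Constant coefficients\<close>

lemma add_eq_0_poly_mapping_nat: "m + n = 0 \<longleftrightarrow> m = 0 \<and> n = 0" for m n :: "'x \<Rightarrow>\<^sub>0 nat"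
proof -
  have "m + n = 0 \<longleftrightarrow> monom_degree (m + n) = 0" by (simp only: monom_degree_eq_0_iff)
  also have "\<dots> \<longleftrightarrow> m = 0 \<and> n = 0" by (simp only: monom_degree_add add_is_0 monom_degree_eq_0_iff)
  finally show ?thesis .
qed

text \<open>Exponents are natural numbers, so only \<open>0 + 0\<close> gives the exponent
  \<open>0\<close>. Taking constant coefficients is thus the ring homomorphism to \<open>K\<close>
  that kills all variables, and \<open>const_vec\<close> is reduction modulo the variables.\<close>

lemma lookup_mult_0: "lookup (p * q) 0 = lookup p 0 * lookup q 0"
  for p q :: "('x, 'k::comm_ring_1) polynomial"
proof -
  have "lookup (p * q) 0 = (\<Sum>m\<in>keys p. \<Sum>n\<in>keys q. if m = 0 then if n =
      0 then lookup p m * lookup q n else 0 else 0)"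
    unfolding poly_mult_expand lookup_sum
    by (intro sum.cong refl) (auto simp: lookup_single when_def add_eq_0_poly_mapping_nat)
  also have "\<dots> = (\<Sum>m\<in>keys p. if m = 0 then \<Sum>n\<in>keys q. if n =
      0 then lookup p m * lookup q n else 0 else 0)"
    by (intro sum.cong refl) auto
  also have "\<dots> = lookup p 0 * lookup q 0"
    by (simp only: sum.delta finite_keys) (simp add: in_keys_iff)
  finally show ?thesis .
qed

definition const_vec :: "(nat \<Rightarrow>\<^sub>0 ('x, 'k::comm_ring_1) polynomial) \<Rightarrow> (nat \<Rightarrow>\<^sub>0 'k)" where
  "const_vec v = Poly_Mapping.map (\<lambda>p. lookup p 0) v"

lemma lookup_const_vec [simp]: "lookup (const_vec v) b = lookup (lookup v b) 0"
  by (auto simp: const_vec_def Poly_Mapping.map.rep_eq when_def)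

lemma keys_const_vec: "keys (const_vec v) \<subseteq> keys v"
  by (auto simp: in_keys_iff)

lemma const_vec_zero [simp]: "const_vec 0 = 0"
  by (rule poly_mapping_eqI) simp

lemma const_vec_add: "const_vec (v + w) = const_vec v + const_vec w"
  by (rule poly_mapping_eqI) (simp add: lookup_add)

lemma const_vec_diff: "const_vec (v - w) = const_vec v - const_vec w"
  by (rule poly_mapping_eqI) (simp add: lookup_minus)

lemma const_vec_lin_ext: "const_vec (lin_ext f v) = lin_ext (\<lambda>b. const_vec (f b)) (const_vec v)"
  by (rule poly_mapping_eqI)
     (simp add: lin_ext_superset[OF finite_keys keys_const_vec] lookup_sum lookup_lin_ext
         lookup_mult_0)

text \<open>A section of \<open>const_vec\<close>: it lifts vectors over \<open>K\<close> to the
  free module, where the grading of maps between free modules is available.\<close>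

definition vec_const :: "(nat \<Rightarrow>\<^sub>0 'k::comm_ring_1) \<Rightarrow> (nat \<Rightarrow>\<^sub>0 ('x, 'k) polynomial)" where
  "vec_const w = Poly_Mapping.map poly_const w"

lemma lookup_vec_const [simp]: "lookup (vec_const w) b = poly_const (lookup w b)"
  by (auto simp: vec_const_def Poly_Mapping.map.rep_eq when_def poly_const_def)

lemma const_vec_vec_const [simp]: "const_vec (vec_const w) = w"
  by (rule poly_mapping_eqI) (simp add: poly_const_def)

lemma vec_const_free_mod: "keys w \<subseteq> B \<Longrightarrow> vec_const w \<in> free_mod S B"
  unfolding free_mod_def by (auto simp: in_keys_iff poly_const_def intro!: poly_ring_single)
    (metis in_keys_iff single_zero subsetD)

lemma homogeneous_vec_const: "(\<And>b. b \<in> keys w \<Longrightarrow> dg b = d) \<Longrightarrow> homogeneous_vec dg d (vec_const w)"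
  by (auto simp: homogeneous_vec_iff poly_const_def in_keys_iff split: if_splits)

section \<open>Comparison of resolutions\<close>

definition graded_ideal :: "'x set \<Rightarrow> ('x, 'k::comm_ring_1) polynomial set \<Rightarrow> bool" where
  "graded_ideal S I \<longleftrightarrow> I \<subseteq> poly_ring S \<and> 0 \<in> I \<and> (\<forall>p\<in>I. \<forall>q\<in>I. p + q \<in> I) \<and>
     (\<forall>r\<in>poly_ring S. \<forall>p\<in>I. r * p \<in> I) \<and> (\<forall>p\<in>I. \<forall>d. restr (\<lambda>m. monom_degree m = d) p \<in> I)"

lemma graded_ideal_uminus: "graded_ideal S I \<Longrightarrow> p \<in> I \<Longrightarrow> - p \<in> I"
  unfolding graded_ideal_def by (metis mult_minus1 poly_ring_1 poly_ring_uminus)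

lemma graded_ideal_diff: "graded_ideal S I \<Longrightarrow> p \<in> I \<Longrightarrow> q \<in> I \<Longrightarrow> p - q \<in> I"
  using graded_ideal_uminus[of S I q] unfolding graded_ideal_def by (metis diff_conv_add_uminus)

lemma graded_ideal_sum: "graded_ideal S I \<Longrightarrow> (\<And>x. x \<in> A \<Longrightarrow> f x \<in> I) \<Longrightarrow> sum f A \<in> I"
  by (induction A rule: infinite_finite_induct) (auto simp: graded_ideal_def)

text \<open>Treats the kernel of \<open>F\<^sub>0 \<rightarrow> R/I\<close> and the kernels of the
  boundary maps uniformly, so that exactness in all positions becomes the one equation
  \<open>syz_eq\<close>.\<close>

definition syz :: "'x set \<Rightarrow> ('x, 'k::comm_ring_1) polynomial set \<Rightarrow> ('x, 'k) free_complex \<Rightarrow> nat \<Rightarrow>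
    (nat \<Rightarrow>\<^sub>0 ('x, 'k) polynomial) set" where
  "syz S I F i = {v \<in> free_mod S (gens F i).
     case i of 0 \<Rightarrow> aug_map (aug F) v \<in> I | Suc i' \<Rightarrow> lin_ext (bdry F i') v = 0}"

lemma syz_0: "syz S I F 0 = {v \<in> free_mod S (gens F 0). aug_map (aug F) v \<in> I}"
  and syz_Suc: "syz S I F (Suc i) = {v \<in> free_mod S (gens F (Suc i)). lin_ext (bdry F i) v = 0}"
  by (simp_all add: syz_def)

lemma syz_free_mod: "v \<in> syz S I F i \<Longrightarrow> v \<in> free_mod S (gens F i)"
  by (simp add: syz_def)

lemma submodule_syz:
  assumes "graded_ideal S I"
  shows "submodule S (syz S I F i)"
  using submodule_free_mod[of S "gens F i"] assms
  unfolding submodule_def syz_def graded_ideal_def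
  by (auto simp: lin_ext_add lin_ext_scale aug_map_add aug_map_scale split: nat.splits)

locale resolution =
  fixes S :: "'x set" and I :: "('x, 'k::comm_ring_1) polynomial set" and F :: "('x, 'k)
      free_complex"
  assumes res: "graded_free_resolution S I F" and ideal: "graded_ideal S I"
begin

lemma finite_gens: "finite {b \<in> gens F i. gdeg F i b = d}"
  using res by (simp add: graded_free_resolution_def)

lemma bdry_free_mod: "b \<in> gens F (Suc i) \<Longrightarrow> bdry F i b \<in> free_mod S (gens F i)"
  and bdry_homogeneous: "b \<in> gens F (Suc i) \<Longrightarrow> homogeneous_vec (gdeg F i) (gdeg F (Suc i) b)
      (bdry F i b)"
  and aug_poly_ring: "b \<in> gens F 0 \<Longrightarrow> aug F b \<in> poly_ring S"
  and aug_homogeneous: "b \<in> gens F 0 \<Longrightarrow> homogeneous (gdeg F 0 b) (aug F b)"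
  using res by (simp_all add: graded_free_resolution_def)

lemma aug_surj: "p \<in> poly_ring S \<Longrightarrow> \<exists>v\<in>free_mod S (gens F 0). p - aug_map (aug F) v \<in> I"
  using res by (simp add: graded_free_resolution_def)

lemma syz_eq: "syz S I F i = lin_ext (bdry F i) ` free_mod S (gens F (Suc i))"
  using res unfolding graded_free_resolution_def syz_def by (cases i) auto

lemma bdry_syz: "b \<in> gens F (Suc i) \<Longrightarrow> bdry F i b \<in> syz S I F i"
  unfolding syz_eq by (rule image_eqI[where x = "single b 1"]) (auto intro: free_mod_single)

lemma bdry_bdry: "b \<in> gens F (Suc (Suc i)) \<Longrightarrow> lin_ext (bdry F i) (bdry F (Suc i) b) = 0"
  using bdry_syz[of b "Suc i"] by (simp add: syz_Suc)

lemma syz_lift: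
  assumes v: "v \<in> syz S I F i" "homogeneous_vec (gdeg F i) d v"
  shows "\<exists>w\<in>free_mod S (gens F (Suc i)). homogeneous_vec (gdeg F (Suc i)) d w \<and> lin_ext (bdry F i)
      w = v"
proof -
  obtain w where w: "w \<in> free_mod S (gens F (Suc i))" "lin_ext (bdry F i) w = v"
    using v(1) unfolding syz_eq by auto
  have "keys w \<subseteq> gens F (Suc i)" using w(1) by (simp add: free_mod_def)
  then have "lin_ext (bdry F i) (hom_part (gdeg F (Suc i)) d w) = hom_part (gdeg F i) d v"
    unfolding w(2)[symmetric] by (intro hom_part_lin_ext[symmetric]) (auto intro: bdry_homogeneous)
  also have "\<dots> = v" by (rule hom_part_eq[OF v(2)])
  finally show ?thesis using w(1) hom_part_free_mod homogeneous_hom_part by blast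
qed

lemma aug_surj_homogeneous:
  assumes "p \<in> poly_ring S" "homogeneous d p"
  shows "\<exists>v\<in>free_mod S (gens F 0). homogeneous_vec (gdeg F 0) d v \<and> p - aug_map (aug F) v \<in> I"
proof -
  obtain v where v: "v \<in> free_mod S (gens F 0)" "p - aug_map (aug F) v \<in> I"
    using aug_surj[OF assms(1)] by blast
  have kv: "keys v \<subseteq> gens F 0" using v by (simp add: free_mod_def)
  have "restr (\<lambda>m. monom_degree m = d) p = p"
    using assms(2) by (intro poly_mapping_eqI) (auto simp: homogeneous_def in_keys_iff)
  moreover have "restr (\<lambda>m. monom_degree m = d) (aug_map (aug F) v) = aug_map (aug F)
      (hom_part (gdeg F 0) d v)"
    by (rule aug_map_hom_part) (use kv aug_homogeneous in auto)
  moreover have "restr (\<lambda>m. monom_degree m = d) (p - aug_map (aug F) v) \<in> I"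
    using ideal v(2) by (simp add: graded_ideal_def)
  ultimately have "p - aug_map (aug F) (hom_part (gdeg F 0) d v) \<in> I"
    by (simp add: restr_diff)
  then show ?thesis using v(1) hom_part_free_mod homogeneous_hom_part by blast
qed

end

definition level_map :: "'x set \<Rightarrow> nat set \<Rightarrow> (nat \<Rightarrow> nat) \<Rightarrow> nat set \<Rightarrow> (nat \<Rightarrow> nat) \<Rightarrow>
    (nat \<Rightarrow> (nat \<Rightarrow>\<^sub>0 ('x, 'k::comm_ring_1) polynomial)) \<Rightarrow> bool" where
  "level_map S B dB C dC f \<longleftrightarrow> (\<forall>b\<in>B. f b \<in> free_mod S C \<and> homogeneous_vec dC (dB b) (f b))"

text \<open>The source is free and the target exact, so values are lifted one basis element at a
  time. The induction carries that cycles go to cycles: this makes the image of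
  \<open>bdry F i b\<close> a cycle of \<open>G\<close>, which has a homogeneous preimage.\<close>

lemma chain_map_exists:
  assumes "resolution S I F" "resolution S I G"
  obtains f where "\<And>i. level_map S (gens F i) (gdeg F i) (gens G i) (gdeg G i) (f i)"
    "\<And>b. b \<in> gens F 0 \<Longrightarrow> aug F b - aug_map (aug G) (f 0 b) \<in> I"
    "\<And>i b. b \<in> gens F (Suc i) \<Longrightarrow> lin_ext (bdry G i) (f (Suc i) b) = lin_ext (f i) (bdry F i b)"
proof -
  interpret F: resolution S I F by fact
  interpret G: resolution S I G by fact
  let ?P = "\<lambda>i f. level_map S (gens F i) (gdeg F i) (gens G i) (gdeg G i) f \<and>
    (\<forall>v\<in>syz S I F i. lin_ext f v \<in> syz S I G i) \<and>
    (i = 0 \<longrightarrow> (\<forall>b\<in>gens F 0. aug F b - aug_map (aug G) (f b) \<in> I))"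
  let ?Q = "\<lambda>i f g. \<forall>b\<in>gens F (Suc i). lin_ext (bdry G i) (g b) = lin_ext f (bdry F i b)"
  have "\<exists>f. \<forall>n. ?P n (f n) \<and> ?Q n (f n) (f (Suc n))"
  proof (rule dependent_nat_choice)
    have "\<forall>b\<in>gens F 0. \<exists>v. v \<in> free_mod S (gens G 0) \<and> homogeneous_vec (gdeg G 0) (gdeg F 0 b) v \<and>
        aug F b - aug_map (aug G) v \<in> I"
      using G.aug_surj_homogeneous F.aug_poly_ring F.aug_homogeneous by blast
    from bchoice[OF this] obtain f where f: "\<And>b. b \<in> gens F 0 \<Longrightarrow> f b \<in> free_mod S (gens G 0) \<and>
        homogeneous_vec (gdeg G 0) (gdeg F 0 b) (f b) \<and> aug F b - aug_map (aug G) (f b) \<in> I"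
            by blast
    have "lin_ext f v \<in> syz S I G 0" if v: "v \<in> syz S I F 0" for v
    proof -
      have v': "v \<in> free_mod S (gens F 0)" "aug_map (aug F) v \<in> I" using v by (auto simp: syz_0)
      then have kv: "keys v \<subseteq> gens F 0" by (simp add: free_mod_def)
      have "aug_map (aug F) v - aug_map (aug G) (lin_ext f v)
          = (\<Sum>b\<in>keys v. lookup v b * (aug F b - aug_map (aug G) (f b)))"
        by (simp add: aug_map_lin_ext) (simp add: aug_map_def right_diff_distrib sum_subtractf)
      also have "\<dots> \<in> I"
        by (rule graded_ideal_sum[OF F.ideal])
           (use f kv v' F.ideal in \<open>auto simp: graded_ideal_def free_mod_def\<close>)
      finally have "aug_map (aug G) (lin_ext f v) \<in> I"
        using graded_ideal_diff[OF F.ideal v'(2)] by fastforce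
      moreover have "lin_ext f v \<in> free_mod S (gens G 0)"
        by (rule lin_ext_free_mod[OF v'(1)]) (use f in auto)
      ultimately show ?thesis by (simp add: syz_0)
    qed
    then show "\<exists>f. ?P 0 f" using f unfolding level_map_def by blast
  next
    fix f i assume Pf: "?P i f"
    have "\<exists>w\<in>free_mod S (gens G (Suc i)). homogeneous_vec (gdeg G (Suc i)) (gdeg F (Suc i) b) w \<and>
        lin_ext (bdry G i) w = lin_ext f (bdry F i b)" if b: "b \<in> gens F (Suc i)" for b
    proof (rule G.syz_lift)
      show "lin_ext f (bdry F i b) \<in> syz S I G i" using Pf F.bdry_syz[OF b] by blast
      have "keys (bdry F i b) \<subseteq> gens F i" using F.bdry_free_mod[OF b] by (simp add: free_mod_def)
      then show "homogeneous_vec (gdeg G i) (gdeg F (Suc i) b) (lin_ext f (bdry F i b))"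
        by (intro homogeneous_lin_ext[OF _ F.bdry_homogeneous[OF b]])
            (use Pf in \<open>auto simp: level_map_def\<close>)
    qed
    then have "\<forall>b\<in>gens F (Suc i). \<exists>w. w \<in> free_mod S (gens G (Suc i)) \<and>
        homogeneous_vec (gdeg G (Suc i)) (gdeg F (Suc i) b) w \<and> lin_ext (bdry G i) w =
            lin_ext f (bdry F i b)" by blast
    from bchoice[OF this] obtain g where g: "\<And>b. b \<in> gens F (Suc i) \<Longrightarrow> g b \<in>
        free_mod S (gens G (Suc i)) \<and>
        homogeneous_vec (gdeg G (Suc i)) (gdeg F (Suc i) b) (g b) \<and> lin_ext (bdry G i) (g b) =
            lin_ext f (bdry F i b)"
      by blast
    have "lin_ext g v \<in> syz S I G (Suc i)" if v: "v \<in> syz S I F (Suc i)" for v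
    proof -
      have v': "v \<in> free_mod S (gens F (Suc i))" "lin_ext (bdry F i) v = 0"
          using v by (auto simp: syz_Suc)
      then have kv: "keys v \<subseteq> gens F (Suc i)" by (simp add: free_mod_def)
      have "lin_ext (bdry G i) (lin_ext g v) = lin_ext (\<lambda>b. lin_ext f (bdry F i b)) v"
        unfolding lin_ext_lin_ext by (rule lin_ext_cong) (use g kv in auto)
      also have "\<dots> = 0" by (simp add: v' flip: lin_ext_lin_ext)
      finally show ?thesis using lin_ext_free_mod[OF v'(1), of g] g by (auto simp: syz_Suc)
    qed
    then show "\<exists>g. ?P (Suc i) g \<and> ?Q i f g" using g unfolding level_map_def by blast
  qed
  then obtain f where f: "\<forall>n. ?P n (f n) \<and> ?Q n (f n) (f (Suc n))" ..
  show ?thesis by (rule that[of f]) (use f in simp_all)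
qed

text \<open>Each value of \<open>f (Suc i)\<close> minus the part already produced by
  \<open>h\<close> is a cycle of the exact complex \<open>G\<close>, hence a boundary; this is the
  invariant in \<open>?P\<close>. The start is possible because \<open>f\<close> induces zero on
  \<open>R/I\<close>.\<close>

lemma chain_homotopy_exists:
  assumes "resolution S I F" "resolution S I G"
    and lvl: "\<And>i. level_map S (gens F i) (gdeg F i) (gens G i) (gdeg G i) (f i)"
    and aug: "\<And>b. b \<in> gens F 0 \<Longrightarrow> aug_map (aug G) (f 0 b) \<in> I"
    and comm: "\<And>i b. b \<in> gens F (Suc i) \<Longrightarrow> lin_ext (bdry G i) (f (Suc i) b) = lin_ext (f i)
        (bdry F i b)"
  obtains h where "\<And>i. level_map S (gens F i) (gdeg F i) (gens G (Suc i)) (gdeg G (Suc i)) (h i)"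
    "\<And>b. b \<in> gens F 0 \<Longrightarrow> lin_ext (bdry G 0) (h 0 b) = f 0 b"
    "\<And>i b. b \<in> gens F (Suc i) \<Longrightarrow> lin_ext (bdry G (Suc i)) (h (Suc i) b) + lin_ext (h i) (bdry F i b)
        = f (Suc i) b"
proof -
  interpret F: resolution S I F by fact
  interpret G: resolution S I G by fact
  let ?P = "\<lambda>i h. level_map S (gens F i) (gdeg F i) (gens G (Suc i)) (gdeg G (Suc i)) h \<and>
    (\<forall>b\<in>gens F (Suc i). f (Suc i) b - lin_ext h (bdry F i b) \<in> syz S I G (Suc i)) \<and>
    (i = 0 \<longrightarrow> (\<forall>b\<in>gens F 0. lin_ext (bdry G 0) (h b) = f 0 b))"
  let ?Q = "\<lambda>i h k. \<forall>b\<in>gens F (Suc i). lin_ext (bdry G (Suc i)) (k b) = f (Suc i)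
      b - lin_ext h (bdry F i b)"
  have kb: "keys (bdry F i b) \<subseteq> gens F i" if "b \<in> gens F (Suc i)" for i b
    using F.bdry_free_mod[OF that] by (simp add: free_mod_def)
  have diff_free: "f (Suc i) b - lin_ext h (bdry F i b) \<in> free_mod S (gens G (Suc i))"
    if "b \<in> gens F (Suc i)" "level_map S (gens F i) (gdeg F i) (gens G (Suc i)) (gdeg G (Suc i)) h"
        for i b h
  proof (rule submodule_diff[OF submodule_free_mod])
    show "f (Suc i) b \<in> free_mod S (gens G (Suc i))" using lvl that(1) by (simp add: level_map_def)
    show "lin_ext h (bdry F i b) \<in> free_mod S (gens G (Suc i))"
      by (rule lin_ext_free_mod[OF F.bdry_free_mod[OF that(1)]]) (use that(2)
          in \<open>simp add: level_map_def\<close>)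
  qed
  have diff_hom: "homogeneous_vec (gdeg G (Suc i)) (gdeg F (Suc i) b) (f (Suc i)
      b - lin_ext h (bdry F i b))"
    if "b \<in> gens F (Suc i)" "level_map S (gens F i) (gdeg F i) (gens G (Suc i)) (gdeg G (Suc i)) h"
        for i b h
  proof (rule homogeneous_vec_diff)
    show "homogeneous_vec (gdeg G (Suc i)) (gdeg F (Suc i) b) (f (Suc i) b)"
      using lvl that(1) by (simp add: level_map_def)
    show "homogeneous_vec (gdeg G (Suc i)) (gdeg F (Suc i) b) (lin_ext h (bdry F i b))"
      by (intro homogeneous_lin_ext[OF _ F.bdry_homogeneous[OF that(1)]])
         (use that(2) kb[OF that(1)] in \<open>auto simp: level_map_def\<close>)
  qed
  have "\<exists>h. \<forall>n. ?P n (h n) \<and> ?Q n (h n) (h (Suc n))"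
  proof (rule dependent_nat_choice)
    have "\<exists>w\<in>free_mod S (gens G (Suc 0)). homogeneous_vec (gdeg G (Suc 0)) (gdeg F 0 b) w \<and>
        lin_ext (bdry G 0) w = f 0 b" if b: "b \<in> gens F 0" for b
      by (rule G.syz_lift) (use lvl[of 0] aug b in \<open>auto simp: syz_0 level_map_def\<close>)
    then have "\<forall>b\<in>gens F 0. \<exists>w. w \<in> free_mod S (gens G (Suc 0)) \<and>
        homogeneous_vec (gdeg G (Suc 0)) (gdeg F 0 b) w \<and> lin_ext (bdry G 0) w = f 0 b" by blast
    from bchoice[OF this] obtain h where h: "\<And>b. b \<in> gens F 0 \<Longrightarrow> h b \<in> free_mod S (gens G (Suc 0)) \<and>
        homogeneous_vec (gdeg G (Suc 0)) (gdeg F 0 b) (h b) \<and> lin_ext (bdry G 0) (h b) = f 0 b"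
            by blast
    have lh: "level_map S (gens F 0) (gdeg F 0) (gens G (Suc 0)) (gdeg G (Suc 0)) h"
      using h by (simp add: level_map_def)
    have "f (Suc 0) b - lin_ext h (bdry F 0 b) \<in> syz S I G (Suc 0)" if b: "b \<in> gens F (Suc 0)" for b
    proof -
      have "lin_ext (bdry G 0) (lin_ext h (bdry F 0 b)) = lin_ext (f 0) (bdry F 0 b)"
        unfolding lin_ext_lin_ext by (rule lin_ext_cong) (use h kb[OF b] in auto)
      then show ?thesis using diff_free[OF b lh] comm[OF b] by (simp add: syz_Suc lin_ext_diff)
    qed
    with lh h show "\<exists>h. ?P 0 h" by blast
  next
    fix h i assume Ph: "?P i h"
    then have lh: "level_map S (gens F i) (gdeg F i) (gens G (Suc i)) (gdeg G (Suc i)) h" by blast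
    have "\<exists>w\<in>free_mod S (gens G (Suc (Suc i))). homogeneous_vec (gdeg G (Suc (Suc i)))
        (gdeg F (Suc i) b) w \<and>
        lin_ext (bdry G (Suc i)) w = f (Suc i) b - lin_ext h (bdry F i b)" if b: "b \<in>
            gens F (Suc i)" for b
      by (rule G.syz_lift) (use Ph b diff_hom[OF b lh] in auto)
    then have "\<forall>b\<in>gens F (Suc i). \<exists>w. w \<in> free_mod S (gens G (Suc (Suc i))) \<and>
        homogeneous_vec (gdeg G (Suc (Suc i))) (gdeg F (Suc i) b) w \<and>
        lin_ext (bdry G (Suc i)) w = f (Suc i) b - lin_ext h (bdry F i b)" by blast
    from bchoice[OF this] obtain k where k: "\<And>b. b \<in> gens F (Suc i) \<Longrightarrow> k b \<in>
        free_mod S (gens G (Suc (Suc i))) \<and>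
        homogeneous_vec (gdeg G (Suc (Suc i))) (gdeg F (Suc i) b) (k b) \<and>
        lin_ext (bdry G (Suc i)) (k b) = f (Suc i) b - lin_ext h (bdry F i b)" by blast
    have lk: "level_map S (gens F (Suc i)) (gdeg F (Suc i)) (gens G (Suc (Suc i)))
        (gdeg G (Suc (Suc i))) k"
      using k by (simp add: level_map_def)
    have "f (Suc (Suc i)) b - lin_ext k (bdry F (Suc i) b) \<in> syz S I G (Suc (Suc i))"
      if b: "b \<in> gens F (Suc (Suc i))" for b
    proof -
      have "lin_ext (bdry G (Suc i)) (lin_ext k (bdry F (Suc i) b))
          = lin_ext (\<lambda>c. f (Suc i) c - lin_ext h (bdry F i c)) (bdry F (Suc i) b)"
        unfolding lin_ext_lin_ext by (rule lin_ext_cong) (use k kb[OF b] in auto)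
      also have "\<dots> = lin_ext (f (Suc i)) (bdry F (Suc i) b)"
        using F.bdry_bdry[OF b] by (simp add: lin_ext_fun_diff flip: lin_ext_lin_ext)
      finally show ?thesis using diff_free[OF b lk] comm[OF b] by (simp add: syz_Suc lin_ext_diff)
    qed
    with lk k show "\<exists>k. ?P (Suc i) k \<and> ?Q i h k" by blast
  qed
  then obtain h where h: "\<forall>n. ?P n (h n) \<and> ?Q n (h n) (h (Suc n))" ..
  show ?thesis
  proof (rule that[of h])
    fix i b assume "b \<in> gens F (Suc i)"
    then show "lin_ext (bdry G (Suc i)) (h (Suc i) b) + lin_ext (h i) (bdry F i b) = f (Suc i) b"
      using h by simp
  qed (use h in simp_all)
qed

section \<open>Dimension counts\<close>

context vector_space
begin

lemma span_Int_independent: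
  assumes "finite D" "independent (A \<union> D)" "A \<inter> D = {}"
  shows "span A \<inter> span D = {0}"
  using assms
proof (induction D)
  case empty
  then show ?case by (auto simp: span_zero)
next
  case (insert d D)
  have IH: "span A \<inter> span D = {0}"
    using insert by (metis Un_insert_right disjoint_insert(2) independent_mono subset_insertI)
  have d: "d \<notin> span (A \<union> D)"
    using insert.prems insert.hyps by (simp add: independent_insert split: if_splits)
  have "x = 0" if x: "x \<in> span A" "x \<in> span (insert d D)" for x
  proof -
    obtain k where k: "x - scale k d \<in> span D" using x(2) span_breakdown_eq by blast
    have "k = 0"
    proof (rule ccontr)
      assume "k \<noteq> 0"
      have "x - (x - scale k d) \<in> span (A \<union> D)"
        by (rule span_diff) (use x k span_mono[of A "A \<union> D"] span_mono[of D "A \<union> D"] in auto)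
      then have "scale k d \<in> span (A \<union> D)" by simp
      then have "scale (inverse k) (scale k d) \<in> span (A \<union> D)" by (rule span_scale)
      moreover have "scale (inverse k) (scale k d) = d" using \<open>k \<noteq> 0\<close> by simp
      ultimately show False using d by simp
    qed
    then show ?thesis using k x IH by auto
  qed
  then show ?case by (auto simp: span_zero)
qed

lemma independent_Un_span_Int:
  assumes "finite D" "independent A" "independent D" "span A \<inter> span D = {0}"
  shows "independent (A \<union> D)"
  using assms
proof (induction D)
  case empty
  then show ?case by simp
next
  case (insert d D)
  have iD: "independent D" "d \<notin> span D"
    using insert.prems insert.hyps by (auto simp: independent_insert)
  have "span A \<inter> span D = {0}"
    using insert.prems(3) span_mono[of D "insert d D"] span_zero by blast
  then have "independent (A \<union> D)" using insert iD by blast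
  moreover have "d \<notin> span (A \<union> D)"
  proof
    assume "d \<in> span (A \<union> D)"
    then obtain a x where a: "d = a + x" "a \<in> span A" "x \<in> span D" by (auto simp: span_Un)
    have "d - x \<in> span (insert d D)"
      by (rule span_diff) (use a span_mono[of D "insert d D"] span_base in auto)
    then have "a = 0" using a insert.prems(3) by auto
    then show False using a iD by simp
  qed
  ultimately show ?case by (simp add: independent_insertI)
qed

text \<open>A complement \<open>D\<close> of \<open>B\<close> in \<open>Z\<close> is mapped
  injectively by \<open>f\<close>, and the image of its span meets \<open>B'\<close> only in
  \<open>0\<close>. A basis of \<open>B'\<close> together with the image of \<open>D\<close> is
  therefore independent in \<open>Z'\<close>.\<close>

lemma quotient_dim_le:
  assumes sub: "subspace Z" "subspace B" "subspace Z'" "subspace B'"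
    and incl: "B \<subseteq> Z" "B' \<subseteq> Z'" and fin: "Z \<subseteq> span X" "finite X" "Z' \<subseteq> span X'" "finite X'"
    and f: "Vector_Spaces.linear scale scale f" "f ` Z \<subseteq> Z'" "\<And>z. z \<in> Z \<Longrightarrow> f z \<in> B' \<Longrightarrow> z \<in> B"
  shows "dim Z - dim B \<le> dim Z' - dim B'"
proof -
  interpret f: Vector_Spaces.linear scale scale f by fact
  obtain b where b: "b \<subseteq> B" "independent b" "B \<subseteq> span b" "card b = dim B"
      using basis_exists by blast
  obtain c where c: "b \<subseteq> c" "c \<subseteq> Z" "independent c" "Z \<subseteq> span c"
    using maximal_independent_subset_extend[of b Z] b(1,2) incl(1) by (metis subset_trans)
  obtain b' where b': "b' \<subseteq> B'" "independent b'" "B' \<subseteq> span b'" "card b' = dim B'"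
      using basis_exists by blast
  have fc: "finite c" using independent_span_bound[OF fin(2) c(3)] c(2) fin(1) by blast
  have fb': "finite b'" using independent_span_bound[OF fin(4) b'(2)] b'(1) incl fin(3) by blast
  define D where "D = c - b"
  have D: "finite D" "independent D" "D \<subseteq> Z"
    using fc c independent_mono[of c D] unfolding D_def by auto
  have cD: "card D = dim Z - dim B"
    using card_Diff_subset[of b c] fc c b finite_subset basis_card_eq_dim[OF c(2,4,3)] unfolding
        D_def by metis
  have span_B: "span b = B" "span b' = B'"
    using b b' sub span_minimal by (meson antisym)+
  have spD: "span D \<subseteq> Z" using D sub span_minimal by blast
  have "b \<union> D = c" "b \<inter> D = {}" using c unfolding D_def by auto
  then have int: "B \<inter> span D = {0}" using span_Int_independent[of D b] D c span_B by simp
  have ker: "z = 0" if "z \<in> span D" "f z \<in> B'" for z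
    using that f(3)[of z] spD int by auto
  have zB': "0 \<in> B'" using sub subspace_0 by blast
  have inj: "inj_on f (span D)"
    unfolding f.inj_on_iff_eq_0[OF subspace_span] using ker zB' by auto
  have iD: "independent (f ` D)" using f.independent_injective_image[OF D(2) inj] .
  have "span b' \<inter> span (f ` D) = {0}"
    unfolding f.span_image span_B using ker zB' span_zero f.zero by force
  then have ind: "independent (b' \<union> f ` D)"
    by (intro independent_Un_span_Int) (use D b' iD in auto)
  have dis: "b' \<inter> f ` D = {}"
  proof (rule ccontr)
    assume "b' \<inter> f ` D \<noteq> {}"
    then obtain x where x: "x \<in> D" "f x \<in> b'" by auto
    then have "x = 0" using ker span_base b'(1) by blast
    then show False using D(2) x(1) dependent_zero by blast
  qed
  have "card (f ` D) = card D"
    by (rule card_image) (meson inj inj_on_subset span_superset)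
  then have "card (b' \<union> f ` D) = dim B' + card D"
    using dis D fb' b' by (simp add: card_Un_disjoint)
  moreover have "card (b' \<union> f ` D) \<le> dim Z'"
  proof -
    have "b' \<union> f ` D \<subseteq> Z'" using b' incl D f(2) by blast
    from maximal_independent_subset_extend[OF this ind]
    obtain e where e: "b' \<union> f ` D \<subseteq> e" "e \<subseteq> Z'" "independent e" "Z' \<subseteq> span e" by metis
    have "finite e" using independent_span_bound[OF fin(4) e(3)] e(2) fin(3) by blast
    then show ?thesis using basis_card_eq_dim[OF e(2,4,3)] card_mono e(1) by metis
  qed
  ultimately show ?thesis using cD by linarith
qed

end

interpretation kvec: vector_space "vec_scale :: 'k::field \<Rightarrow> (nat \<Rightarrow>\<^sub>0 'k) \<Rightarrow> _"
  by (rule vector_space_vec_scale)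

lemma linear_lin_ext: "Vector_Spaces.linear vec_scale vec_scale (lin_ext f)" for f :: "nat \<Rightarrow>
    (nat \<Rightarrow>\<^sub>0 'k::field)"
  by (simp add: Vector_Spaces.linear_iff vector_space_vec_scale lin_ext_add lin_ext_scale)

text \<open>A coordinate with nonzero constant coefficient contributes exactly the degree of its
  basis element, which must then be \<open>j\<close>; the other coordinates vanish modulo the
  variables.\<close>

lemma const_vec_tensor_part:
  assumes v: "v \<in> free_mod S (gens F i)" "homogeneous_vec (gdeg F i) j v"
  shows "const_vec v \<in> tensor_part F i j"
  unfolding tensor_part_def
proof (intro CollectI subsetI)
  fix b assume b: "b \<in> keys (const_vec v)"
  then have "0 \<in> keys (lookup v b)" by (simp add: in_keys_iff)
  then have "gdeg F i b = j"
    using v(2) unfolding homogeneous_vec_iff by (metis add_0_right monom_degree_0)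
  moreover have "b \<in> gens F i" using b keys_const_vec[of v] v(1) by (auto simp: free_mod_def)
  ultimately show "b \<in> gens F i \<and> gdeg F i b = j" by simp
qed

section \<open>Graded pieces of a complex tensored with \<open>K\<close>, and the invariance of
  their homology\<close>

lemma subspace_tensor_part:
  fixes F :: "('x, 'k::comm_ring_1) free_complex"
  shows "vec.subspace (tensor_part F i j)"
proof -
  let ?B = "{b \<in> gens F i. gdeg F i b = j}"
  have "keys (v + w) \<subseteq> ?B" if "keys v \<subseteq> ?B" "keys w \<subseteq> ?B" for v w :: "nat \<Rightarrow>\<^sub>0 'k"
    using that keys_add[of v w] by blast
  moreover have "keys (vec_scale c v) \<subseteq> ?B" if "keys v \<subseteq> ?B" for c and v :: "nat \<Rightarrow>\<^sub>0 'k"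
    using that keys_vec_scale[of c v] by blast
  ultimately show ?thesis unfolding vec.subspace_def tensor_part_def by simp
qed

lemma tensor_part_span:
  "tensor_part F i j \<subseteq> vec.span ((\<lambda>b. single b 1) ` {b \<in> gens F i. gdeg F i b = j})"
proof
  fix w :: "nat \<Rightarrow>\<^sub>0 'a" assume w: "w \<in> tensor_part F i j"
  have "w = (\<Sum>b\<in>keys w. vec_scale (lookup w b) (single b 1))"
    by (simp flip: poly_mapping_expand)
  also have "\<dots> \<in> vec.span ((\<lambda>b. single b 1) ` {b \<in> gens F i. gdeg F i b = j})"
    by (intro vec.span_sum vec.span_scale vec.span_base) (use w in \<open>auto simp: tensor_part_def\<close>)
  finally show "w \<in> vec.span ((\<lambda>b. single b 1) ` {b \<in> gens F i. gdeg F i b = j})" .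
qed

text \<open>The constant lift of \<open>w\<close> is a homogeneous vector over \<open>K[S]\<close>;
  \<open>f\<close> is applied there, and the result is reduced modulo the variables again.\<close>

lemma level_map_tensor_part:
  fixes S :: "'x set" and f :: "nat \<Rightarrow> (nat \<Rightarrow>\<^sub>0 ('x, 'k::comm_ring_1) polynomial)"
  assumes "level_map S (gens F i) (gdeg F i) (gens G k) (gdeg G k) f" "w \<in> tensor_part F i j"
  shows "lin_ext (\<lambda>b. const_vec (f b)) w \<in> tensor_part G k j"
proof -
  let ?u = "vec_const w :: nat \<Rightarrow>\<^sub>0 ('x, 'k) polynomial"
  have u: "?u \<in> free_mod S (gens F i)" "homogeneous_vec (gdeg F i) j ?u"
    using assms(2) unfolding tensor_part_def
    by (blast intro: vec_const_free_mod homogeneous_vec_const)+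
  have ku: "keys ?u \<subseteq> gens F i" using u by (simp add: free_mod_def)
  have "lin_ext f ?u \<in> free_mod S (gens G k)"
    by (rule lin_ext_free_mod[OF u(1)]) (use assms(1) in \<open>simp add: level_map_def\<close>)
  moreover have "homogeneous_vec (gdeg G k) j (lin_ext f ?u)"
    by (rule homogeneous_lin_ext[OF _ u(2)]) (use assms(1) ku in \<open>auto simp: level_map_def\<close>)
  ultimately have "const_vec (lin_ext f ?u) \<in> tensor_part G k j" by (rule const_vec_tensor_part)
  then show ?thesis by (simp add: const_vec_lin_ext)
qed

lemma tensor_diff_eq: "tensor_diff F i = lin_ext (\<lambda>b. const_vec (bdry F i b))"
  by (simp add: tensor_diff_def const_vec_def)

context resolution
begin

lemma level_map_bdry: "level_map S (gens F (Suc i)) (gdeg F (Suc i)) (gens F i) (gdeg F i)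
    (bdry F i)"
  by (simp add: level_map_def bdry_free_mod bdry_homogeneous)

lemma tensor_boundaries_subset: "tensor_boundaries F i j \<subseteq> tensor_cycles F i j"
proof
  fix x assume "x \<in> tensor_boundaries F i j"
  then obtain w where w: "w \<in> tensor_part F (Suc i) j" "x = tensor_diff F i w"
    by (auto simp: tensor_boundaries_def)
  have x: "x \<in> tensor_part F i j"
    unfolding w(2) tensor_diff_eq by (rule level_map_tensor_part[OF level_map_bdry w(1)])
  have "tensor_diff F i' x = 0" if "i = Suc i'" for i'
  proof -
    have "tensor_diff F i' x = lin_ext (\<lambda>b. const_vec (lin_ext (bdry F i') (bdry F (Suc i') b))) w"
      unfolding w(2) that tensor_diff_eq lin_ext_lin_ext by (simp add: const_vec_lin_ext)
    also have "\<dots> = lin_ext (\<lambda>b. 0) w"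
      by (rule lin_ext_cong) (use w(1) that in \<open>auto simp: tensor_part_def bdry_bdry\<close>)
    finally show ?thesis by simp
  qed
  with x show "x \<in> tensor_cycles F i j" by (auto simp: tensor_cycles_def split: nat.splits)
qed

end

lemma subspace_tensor_cycles: "vec.subspace (tensor_cycles F i j)"
  using subspace_tensor_part[of F i j] unfolding vec.subspace_def tensor_cycles_def
  by (auto simp: tensor_diff_eq lin_ext_add lin_ext_scale split: nat.splits)

lemma subspace_tensor_boundaries: "vec.subspace (tensor_boundaries (F :: ('x, 'k::field)
    free_complex) i j)"
proof -
  interpret Vector_Spaces.linear vec_scale vec_scale "tensor_diff F i"
    unfolding tensor_diff_eq by (rule linear_lin_ext)
  show ?thesis unfolding tensor_boundaries_def by (rule subspace_image[OF subspace_tensor_part])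
qed

text \<open>Comparison maps in both directions compose to a map homotopic to the identity, so the
  map induced by \<open>f\<close> on homology is injective. Exchanging \<open>F\<close> and
  \<open>G\<close> then turns the inequality into an equality.\<close>

lemma tor_dim_le:
  fixes F G :: "('x, 'k::field) free_complex"
  assumes "resolution S I F" "resolution S I G"
  shows "tor_dim F i j \<le> tor_dim G i j"
proof -
  interpret F: resolution S I F by fact
  interpret G: resolution S I G by fact
  obtain f where f: "\<And>i. level_map S (gens F i) (gdeg F i) (gens G i) (gdeg G i) (f i)"
    "\<And>b. b \<in> gens F 0 \<Longrightarrow> aug F b - aug_map (aug G) (f 0 b) \<in> I"
    "\<And>i b. b \<in> gens F (Suc i) \<Longrightarrow> lin_ext (bdry G i) (f (Suc i) b) = lin_ext (f i) (bdry F i b)"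
    using chain_map_exists[OF assms] by blast
  obtain g where g: "\<And>i. level_map S (gens G i) (gdeg G i) (gens F i) (gdeg F i) (g i)"
    "\<And>b. b \<in> gens G 0 \<Longrightarrow> aug G b - aug_map (aug F) (g 0 b) \<in> I"
    "\<And>i b. b \<in> gens G (Suc i) \<Longrightarrow> lin_ext (bdry F i) (g (Suc i) b) = lin_ext (g i) (bdry G i b)"
    using chain_map_exists[OF assms(2,1)] by blast
  \<comment> \<open>The composite minus the identity is a chain map inducing zero on
    \<open>R/I\<close>, so it is null-homotopic.\<close>
  define \<phi> where "\<phi> i b = lin_ext (g i) (f i b) - single b 1" for i b
  have keys_f: "keys (f i b) \<subseteq> gens G i" if "b \<in> gens F i" for i b
    using f(1)[of i] that by (auto simp: level_map_def free_mod_def)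
  have keys_bF: "keys (bdry F i b) \<subseteq> gens F i" if "b \<in> gens F (Suc i)" for i b
    using F.bdry_free_mod[OF that] by (simp add: free_mod_def)
  have lvl: "level_map S (gens F i) (gdeg F i) (gens F i) (gdeg F i) (\<phi> i)" for i
    unfolding level_map_def
  proof (intro ballI conjI)
    fix b assume b: "b \<in> gens F i"
    have fb: "f i b \<in> free_mod S (gens G i)" "homogeneous_vec (gdeg G i) (gdeg F i b) (f i b)"
      using f(1)[of i] b by (auto simp: level_map_def)
    show "\<phi> i b \<in> free_mod S (gens F i)" unfolding \<phi>_def
      by (intro submodule_diff[OF submodule_free_mod] lin_ext_free_mod[OF fb(1)] free_mod_single)
         (use g(1)[of i] b in \<open>auto simp: level_map_def\<close>)
    show "homogeneous_vec (gdeg F i) (gdeg F i b) (\<phi> i b)" unfolding \<phi>_def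
      by (intro homogeneous_vec_diff homogeneous_lin_ext[OF _ fb(2)] homogeneous_vec_single[where k
          = 0])
         (use g(1)[of i] keys_f[OF b] in \<open>auto simp: level_map_def homogeneous_def\<close>)
  qed
  have aug0: "aug_map (aug F) (\<phi> 0 b) \<in> I" if b: "b \<in> gens F 0" for b
  proof -
    have fb: "f 0 b \<in> free_mod S (gens G 0)" using f(1)[of 0] b by (auto simp: level_map_def)
    have "aug_map (aug G) (f 0 b) - aug_map (aug F) (lin_ext (g 0) (f 0 b))
        = (\<Sum>c\<in>keys (f 0 b). lookup (f 0 b) c * (aug G c - aug_map (aug F) (g 0 c)))"
      by (simp add: aug_map_lin_ext) (simp add: aug_map_def right_diff_distrib sum_subtractf)
    also have "\<dots> \<in> I"
      by (rule graded_ideal_sum[OF F.ideal])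
         (use fb g(2) keys_f[OF b] F.ideal in \<open>auto simp: graded_ideal_def free_mod_def\<close>)
    finally have "(aug_map (aug G) (f 0 b) - aug_map (aug F) (lin_ext (g 0) (f 0 b)))
        + (aug F b - aug_map (aug G) (f 0 b)) \<in> I"
      using f(2)[OF b] F.ideal unfolding graded_ideal_def by blast
    then have "- (aug F b - aug_map (aug F) (lin_ext (g 0) (f 0 b))) \<in> I"
      by (intro graded_ideal_uminus[OF F.ideal]) (simp add: algebra_simps)
    then show ?thesis by (simp add: \<phi>_def aug_map_diff)
  qed
  have comm: "lin_ext (bdry F i) (\<phi> (Suc i) b) = lin_ext (\<phi> i) (bdry F i b)" if b: "b \<in>
      gens F (Suc i)" for i b
  proof -
    have "lin_ext (bdry F i) (lin_ext (g (Suc i)) (f (Suc i) b)) = lin_ext (g i) (lin_ext (bdry G i)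
        (f (Suc i) b))"
      unfolding lin_ext_lin_ext by (rule lin_ext_cong) (use g(3) keys_f[OF b] in auto)
    also have "\<dots> = lin_ext (\<lambda>c. lin_ext (g i) (f i c)) (bdry F i b)"
      by (simp add: f(3)[OF b] lin_ext_lin_ext)
    finally show ?thesis unfolding \<phi>_def[abs_def] by (simp add: lin_ext_diff lin_ext_fun_diff)
  qed
  obtain h where h: "\<And>i. level_map S (gens F i) (gdeg F i) (gens F (Suc i)) (gdeg F (Suc i)) (h i)"
    "\<And>b. b \<in> gens F 0 \<Longrightarrow> lin_ext (bdry F 0) (h 0 b) = \<phi> 0 b"
    "\<And>i b. b \<in> gens F (Suc i) \<Longrightarrow> lin_ext (bdry F (Suc i)) (h (Suc i) b) + lin_ext (h i) (bdry F i b)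
        = \<phi> (Suc i) b"
    using chain_homotopy_exists[OF assms(1) assms(1) lvl aug0 comm] by blast
  define f' where "f' i = lin_ext (\<lambda>b. const_vec (f i b))" for i
  define g' where "g' i = lin_ext (\<lambda>b. const_vec (g i b))" for i
  define h' where "h' i = lin_ext (\<lambda>b. const_vec (h i b))" for i
  have ker: "keys w \<subseteq> gens F i" if "w \<in> tensor_part F i j" for w i j
    using that by (auto simp: tensor_part_def)
  have kerG: "keys w \<subseteq> gens G i" if "w \<in> tensor_part G i j" for w i j
    using that by (auto simp: tensor_part_def)
  have f'_comm: "tensor_diff G i (f' (Suc i) w) = f' i (tensor_diff F i w)" if "w \<in>
      tensor_part F (Suc i) j" for w i j
    unfolding f'_def tensor_diff_eq lin_ext_lin_ext
    by (rule lin_ext_cong) (use ker[OF that] in \<open>auto simp: f(3) simp flip: const_vec_lin_ext\<close>)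
  have g'_comm: "tensor_diff F i (g' (Suc i) w) = g' i (tensor_diff G i w)" if "w \<in>
      tensor_part G (Suc i) j" for w i j
    unfolding g'_def tensor_diff_eq lin_ext_lin_ext
    by (rule lin_ext_cong) (use kerG[OF that] in \<open>auto simp: g(3) simp flip: const_vec_lin_ext\<close>)
  have f'_part: "f' i w \<in> tensor_part G i j" if "w \<in> tensor_part F i j" for w i j
    unfolding f'_def by (rule level_map_tensor_part[OF f(1) that])
  have g'_part: "g' i w \<in> tensor_part F i j" if "w \<in> tensor_part G i j" for w i j
    unfolding g'_def by (rule level_map_tensor_part[OF g(1) that])
  have h'_part: "h' i w \<in> tensor_part F (Suc i) j" if "w \<in> tensor_part F i j" for w i j
    unfolding h'_def by (rule level_map_tensor_part[OF h(1) that])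
  have gf: "g' i (f' i w) - w \<in> tensor_boundaries F i j" if w: "w \<in> tensor_cycles F i j" for w
  proof -
    have wp: "w \<in> tensor_part F i j" using w by (simp add: tensor_cycles_def)
    have "g' i (f' i w) - w = lin_ext (\<lambda>b. const_vec (\<phi> i b)) w"
      unfolding g'_def f'_def lin_ext_lin_ext \<phi>_def const_vec_diff lin_ext_fun_diff
          const_vec_lin_ext
      by (simp add: const_vec_def[of "single _ 1"])
    also have "\<dots> = tensor_diff F i (h' i w)"
    proof (cases i)
      case 0
      have "lin_ext (\<lambda>b. const_vec (\<phi> 0 b)) w = lin_ext (\<lambda>b. const_vec (lin_ext (bdry F 0) (h 0 b)))
          w"
        by (rule lin_ext_cong) (use ker[OF wp] h(2) 0 in auto)
      also have "\<dots> = tensor_diff F 0 (h' 0 w)"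
        by (simp add: tensor_diff_eq h'_def lin_ext_lin_ext const_vec_lin_ext)
      finally show ?thesis using 0 by simp
    next
      case (Suc k)
      have wz: "tensor_diff F k w = 0" using w Suc by (simp add: tensor_cycles_def)
      have "lin_ext (\<lambda>b. const_vec (\<phi> (Suc k) b)) w
          = lin_ext (\<lambda>b. const_vec (lin_ext (bdry F (Suc k)) (h (Suc k) b)) +
              const_vec (lin_ext (h k) (bdry F k b))) w"
        by (rule lin_ext_cong) (use ker[OF wp] h(3)[of _ k,
            symmetric] Suc in \<open>auto simp flip: const_vec_add\<close>)
      also have "\<dots> = tensor_diff F (Suc k) (h' (Suc k) w) + h' k (tensor_diff F k w)"
        by (simp add: tensor_diff_eq h'_def lin_ext_lin_ext const_vec_lin_ext lin_ext_fun_add)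
      also have "\<dots> = tensor_diff F (Suc k) (h' (Suc k) w)" by (simp add: wz h'_def)
      finally show ?thesis using Suc by simp
    qed
    finally show ?thesis using h'_part[OF wp] by (simp add: tensor_boundaries_def)
  qed
  show ?thesis unfolding tor_dim_def
  proof (rule kvec.quotient_dim_le[where f = "f' i"
        and X = "(\<lambda>b. single b 1) ` {b \<in> gens F i. gdeg F i b = j}"
        and X' = "(\<lambda>b. single b 1) ` {b \<in> gens G i. gdeg G i b = j}"])
    show "tensor_cycles F i j \<subseteq> vec.span ((\<lambda>b. single b 1) ` {b \<in> gens F i. gdeg F i b = j})"
      using tensor_part_span[of F i j] by (auto simp: tensor_cycles_def)
    show "tensor_cycles G i j \<subseteq> vec.span ((\<lambda>b. single b 1) ` {b \<in> gens G i. gdeg G i b = j})"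
      using tensor_part_span[of G i j] by (auto simp: tensor_cycles_def)
    show "f' i ` tensor_cycles F i j \<subseteq> tensor_cycles G i j"
      using f'_part f'_comm[of _ _ j] by (auto simp: tensor_cycles_def f'_def split: nat.splits)
    fix z assume z: "z \<in> tensor_cycles F i j" "f' i z \<in> tensor_boundaries G i j"
    then obtain u where u: "u \<in> tensor_part G (Suc i) j" "f' i z = tensor_diff G i u"
      by (auto simp: tensor_boundaries_def)
    then have "g' i (f' i z) \<in> tensor_boundaries F i j"
      using g'_comm[OF u(1)] g'_part[OF u(1)] unfolding tensor_boundaries_def by (metis imageI)
    \<comment> \<open>Both terms of this difference are boundaries, and the difference is
      \<open>z\<close>.\<close>
    then have "g' i (f' i z) - (g' i (f' i z) - z) \<in> tensor_boundaries F i j"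
      by (rule vec.subspace_diff[OF subspace_tensor_boundaries]) (rule gf[OF z(1)])
    then show "z \<in> tensor_boundaries F i j" by simp
  qed (auto simp: F.finite_gens G.finite_gens subspace_tensor_cycles subspace_tensor_boundaries
      F.tensor_boundaries_subset[THEN subsetD] G.tensor_boundaries_subset[THEN subsetD] f'_def
          linear_lin_ext)
qed

lemma tor_dim_unique:
  fixes F G :: "('x, 'k::field) free_complex"
  assumes "graded_ideal S I" "graded_free_resolution S I F" "graded_free_resolution S I G"
  shows "tor_dim F i j = tor_dim G i j"
  using assms by (intro antisym tor_dim_le[of S I]) (auto intro: resolution.intro)

text \<open>The resolution chosen in the definition exists as soon as some \<open>F\<close> is
  known, and by the comparison theorem it may be replaced by \<open>F\<close>.\<close>

lemma graded_betti_eq: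
  fixes F :: "('x, 'k::field) free_complex"
  assumes "graded_ideal S I" "graded_free_resolution S I F"
  shows "graded_betti S I i j = tor_dim F i j"
  unfolding graded_betti_def by (metis assms tor_dim_unique someI)

section \<open>Minimal resolutions\<close>

lemma lookup_le_monom_degree: "lookup m x \<le> monom_degree m"
  unfolding monom_degree_def
  by (cases "x \<in> keys m") (auto intro: member_le_sum simp: in_keys_iff)

lemma finite_monoms:
  assumes "finite S"
  shows "finite {m :: 'x \<Rightarrow>\<^sub>0 nat. keys m \<subseteq> S \<and> monom_degree m = k}"
proof -
  let ?M = "{m :: 'x \<Rightarrow>\<^sub>0 nat. keys m \<subseteq> S \<and> monom_degree m = k}"
  have "lookup ` ?M \<subseteq> {f. \<forall>x. (x \<in> S \<longrightarrow> f x \<in> {..k}) \<and> (x \<notin> S \<longrightarrow> f x = 0)}"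
    using lookup_le_monom_degree by (auto simp: in_keys_iff)
  then have "finite (lookup ` ?M)"
    by (rule finite_subset) (rule finite_set_of_finite_funs, use assms in auto)
  then show ?thesis
    by (rule finite_imageD) (simp add: inj_on_def poly_mapping.lookup_inject)
qed

section \<open>Minimal homogeneous generators of a graded submodule\<close>

definition const_scale :: "'k::comm_ring_1 \<Rightarrow> (nat \<Rightarrow>\<^sub>0 ('x, 'k) polynomial) \<Rightarrow> (nat \<Rightarrow>\<^sub>0 ('x, 'k)
    polynomial)" where
  "const_scale c v = vec_scale (poly_const c) v"

text \<open>The \<open>K\<close>-structure of the free modules, needed to choose generators degree
  by degree with linear algebra.\<close>

interpretation pvec: vector_space "const_scale :: 'k::field \<Rightarrow> (nat \<Rightarrow>\<^sub>0 ('x, 'k) polynomial) \<Rightarrow> _"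
  by unfold_locales
     (auto simp: const_scale_def poly_const_def vec.scale_right_distrib vec.scale_left_distrib
         single_add mult_single)

lemma subspace_submodule: "submodule S N \<Longrightarrow> pvec.subspace N"
  unfolding pvec.subspace_def submodule_def const_scale_def poly_const_def
  by (simp add: poly_ring_single)

lemma homogeneous_vec_const_scale: "homogeneous_vec dg d v \<Longrightarrow> homogeneous_vec dg d (const_scale c v)"
  unfolding const_scale_def
  by (rule homogeneous_vec_scale[where k = 0, simplified])
      (auto simp: homogeneous_def poly_const_def)

text \<open>In degree \<open>d\<close> only basis elements of degree at most \<open>d\<close> occur,
  times monomials of the missing degree. For finite \<open>S\<close> and finitely many basis
  elements in each degree this spanning set is finite.\<close>

lemma homogeneous_vec_span:
  fixes v :: "nat \<Rightarrow>\<^sub>0 ('x, 'k::field) polynomial"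
  assumes "v \<in> free_mod S B" "homogeneous_vec dg d v"
  shows "v \<in> pvec.span ((\<lambda>(b, m). single b (single m 1)) `
    (SIGMA b:{b \<in> B. dg b \<le> d}. {m. keys m \<subseteq> S \<and> monom_degree m = d - dg b}))" (is "_ \<in>
        pvec.span ?X")
proof -
  have "v = (\<Sum>b\<in>keys v. \<Sum>m\<in>keys (lookup v b). const_scale (lookup (lookup v b) m)
      (single b (single m 1)))"
  proof (rule poly_mapping_eqI)
    fix c
    have "lookup (\<Sum>b\<in>keys v. \<Sum>m\<in>keys (lookup v b). const_scale (lookup (lookup v b) m)
        (single b (single m 1))) c
       = (\<Sum>b\<in>keys v. if b = c then \<Sum>m\<in>keys (lookup v b). single m (lookup (lookup v b) m) else 0)"
      unfolding lookup_sum
      by (intro sum.cong refl) (auto simp: lookup_sum const_scale_def poly_const_def mult_single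
          lookup_single)
    also have "\<dots> = lookup v c"
      by (auto simp: in_keys_iff simp flip: poly_mapping_expand)
    finally show "lookup v c = lookup (\<Sum>b\<in>keys v. \<Sum>m\<in>keys (lookup v b).
        const_scale (lookup (lookup v b) m) (single b (single m 1))) c" by simp
  qed
  also have "\<dots> \<in> pvec.span ?X"
  proof (intro pvec.span_sum pvec.span_scale pvec.span_base)
    fix b m assume bm: "b \<in> keys v" "m \<in> keys (lookup v b)"
    have "dg b + monom_degree m = d" using assms(2) bm(2) unfolding homogeneous_vec_iff by blast
    moreover have "b \<in> B" "keys m \<subseteq> S" using assms(1) bm by (auto simp: free_mod_def poly_ring_def)
    ultimately show "single b (single m 1) \<in> ?X" by force
  qed
  finally show ?thesis .
qed

text \<open>\<open>C\<close> represents a basis of the quotient of \<open>H\<close> by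
  \<open>W\<close>. Independence modulo \<open>W\<close> is expressed by coefficients, so that no
  quotient space has to be formed.\<close>

lemma (in vector_space) complement_basis:
  assumes "subspace W" "W \<subseteq> H" "H \<subseteq> span X" "finite X"
  shows "\<exists>C\<subseteq>H. finite C \<and> H \<subseteq> span (W \<union> C) \<and>
    (\<forall>a. (\<Sum>c\<in>C. scale (a c) c) \<in> W \<longrightarrow> (\<forall>c\<in>C. a c = 0))"
proof -
  obtain b where b: "b \<subseteq> W" "independent b" "W \<subseteq> span b" by (rule basis_exists)
  have bH: "b \<subseteq> H" using b(1) assms(2) by (rule subset_trans)
  obtain c where c: "b \<subseteq> c" "c \<subseteq> H" "independent c" "H \<subseteq> span c"
    by (rule maximal_independent_subset_extend[OF bH b(2)])
  have fc: "finite c" using independent_span_bound[OF assms(4) c(3)] c(2) assms(3) by blast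
  define C where "C = c - b"
  have C: "finite C" "C \<subseteq> H" "independent C" "b \<union> C = c" "b \<inter> C = {}"
    using fc c independent_mono[of c C] unfolding C_def by auto
  have "span c \<subseteq> span (W \<union> C)" by (rule span_mono) (use C b in auto)
  then have "H \<subseteq> span (W \<union> C)" using c by blast
  moreover have "a x = 0" if "(\<Sum>c\<in>C. scale (a c) c) \<in> W" "x \<in> C" for a x
  proof -
    have "(\<Sum>c\<in>C. scale (a c) c) \<in> span C" by (intro span_sum span_scale span_base)
    then have "(\<Sum>c\<in>C. scale (a c) c) = 0"
      using span_Int_independent[of C b] C c(3) b(3) that(1) by auto
    then show ?thesis using independentD[OF C(3) C(1)] that(2) by blast
  qed
  ultimately show ?thesis using C by blast
qed

text \<open>A graded Nakayama argument. In each degree one takes a basis of \<open>N\<close> modulo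
  the products of elements of \<open>N\<close> with polynomials of positive degree. These elements
  generate by induction on the degree, and a relation among them cannot have constant
  coefficients.\<close>

lemma minimal_generators:
  fixes N :: "(nat \<Rightarrow>\<^sub>0 ('x, 'k::field) polynomial) set"
  assumes "finite S" and fin: "\<And>d. finite {b \<in> B. dg b = d}"
    and N: "submodule S N" "N \<subseteq> free_mod S B" "\<And>v d. v \<in> N \<Longrightarrow> hom_part dg d v \<in> N"
  shows "\<exists>G g f. (\<forall>d. finite {b \<in> G. g b = d}) \<and> (\<forall>b\<in>G. f b \<in> N \<and> homogeneous_vec dg (g b) (f b)) \<and>
    lin_ext f ` free_mod S G = N \<and> (\<forall>v\<in>free_mod S G. lin_ext f v = 0 \<longrightarrow> const_vec v = 0)"
proof -
  define H where "H d = {v \<in> N. homogeneous_vec dg d v}" for d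
  \<comment> \<open>The degree \<open>d\<close> part of the ideal of the variables times
    \<open>N\<close>. It involves \<open>H d'\<close> only for \<open>d' < d\<close>, which drives
    the induction for \<open>HIm\<close>.\<close>
  define D where "D d = pvec.span {vec_scale p u | p u k d'. p \<in> poly_ring S \<and> homogeneous k p \<and>
    0 < k \<and> u \<in> H d' \<and> d' + k = d}" for d
  have subH: "pvec.subspace (H d)" for d
    using subspace_submodule[OF N(1)] unfolding H_def pvec.subspace_def
    by (auto intro: homogeneous_vec_add homogeneous_vec_const_scale)
  have DH: "D d \<subseteq> H d" for d
    unfolding D_def
  proof (rule pvec.span_minimal[OF _ subH], safe)
    fix p :: "('x, 'k) polynomial" and u k d' assume a: "p \<in> poly_ring S" "homogeneous k p" "u \<in>
        H d'"
    have "vec_scale p u \<in> N" using N(1) a unfolding submodule_def H_def by blast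
    moreover have "homogeneous_vec dg (k + d') (vec_scale p u)"
      using a by (intro homogeneous_vec_scale) (auto simp: H_def)
    ultimately show "vec_scale p u \<in> H (d' + k)" by (simp add: H_def add.commute)
  qed
  have finle: "finite {b \<in> B. dg b \<le> d}" for d
  proof -
    have "{b \<in> B. dg b \<le> d} = (\<Union>e\<in>{..d}. {b \<in> B. dg b = e})" by auto
    then show ?thesis using fin by simp
  qed
  have "\<exists>C\<subseteq>H d. finite C \<and> H d \<subseteq> pvec.span (D d \<union> C) \<and>
      (\<forall>a. (\<Sum>c\<in>C. const_scale (a c) c) \<in> D d \<longrightarrow> (\<forall>c\<in>C. a c = 0))" for d
  proof (rule pvec.complement_basis)
    show "pvec.subspace (D d)" unfolding D_def by (rule pvec.subspace_span)
    show "D d \<subseteq> H d" by (rule DH)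
    let ?X = "(\<lambda>(b, m). single b (single m 1)) `
      (SIGMA b:{b \<in> B. dg b \<le> d}. {m :: 'x \<Rightarrow>\<^sub>0 nat. keys m \<subseteq> S \<and> monom_degree m = d - dg b})"
    show "H d \<subseteq> pvec.span ?X"
      unfolding H_def using homogeneous_vec_span[of _ S B dg d] N(2) by auto
    show "finite ?X" by (intro finite_imageI finite_SigmaI finle finite_monoms[OF \<open>finite S\<close>])
  qed
  then have "\<forall>d. \<exists>C. C \<subseteq> H d \<and> finite C \<and> H d \<subseteq> pvec.span (D d \<union> C) \<and>
      (\<forall>a. (\<Sum>c\<in>C. const_scale (a c) c) \<in> D d \<longrightarrow> (\<forall>c\<in>C. a c = 0))" by simp
  from choice[OF this] obtain C where C': "\<forall>d. C d \<subseteq> H d \<and> finite (C d) \<and>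
      H d \<subseteq> pvec.span (D d \<union> C d) \<and>
      (\<forall>a. (\<Sum>c\<in>C d. const_scale (a c) c) \<in> D d \<longrightarrow> (\<forall>c\<in>C d. a c = 0))" ..
  have C: "C d \<subseteq> H d" "finite (C d)" "H d \<subseteq> pvec.span (D d \<union> C d)"
    "(\<Sum>c\<in>C d. const_scale (a c) c) \<in> D d \<Longrightarrow> \<forall>c\<in>C d. a c = 0" for d a
    using C'[rule_format, of d] by simp_all
  have "\<exists>h. bij_betw h {0..<card (C d)} (C d)" for d
    by (rule ex_bij_betw_nat_finite[OF C(2)])
  then obtain h where h: "\<And>d. bij_betw (h d) {0..<card (C d)} (C d)" by metis
  \<comment> \<open>Generators are coded by degree and index, so that the degree can be read off
    from the code.\<close>
  define G where "G = {prod_encode (d, n) | d n. n < card (C d)}"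
  define g where "g k = fst (prod_decode k)" for k
  define f where "f k = h (fst (prod_decode k)) (snd (prod_decode k))" for k
  have Gd: "{b \<in> G. g b = d} = (\<lambda>n. prod_encode (d, n)) ` {0..<card (C d)}" for d
    by (auto simp: G_def g_def)
  have bij: "bij_betw f {b \<in> G. g b = d} (C d)" for d
  proof -
    have "bij_betw f ((\<lambda>n. prod_encode (d, n)) ` {0..<card (C d)}) (C d)"
    proof (rule bij_betw_imageI)
      show "inj_on f ((\<lambda>n. prod_encode (d, n)) ` {0..<card (C d)})"
        using h[of d] by (auto simp: inj_on_def f_def bij_betw_def)
      show "f ` (\<lambda>n. prod_encode (d, n)) ` {0..<card (C d)} = C d"
        using h[of d] by (simp add: image_image f_def bij_betw_def)
    qed
    then show ?thesis by (simp add: Gd)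
  qed
  have fH: "f b \<in> H (g b)" if "b \<in> G" for b
    using bij_betwE[OF bij[of "g b"]] that C(1) by blast
  have finG: "finite {b \<in> G. g b = d}" for d by (simp add: Gd)
  let ?Im = "lin_ext f ` free_mod S G"
  have sub: "submodule S ?Im"
    unfolding submodule_def
  proof (intro conjI ballI)
    show "0 \<in> ?Im" by (rule image_eqI[where x = 0]) simp_all
    show "v + w \<in> ?Im" if vw: "v \<in> ?Im" "w \<in> ?Im" for v w
    proof -
      obtain v' w' where v': "v' \<in> free_mod S G" "v = lin_ext f v'" and w': "w' \<in> free_mod S G" "w =
          lin_ext f w'"
        using vw by blast
      then have "v' + w' \<in> free_mod S G" using submodule_free_mod unfolding submodule_def by blast
      then show ?thesis using v' w' by (metis lin_ext_add imageI)
    qed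
    show "vec_scale p v \<in> ?Im" if pv: "p \<in> poly_ring S" "v \<in> ?Im" for p v
    proof -
      obtain v' where v': "v' \<in> free_mod S G" "v = lin_ext f v'" using pv by blast
      then have "vec_scale p v' \<in> free_mod S G" using submodule_free_mod pv(1)
          unfolding submodule_def by blast
      then show ?thesis using v' by (metis lin_ext_scale imageI)
    qed
  qed
  have HIm: "H d \<subseteq> ?Im" for d
  proof (induction d rule: less_induct)
    case (less d)
    have "D d \<subseteq> ?Im"
      unfolding D_def
    proof (rule pvec.span_minimal[OF _ subspace_submodule[OF sub]], safe)
      fix p :: "('x, 'k) polynomial" and u k d'
      assume a: "p \<in> poly_ring S" "0 < k" "u \<in> H d'" "d = d' + k"
      then have "u \<in> ?Im" using less[of d'] by auto
      then show "vec_scale p u \<in> ?Im" using sub a(1) unfolding submodule_def by blast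
    qed
    moreover have "C d \<subseteq> ?Im"
    proof
      fix c assume "c \<in> C d"
      then obtain b where "b \<in> G" "c = f b" using bij_betw_imp_surj_on[OF bij[of d]] by blast
      then show "c \<in> ?Im" by (intro image_eqI[where x = "single b 1"]) (auto intro: free_mod_single)
    qed
    ultimately have "pvec.span (D d \<union> C d) \<subseteq> ?Im"
      by (intro pvec.span_minimal subspace_submodule[OF sub]) auto
    then show ?case using C(3) by blast
  qed
  have "?Im = N"
  proof
    show "?Im \<subseteq> N"
    proof safe
      fix v :: "nat \<Rightarrow>\<^sub>0 ('x, 'k) polynomial" assume v: "v \<in> free_mod S G"
      show "lin_ext f v \<in> N"
        by (rule submodule_lin_ext[OF N(1)]) (use v fH in \<open>auto simp: free_mod_def H_def\<close>)
    qed
    show "N \<subseteq> ?Im"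
    proof
      fix v assume v: "v \<in> N"
      obtain E where E: "finite E" "v = (\<Sum>d\<in>E. hom_part dg d v)" using hom_part_expand by blast
      have "(\<Sum>d\<in>E. hom_part dg d v) \<in> ?Im"
      proof (rule submodule_sum[OF sub])
        fix d show "hom_part dg d v \<in> ?Im" using HIm[of d] N(3)[OF v] by (auto simp: H_def)
      qed
      then show "v \<in> ?Im" using E(2) by metis
    qed
  qed
  moreover have "const_vec v = 0" if v: "v \<in> free_mod S G" "lin_ext f v = 0" for v
  proof (rule poly_mapping_eqI)
    fix b
    show "lookup (const_vec v) b = lookup 0 b"
    proof (cases "b \<in> G")
      case False
      then have "lookup v b = 0" using v(1) by (auto simp: free_mod_def in_keys_iff)
      then show ?thesis by simp
    next
      case True
      \<comment> \<open>In the component of degree \<open>g b\<close>, generators of that degree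
        have constant coefficients, and generators of lower degree have coefficients of positive
        degree and contribute to \<open>D (g b)\<close>. Independence modulo \<open>D (g b)\<close>
        kills the constants.\<close>
      define u where "u = hom_part g (g b) v"
      have u: "u \<in> free_mod S G" unfolding u_def by (rule hom_part_free_mod[OF v(1)])
      then have ku: "keys u \<subseteq> G" and pu: "\<And>b. lookup u b \<in> poly_ring S" by (auto simp: free_mod_def)
      have hu: "homogeneous_vec g (g b) u" unfolding u_def by simp
      have "lin_ext f u = hom_part dg (g b) (lin_ext f v)" unfolding u_def
        by (rule hom_part_lin_ext[symmetric]) (use fH v(1) in \<open>auto simp: free_mod_def H_def\<close>)
      then have "0 = lin_ext f u" using v(2) by simp
      also have "\<dots> = (\<Sum>b'\<in>keys u. vec_scale (lookup u b') (f b'))" by (simp add: lin_ext_def)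
      also have "\<dots> = (\<Sum>b'\<in>{b'\<in>keys u. g b' = g b}. vec_scale (lookup u b') (f b'))
          + (\<Sum>b'\<in>{b'\<in>keys u. g b' \<noteq> g b}. vec_scale (lookup u b') (f b'))"
        by (subst sum.union_disjoint[symmetric]) (auto intro!: sum.cong)
      finally have eq: "(\<Sum>b'\<in>{b'\<in>keys u. g b' = g b}. vec_scale (lookup u b') (f b'))
          = - (\<Sum>b'\<in>{b'\<in>keys u. g b' \<noteq> g b}. vec_scale (lookup u b') (f b'))"
        unfolding eq_neg_iff_add_eq_0 by (rule sym)
      have "(\<Sum>b'\<in>{b'\<in>keys u. g b' \<noteq> g b}. vec_scale (lookup u b') (f b')) \<in> D (g b)"
        unfolding D_def
      proof (intro pvec.span_sum pvec.span_base)
        fix b' assume b': "b' \<in> {b'\<in>keys u. g b' \<noteq> g b}"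
        then obtain k where k: "g b' + k = g b" "homogeneous k (lookup u b')"
          using hu unfolding homogeneous_vec_def by blast
        moreover have "0 < k" using k b' by (cases k) auto
        ultimately show "vec_scale (lookup u b') (f b') \<in> {vec_scale p u | p u k d'. p \<in>
            poly_ring S \<and>
            homogeneous k p \<and> 0 < k \<and> u \<in> H d' \<and> d' + k = g b}"
          using pu fH[of b'] ku b' by blast
      qed
      then have inD: "(\<Sum>b'\<in>{b'\<in>keys u. g b' = g b}. vec_scale (lookup u b') (f b')) \<in> D (g b)"
        unfolding eq D_def by (rule pvec.span_neg)
      have const: "lookup u b' = poly_const (lookup (lookup u b') 0)" if "g b' = g b" for b'
      proof (cases "b' \<in> keys u")
        case True
        then obtain k where "g b' + k = g b" "homogeneous k (lookup u b')"
          using hu unfolding homogeneous_vec_def by blast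
        then have "homogeneous 0 (lookup u b')" using that by simp
        then show ?thesis unfolding poly_const_def by (rule homogeneous_0_eq)
      qed (simp add: in_keys_iff poly_const_def)
      \<comment> \<open>The independence condition is indexed by the vectors in
        \<open>C (g b)\<close>, hence the translation back to generators.\<close>
      let ?inv = "the_inv_into {b' \<in> G. g b' = g b} f"
      have inj: "inj_on f {b' \<in> G. g b' = g b}" using bij by (rule bij_betw_imp_inj_on)
      have "(\<Sum>c\<in>C (g b). const_scale (lookup (lookup u (?inv c)) 0) c)
          = (\<Sum>b'\<in>{b' \<in> G. g b' = g b}. const_scale (lookup (lookup u b') 0) (f b'))"
        by (subst sum.reindex_bij_betw[OF bij[of "g b"], symmetric])
           (auto intro!: sum.cong simp: the_inv_into_f_f[OF inj])
      also have "\<dots> = (\<Sum>b'\<in>{b' \<in> G. g b' = g b}. vec_scale (lookup u b') (f b'))"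
        by (intro sum.cong refl) (simp add: const_scale_def const[symmetric])
      also have "\<dots> = (\<Sum>b'\<in>{b'\<in>keys u. g b' = g b}. vec_scale (lookup u b') (f b'))"
        by (intro sum.mono_neutral_right finG) (use ku in \<open>auto simp: in_keys_iff\<close>)
      finally have "(\<Sum>c\<in>C (g b). const_scale (lookup (lookup u (?inv c)) 0) c) \<in> D (g b)"
        using inD by simp
      then have "\<forall>c\<in>C (g b). lookup (lookup u (?inv c)) 0 = 0" by (rule C(4))
      moreover have "f b \<in> C (g b)" using bij_betwE[OF bij[of "g b"]] True by blast
      ultimately have "lookup (lookup u b) 0 = 0"
        using the_inv_into_f_f[OF inj, of b] True by auto
      then show ?thesis by (simp add: u_def lookup_hom_part)
    qed
  qed
  ultimately show ?thesis using finG fH unfolding H_def by (intro exI[of _ G] exI[of _ g] exI[of _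
      f]) blast
qed

definition minimal :: "('x, 'k::comm_ring_1) free_complex \<Rightarrow> bool" where
  "minimal F \<longleftrightarrow> (\<forall>i. \<forall>b\<in>gens F (Suc i). const_vec (bdry F i b) = 0)"

text \<open>Starting from \<open>F\<^sub>0 = R\<close>, each kernel is covered by minimal
  generators. The invariant that kernels have no constant coefficients starts with the assumption on
  \<open>I\<close> and is passed on by \<open>minimal_generators\<close>; boundary values lie in
  these kernels.\<close>

lemma minimal_resolution_exists:
  fixes I :: "('x, 'k::field) polynomial set"
  assumes "finite S" and I: "graded_ideal S I" "\<And>p. p \<in> I \<Longrightarrow> lookup p 0 = 0"
  obtains F where "graded_free_resolution S I F" "minimal F"
proof -
  define ok where "ok G g N \<longleftrightarrow> (\<forall>d. finite {b \<in> G. g b = d}) \<and> submodule S N \<and> N \<subseteq> free_mod S G \<and>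
    (\<forall>v\<in>N. \<forall>d. hom_part g d v \<in> N) \<and> (\<forall>v\<in>N. const_vec v = 0)"
    for G g and N :: "(nat \<Rightarrow>\<^sub>0 ('x, 'k) polynomial) set"
  \<comment> \<open>A stage consists of a basis, its degrees and the kernel that the next stage must
    cover; stage \<open>0\<close> is \<open>R\<close> with one generator of degree
    \<open>0\<close>.\<close>
  let ?P = "\<lambda>i (G, g, N). ok G g N \<and> (i = 0 \<longrightarrow> G = {0} \<and> g = (\<lambda>_. 0) \<and> N = {v \<in>
      free_mod S {0}. lookup v 0 \<in> I})"
  let ?Q = "\<lambda>(i :: nat) (G, g, N) (G', g', N'). \<exists>f. (\<forall>b\<in>G'. f b \<in> N \<and> homogeneous_vec g (g' b)
      (f b)) \<and>
    lin_ext f ` free_mod S G' = N \<and> N' = {v \<in> free_mod S G'. lin_ext f v = 0}"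
  have "\<exists>x. \<forall>n. ?P n (x n) \<and> ?Q n (x n) (x (Suc n))"
  proof (rule dependent_nat_choice)
    let ?N = "{v \<in> free_mod S {0}. lookup v 0 \<in> I}"
    have "ok {0} (\<lambda>_. 0) ?N"
      unfolding ok_def
    proof (intro conjI allI ballI)
      show "submodule S ?N"
        using submodule_free_mod[of S "{0}"] I(1)
        unfolding submodule_def graded_ideal_def by (auto simp: lookup_add)
      fix v d assume v: "v \<in> ?N"
      then show "hom_part (\<lambda>_. 0) d v \<in> ?N"
        using hom_part_free_mod[of v S "{0}"] I(1) by (auto simp: lookup_hom_part graded_ideal_def)
      show "const_vec v = 0"
      proof (rule poly_mapping_eqI)
        fix b show "lookup (const_vec v) b = lookup 0 b"
        proof (cases "b = 0")
          case True then show ?thesis using v I(2) by simp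
        next
          case False
          then have "lookup v b = 0" using v by (auto simp: free_mod_def in_keys_iff)
          then show ?thesis by simp
        qed
      qed
    qed auto
    then show "\<exists>x. ?P 0 x" by (intro exI[of _ "({0}, \<lambda>_. 0, ?N)"]) simp
  next
    fix x and i :: nat assume Px: "?P i x"
    obtain G g N where x: "x = (G, g, N)" by (cases x)
    have okx: "ok G g N" using Px x by simp
    have "\<exists>G' g' f. (\<forall>d. finite {b \<in> G'. g' b = d}) \<and> (\<forall>b\<in>G'. f b \<in> N \<and> homogeneous_vec g (g' b)
        (f b)) \<and>
        lin_ext f ` free_mod S G' = N \<and> (\<forall>v\<in>free_mod S G'. lin_ext f v = 0 \<longrightarrow> const_vec v = 0)"
      by (rule minimal_generators[OF \<open>finite S\<close>, of G g N]) (use okx in \<open>auto simp: ok_def\<close>)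
    then obtain G' g' f where f_all: "(\<forall>d. finite {b \<in> G'. g' b = d}) \<and>
        (\<forall>b\<in>G'. f b \<in> N \<and> homogeneous_vec g (g' b) (f b)) \<and>
        lin_ext f ` free_mod S G' = N \<and> (\<forall>v\<in>free_mod S G'. lin_ext f v = 0 \<longrightarrow> const_vec v = 0)"
      by (elim exE) (rule that)
    note f = f_all[THEN conjunct1] f_all[THEN conjunct2, THEN conjunct1]
      f_all[THEN conjunct2, THEN conjunct2, THEN conjunct1] f_all[THEN conjunct2, THEN conjunct2,
          THEN conjunct2]
    let ?N' = "{v \<in> free_mod S G'. lin_ext f v = 0}"
    have "ok G' g' ?N'"
      unfolding ok_def
    proof (intro conjI allI ballI)
      show "submodule S ?N'"
        using submodule_free_mod[of S G'] unfolding submodule_def by (auto simp: lin_ext_add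
            lin_ext_scale)
      fix v d assume v: "v \<in> ?N'"
      have "lin_ext f (hom_part g' d v) = hom_part g d (lin_ext f v)"
        by (rule hom_part_lin_ext[symmetric]) (use f(2) v in \<open>auto simp: free_mod_def\<close>)
      then show "hom_part g' d v \<in> ?N'" using v hom_part_free_mod by auto
      show "const_vec v = 0" using f(4) v by blast
    qed (use f in auto)
    then show "\<exists>y. ?P (Suc i) y \<and> ?Q i x y"
      using f x by (intro exI[of _ "(G', g', ?N')"]) auto
  qed
  then obtain x where x: "\<forall>n. ?P n (x n) \<and> ?Q n (x n) (x (Suc n))" ..
  define G where "G n = fst (x n)" for n
  define g where "g n = fst (snd (x n))" for n
  define N where "N n = snd (snd (x n))" for n
  have x_eq: "x n = (G n, g n, N n)" for n by (simp add: G_def g_def N_def)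
  have okn: "ok (G n) (g n) (N n)" for n using x x_eq by (metis (no_types, lifting) case_prodD)
  have x0: "G 0 = {0}" "g 0 = (\<lambda>_. 0)" "N 0 = {v \<in> free_mod S {0}. lookup v 0 \<in> I}"
    using x[THEN spec, of 0] by (auto simp: x_eq)
  have "\<forall>n. \<exists>f. (\<forall>b\<in>G (Suc n). f b \<in> N n \<and> homogeneous_vec (g n) (g (Suc n) b) (f b)) \<and>
    lin_ext f ` free_mod S (G (Suc n)) = N n \<and> N (Suc n) = {v \<in>
        free_mod S (G (Suc n)). lin_ext f v = 0}"
    using x unfolding x_eq by simp
  from choice[OF this] obtain f where f_all: "\<forall>n. (\<forall>b\<in>G (Suc n). f n b \<in> N n \<and> homogeneous_vec (g n)
      (g (Suc n) b) (f n b)) \<and>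
    lin_ext (f n) ` free_mod S (G (Suc n)) = N n \<and> N (Suc n) = {v \<in>
        free_mod S (G (Suc n)). lin_ext (f n) v = 0}" ..
  have f: "\<And>n b. b \<in> G (Suc n) \<Longrightarrow> f n b \<in> N n \<and> homogeneous_vec (g n) (g (Suc n) b) (f n b)"
    "\<And>n. lin_ext (f n) ` free_mod S (G (Suc n)) = N n"
    "\<And>n. N (Suc n) = {v \<in> free_mod S (G (Suc n)). lin_ext (f n) v = 0}"
    using f_all by simp_all
  define F :: "('x, 'k) free_complex" where "F = \<lparr>gens = G, gdeg = g, bdry = f, aug = (\<lambda>_. 1)\<rparr>"
  have aug1: "aug_map (\<lambda>_. 1) v = lookup v 0" if "v \<in> free_mod S {0}" for v :: "nat \<Rightarrow>\<^sub>0 ('x, 'k)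
      polynomial"
    unfolding aug_map_def
    by (subst sum_keys_superset[where A = "{0}"]) (use that in \<open>auto simp: free_mod_def\<close>)
  have "graded_free_resolution S I F"
    unfolding graded_free_resolution_def
  proof (intro conjI allI ballI)
    fix i d show "finite {b \<in> gens F i. gdeg F i b = d}" using okn[of i] by (simp add: F_def ok_def)
  next
    fix i b assume b: "b \<in> gens F (Suc i)"
    then show "bdry F i b \<in> free_mod S (gens F i)" using f(1)[of b i] okn[of i] by (auto simp: F_def
        ok_def)
    show "homogeneous_vec (gdeg F i) (gdeg F (Suc i) b) (bdry F i b)"
        using f(1)[of b i] b by (simp add: F_def)
  next
    fix b assume b: "b \<in> gens F 0"
    show "aug F b \<in> poly_ring S" by (simp add: F_def)
    show "homogeneous (gdeg F 0 b) (aug F b)" by (simp add: F_def x0 homogeneous_def)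
  next
    fix p :: "('x, 'k) polynomial" assume p: "p \<in> poly_ring S"
    show "\<exists>v\<in>free_mod S (gens F 0). p - aug_map (aug F) v \<in> I"
      by (rule bexI[where x = "single 0 p"])
         (use p I(1) in \<open>auto simp: F_def x0 graded_ideal_def intro: free_mod_single\<close>)
  next
    have "{v \<in> free_mod S (gens F 0). aug_map (aug F) v \<in> I} = N 0"
      by (auto simp: F_def x0 aug1)
    also have "\<dots> = lin_ext (bdry F 0) ` free_mod S (gens F 1)" using f(2)[of 0] by (simp add: F_def)
    finally show "{v \<in> free_mod S (gens F 0). aug_map (aug F) v \<in> I} = lin_ext (bdry F 0)
        ` free_mod S (gens F 1)" .
  next
    fix i show "{v \<in> free_mod S (gens F (Suc i)). lin_ext (bdry F i) v = 0}
        = lin_ext (bdry F (Suc i)) ` free_mod S (gens F (i + 2))"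
      using f(3)[of i] f(2)[of "Suc i"] by (simp add: F_def)
  qed
  moreover have "minimal F"
    unfolding minimal_def
  proof (intro allI ballI)
    fix i b assume "b \<in> gens F (Suc i)"
    then have "f i b \<in> N i" using f(1) by (simp add: F_def)
    then show "const_vec (bdry F i b) = 0" using okn[of i] by (simp add: F_def ok_def)
  qed
  ultimately show ?thesis by (rule that)
qed

text \<open>All differentials vanish after tensoring with \<open>K\<close>, so the basis elements
  themselves span Tor.\<close>

lemma tor_dim_minimal:
  fixes F :: "('x, 'k::field) free_complex"
  assumes "minimal F" "\<And>i d. finite {b \<in> gens F i. gdeg F i b = d}"
  shows "tor_dim F i j = card {b \<in> gens F i. gdeg F i b = j}"
proof -
  have td: "tensor_diff F i w = 0" if "w \<in> tensor_part F (Suc i) j" for i w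
  proof -
    have "tensor_diff F i w = lin_ext (\<lambda>_. 0) w"
      unfolding tensor_diff_eq
      by (rule lin_ext_cong) (use assms(1) that in \<open>auto simp: minimal_def tensor_part_def\<close>)
    then show ?thesis by simp
  qed
  have zero: "(0 :: nat \<Rightarrow>\<^sub>0 'k) \<in> tensor_part F (Suc i) j" by (simp add: tensor_part_def)
  have "tensor_boundaries F i j = {0}"
    unfolding tensor_boundaries_def using td zero by (auto intro!: image_eqI[OF _ zero])
  moreover have "kvec.dim {0 :: nat \<Rightarrow>\<^sub>0 'k} = 0"
    by (rule kvec.dim_unique[where B = "{}"]) (auto simp: vec.span_zero vec.independent_empty)
  moreover have "tensor_cycles F i j = tensor_part F i j"
    using td by (cases i) (auto simp: tensor_cycles_def)
  moreover have "kvec.dim (tensor_part F i j) = card {b \<in> gens F i. gdeg F i b = j}"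
  proof (rule kvec.dim_unique)
    let ?B = "{b \<in> gens F i. gdeg F i b = j}" and ?e = "\<lambda>b. single b (1 :: 'k)"
    have inj: "inj ?e" by (rule injI) (metis lookup_single_eq lookup_single_not_eq zero_neq_one)
    show "?e ` ?B \<subseteq> tensor_part F i j" by (auto simp: tensor_part_def)
    show "tensor_part F i j \<subseteq> vec.span (?e ` ?B)" by (rule tensor_part_span)
    show "card (?e ` ?B) = card ?B" by (rule card_image) (rule inj_on_subset[OF inj subset_UNIV])
    show "vec.independent (?e ` ?B)"
    proof (rule kvec.independent_if_scalars_zero)
      show "finite (?e ` ?B)" using assms(2) by simp
      fix a x assume a: "(\<Sum>x\<in>?e ` ?B. vec_scale (a x) x) = 0" and "x \<in> ?e ` ?B"
      then obtain b where b: "b \<in> ?B" "x = ?e b" by blast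
      have "0 = (\<Sum>b'\<in>?B. single b' (a (?e b')))"
        using a by (subst (asm) sum.reindex) (auto intro: inj_on_subset[OF inj])
      then have "lookup 0 b = lookup (\<Sum>b'\<in>?B. single b' (a (?e b'))) b" by (rule arg_cong)
      also have "\<dots> = (\<Sum>b'\<in>?B. if b' = b then a (?e b') else 0)"
        by (simp add: lookup_sum lookup_single when_def)
      also have "\<dots> = a x" using b assms(2)[of i j] by (subst sum.delta) auto
      finally show "a x = 0" by simp
    qed
  qed
  ultimately show ?thesis by (simp add: tor_dim_def)
qed

section \<open>Linear extension of maps between monomials\<close>

text \<open>The target may be any type. With pairs as values, several invariants of a monomial are
  tested by a single equation.\<close>

definition push :: "('a \<Rightarrow> 'b) \<Rightarrow> ('a \<Rightarrow>\<^sub>0 'k::comm_monoid_add) \<Rightarrow> ('b \<Rightarrow>\<^sub>0 'k)" where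
  "push \<theta> p = (\<Sum>m\<in>keys p. single (\<theta> m) (lookup p m))"

lemma push_zero [simp]: "push \<theta> 0 = 0"
  by (simp add: push_def)

lemma push_add: "push \<theta> (p + q) = push \<theta> p + push \<theta> q"
  unfolding push_def by (rule setsum_keys_plus_distrib) (auto simp: single_add)

lemma push_sum: "push \<theta> (sum f A) = (\<Sum>x\<in>A. push \<theta> (f x))"
  by (induction A rule: infinite_finite_induct) (auto simp: push_add)

lemma push_single [simp]: "push \<theta> (single m c) = single (\<theta> m) c"
  by (simp add: push_def)

lemma push_push: "push \<theta> (push \<eta> p) = push (\<lambda>m. \<theta> (\<eta> m)) p"
  unfolding push_def[of \<eta>] by (simp add: push_sum) (simp add: push_def)

lemma lookup_push: "lookup (push \<theta> p) y = (\<Sum>m\<in>keys p. if \<theta> m = y then lookup p m else 0)"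
  by (simp add: push_def lookup_sum lookup_single when_def)

lemma push_cong: "(\<And>m. m \<in> keys p \<Longrightarrow> \<theta> m = \<theta>' m) \<Longrightarrow> push \<theta> p = push \<theta>' p"
  by (simp add: push_def)

lemma keys_push: "keys (push \<theta> p) \<subseteq> \<theta> ` keys p"
proof
  fix y assume "y \<in> keys (push \<theta> p)"
  then have "lookup (push \<theta> p) y \<noteq> 0" by (simp add: in_keys_iff)
  then show "y \<in> \<theta> ` keys p"
    unfolding lookup_push by (rule contrapos_np) (auto intro!: sum.neutral)
qed

text \<open>Whether \<open>push \<theta> p\<close> vanishes depends only on which monomials of
  \<open>p\<close> share a value of \<open>\<theta>\<close>. If \<open>\<eta>\<close> identifies at
  least these, it factors as \<open>\<xi>\<close> after \<open>\<theta>\<close>, and linearity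
  carries the vanishing over.\<close>

lemma push_eq_0_factor:
  assumes "push \<theta> p = 0" "\<And>m m'. m \<in> keys p \<Longrightarrow> m' \<in> keys p \<Longrightarrow> \<theta> m = \<theta> m' \<Longrightarrow> \<eta> m = \<eta> m'"
  shows "push \<eta> p = 0"
proof -
  define \<xi> where "\<xi> y = \<eta> (SOME m. m \<in> keys p \<and> \<theta> m = y)" for y
  have "\<xi> (\<theta> m) = \<eta> m" if "m \<in> keys p" for m
  proof -
    have "(SOME m'. m' \<in> keys p \<and> \<theta> m' = \<theta> m) \<in> keys p \<and> \<theta> (SOME m'. m' \<in> keys p \<and> \<theta> m' = \<theta> m) =
        \<theta> m"
      by (rule someI[of _ m]) (use that in auto)
    then show ?thesis unfolding \<xi>_def using assms(2) that by blast
  qed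
  then have "push \<eta> p = push (\<lambda>m. \<xi> (\<theta> m)) p" by (intro push_cong) simp
  also have "\<dots> = push \<xi> (push \<theta> p)" by (simp only: push_push)
  finally show ?thesis using assms(1) by simp
qed

lemma push_single_mult:
  fixes p :: "('x, 'k::comm_ring_1) polynomial"
  shows "push \<theta> (single q c * p) = (\<Sum>m\<in>keys p. single (\<theta> (q + m)) (c * lookup p m))"
proof -
  have "single q c * p = (\<Sum>m\<in>keys p. single (q + m) (c * lookup p m))"
    by (subst poly_mapping_expand[of p]) (simp add: sum_distrib_left mult_single)
  then show ?thesis by (simp add: push_sum)
qed

text \<open>By \<open>cong\<close>, sharing a value of \<open>\<theta>\<close> is stable under
  multiplication by a monomial, so \<open>push_eq_0_factor\<close> settles monomial
  \<open>r\<close>; the general case follows by linearity.\<close>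

lemma push_eq_0_mult:
  fixes p r :: "('x, 'k::comm_ring_1) polynomial"
  assumes p: "push \<theta> p = 0" "p \<in> poly_ring S" and r: "r \<in> poly_ring S"
    and cong: "\<And>q m m'. keys q \<subseteq> S \<Longrightarrow> keys m \<subseteq> S \<Longrightarrow> keys m' \<subseteq> S \<Longrightarrow> \<theta> m = \<theta> m' \<Longrightarrow> \<theta> (q + m) = \<theta> (q + m')"
  shows "push \<theta> (r * p) = 0"
proof -
  have "push \<theta> (single q c * p) = 0" if q: "keys q \<subseteq> S" for q c
  proof -
    have p0: "push (\<lambda>m. \<theta> (q + m)) p = 0"
      by (rule push_eq_0_factor[OF p(1)]) (use q p(2) in \<open>auto simp: poly_ring_def intro: cong\<close>)
    show ?thesis
    proof (rule poly_mapping_eqI)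
      fix y
      have "lookup (push \<theta> (single q c * p)) y = c * lookup (push (\<lambda>m. \<theta> (q + m)) p) y"
        by (auto simp: push_single_mult lookup_push lookup_sum lookup_single sum_distrib_left
            when_def intro!: sum.cong)
      then show "lookup (push \<theta> (single q c * p)) y = lookup 0 y" by (simp add: p0)
    qed
  qed
  then have "(\<Sum>q\<in>keys r. push \<theta> (single q (lookup r q) * p)) = 0"
    using r by (intro sum.neutral) (auto simp: poly_ring_def)
  also have "(\<Sum>q\<in>keys r. push \<theta> (single q (lookup r q) * p)) = push \<theta> (r * p)"
    unfolding push_sum[symmetric] sum_distrib_right[symmetric] poly_mapping_expand[of r,
        symmetric] ..
  finally show ?thesis .
qed

section \<open>Free extensions of polynomial rings\<close>

text \<open>
  Every monomial \<open>m\<close> over \<open>S\<close> has a leading part \<open>s m\<close> over \<open>S1\<close> and a type \<open>t m\<close>, represented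
  by the monomial \<open>\<mu> (t m)\<close>. Identifying monomials with equal \<open>s\<close> and \<open>t\<close> turns \<open>K[S]\<close> into a
  quotient \<open>K[S]/J\<close> that is free over \<open>K[S1]\<close> with basis the \<open>\<mu> n\<close>.
\<close>

locale monomial_decomp =
  fixes S S1 :: "'x set" and s :: "('x \<Rightarrow>\<^sub>0 nat) \<Rightarrow> ('x \<Rightarrow>\<^sub>0 nat)"
    and t :: "('x \<Rightarrow>\<^sub>0 nat) \<Rightarrow> 'i" and \<mu> :: "'i \<Rightarrow> ('x \<Rightarrow>\<^sub>0 nat)"
  assumes S1: "S1 \<subseteq> S"
    and s_add: "\<And>a m. keys a \<subseteq> S1 \<Longrightarrow> keys m \<subseteq> S \<Longrightarrow> s (a + m) = a + s m"
    and t_add: "\<And>a m. keys a \<subseteq> S1 \<Longrightarrow> keys m \<subseteq> S \<Longrightarrow> t (a + m) = t m"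
    and keys_s: "\<And>m. keys m \<subseteq> S \<Longrightarrow> keys (s m) \<subseteq> S1"
    and keys_\<mu>: "\<And>m. keys m \<subseteq> S \<Longrightarrow> keys (\<mu> (t m)) \<subseteq> S"
    and s_\<mu>: "\<And>m. keys m \<subseteq> S \<Longrightarrow> s (\<mu> (t m)) = 0"
    and t_\<mu>: "\<And>m. keys m \<subseteq> S \<Longrightarrow> t (\<mu> (t m)) = t m"
    and st_cong: "\<And>q m m'. keys q \<subseteq> S \<Longrightarrow> keys m \<subseteq> S \<Longrightarrow> keys m' \<subseteq> S \<Longrightarrow> s m = s m' \<Longrightarrow> t m = t m' \<Longrightarrow>
      s (q + m) = s (q + m') \<and> t (q + m) = t (q + m')"
begin

text \<open>The coordinate of the class of \<open>p\<close> at the basis element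
  \<open>\<mu> n\<close>.\<close>

definition coef :: "'i \<Rightarrow> ('x, 'k::comm_ring_1) polynomial \<Rightarrow> ('x, 'k) polynomial" where
  "coef n p = push s (restr (\<lambda>m. t m = n) p)"

definition J :: "('x, 'k::comm_ring_1) polynomial set" where
  "J = {p \<in> poly_ring S. \<forall>n. coef n p = 0}"

lemma coef_zero [simp]: "coef n 0 = 0"
  by (simp add: coef_def)

lemma coef_add: "coef n (p + q) = coef n p + coef n q"
  by (simp add: coef_def restr_add push_add)

lemma coef_diff: "coef n (p - q) = coef n p - coef n q"
  by (metis add_diff_cancel coef_add diff_add_cancel)

lemma coef_sum: "coef n (sum f A) = (\<Sum>x\<in>A. coef n (f x))"
  by (simp add: coef_def restr_sum push_sum)

lemma coef_single: "coef n (single m c) = (if t m = n then single (s m) c else 0)"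
  by (simp add: coef_def restr_single)

text \<open>The family of all coefficients carries the same information as a single image indexed by
  pairs, and to the latter \<open>push_eq_0_factor\<close> applies.\<close>

lemma lookup_push_coef:
  "lookup (push \<xi> (coef n p)) y = lookup (push (\<lambda>m. (\<xi> (s m), t m)) p) (y, n)"
  unfolding coef_def push_push lookup_push keys_restr lookup_restr
  by (auto simp: sum.inter_filter intro!: sum.cong)

lemma lookup_coef: "lookup (coef n p) y = lookup (push (\<lambda>m. (s m, t m)) p) (y, n)"
  using lookup_push_coef[of "\<lambda>m. m" n p y] by (simp add: push_def flip: poly_mapping_expand)

lemma coef_eq_0_iff: "(\<forall>n. coef n p = 0) \<longleftrightarrow> push (\<lambda>m. (s m, t m)) p = 0"
  unfolding poly_mapping_eq_iff fun_eq_iff lookup_coef by auto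

lemma push_coef_eq_0_iff: "(\<forall>n. push \<xi> (coef n p) = 0) \<longleftrightarrow> push (\<lambda>m. (\<xi> (s m), t m)) p = 0"
  unfolding poly_mapping_eq_iff fun_eq_iff lookup_push_coef by auto

lemma coef_poly_ring: "p \<in> poly_ring S \<Longrightarrow> coef n p \<in> poly_ring S1"
  using keys_push[of s "restr (\<lambda>m. t m = n) p"] keys_s
  unfolding coef_def poly_ring_def keys_restr by blast

lemma coef_mult:
  assumes "r \<in> poly_ring S1" "p \<in> poly_ring S"
  shows "coef n (r * p) = r * coef n p"
proof -
  have "coef n (r * p) = (\<Sum>a\<in>keys r. \<Sum>m\<in>keys p. single a (lookup r a)
      * coef n (single m (lookup p m)))"
    unfolding poly_mult_expand[of r p] coef_sum
    by (intro sum.cong refl) (use assms in \<open>auto simp: coef_single mult_single poly_ring_def s_add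
        t_add\<close>)
  also have "\<dots> = r * coef n p"
    by (simp add: coef_sum flip: sum_distrib_left sum_distrib_right poly_mapping_expand coef_sum)
  finally show ?thesis .
qed

lemma coef_eq_0: "n \<notin> t ` keys p \<Longrightarrow> coef n p = 0"
proof -
  assume "n \<notin> t ` keys p"
  then have "restr (\<lambda>m. t m = n) p = 0" by (intro poly_mapping_eqI) (auto simp: in_keys_iff)
  then show ?thesis by (simp add: coef_def)
qed

text \<open>A monomial \<open>m\<close> is replaced by \<open>\<mu> (t m)\<close> times
  \<open>s m\<close>, which has the same leading part and type. \<open>T\<close> may exceed the
  types of \<open>p\<close>, so that one \<open>T\<close> serves all coordinates of a
  vector.\<close>

lemma normal_form:
  fixes p :: "('x, 'k::comm_ring_1) polynomial"
  assumes p: "p \<in> poly_ring S" and T: "finite T" "t ` keys p \<subseteq> T" "T \<subseteq> t ` {m. keys m \<subseteq> S}"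
  shows "p - (\<Sum>n\<in>T. single (\<mu> n) 1 * coef n p) \<in> J"
proof -
  have mu: "single (\<mu> n) (1 :: 'k) \<in> poly_ring S" if "n \<in> T" for n
    using that T(3) keys_\<mu> by (auto intro!: poly_ring_single)
  have cp: "coef n p \<in> poly_ring S" for n
    using coef_poly_ring[OF p] poly_ring_mono[OF S1] by blast
  have "coef k (\<Sum>n\<in>T. single (\<mu> n) 1 * coef n p) = coef k p" for k
  proof -
    have "coef k (\<Sum>n\<in>T. single (\<mu> n) 1 * coef n p) = (\<Sum>n\<in>T. coef n p * coef k (single (\<mu> n) 1))"
      unfolding coef_sum
      by (intro sum.cong refl) (simp add: mult.commute[of "single _ _"] coef_mult[OF
          coef_poly_ring[OF p] mu])
    also have "\<dots> = (\<Sum>n\<in>T. if n = k then coef n p else 0)"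
      by (intro sum.cong refl) (use T(3) in \<open>auto simp: coef_single s_\<mu> t_\<mu>\<close>)
    also have "\<dots> = (if k \<in> T then coef k p else 0)" using T(1) by simp
    also have "\<dots> = coef k p" using coef_eq_0[of k p] T(2) by auto
    finally show ?thesis .
  qed
  moreover have "p - (\<Sum>n\<in>T. single (\<mu> n) 1 * coef n p) \<in> poly_ring S"
    by (intro poly_ring_diff poly_ring_sum poly_ring_mult p mu cp)
  ultimately show ?thesis by (simp add: J_def coef_diff)
qed

lemma J_ideal:
  shows "0 \<in> J" "p \<in> J \<Longrightarrow> q \<in> J \<Longrightarrow> p + q \<in> J" "r \<in> poly_ring S \<Longrightarrow> p \<in> J \<Longrightarrow> r * p \<in> J"
proof -
  show "0 \<in> J" by (simp add: J_def)
  show "p \<in> J \<Longrightarrow> q \<in> J \<Longrightarrow> p + q \<in> J" by (simp add: J_def coef_add poly_ring_add)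
  assume r: "r \<in> poly_ring S" and p: "p \<in> J"
  then have "push (\<lambda>m. (s m, t m)) (r * p) = 0"
    by (intro push_eq_0_mult[where S = S]) (auto simp: J_def coef_eq_0_iff dest: st_cong)
  then show "r * p \<in> J" using r p by (simp add: J_def coef_eq_0_iff poly_ring_mult)
qed

definition coef_vec :: "'i \<Rightarrow> (nat \<Rightarrow>\<^sub>0 ('x, 'k::comm_ring_1) polynomial) \<Rightarrow> (nat \<Rightarrow>\<^sub>0 ('x, 'k)
    polynomial)" where
  "coef_vec n v = Poly_Mapping.map (coef n) v"

lemma lookup_coef_vec [simp]: "lookup (coef_vec n v) b = coef n (lookup v b)"
  by (auto simp: coef_vec_def Poly_Mapping.map.rep_eq when_def)

lemma keys_coef_vec: "keys (coef_vec n v) \<subseteq> keys v"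
  by (auto simp: in_keys_iff)

lemma coef_vec_free_mod: "v \<in> free_mod S B \<Longrightarrow> coef_vec n v \<in> free_mod S1 B"
  using keys_coef_vec[of n v] by (auto simp: free_mod_def coef_poly_ring)

lemma coef_vec_lin_ext:
  assumes "v \<in> free_mod S B" "\<And>b. b \<in> B \<Longrightarrow> f b \<in> free_mod S1 C"
  shows "coef_vec n (lin_ext f v) = lin_ext f (coef_vec n v)"
proof (rule poly_mapping_eqI)
  fix c
  have "lookup (coef_vec n (lin_ext f v)) c = (\<Sum>b\<in>keys v. coef n (lookup (f b) c * lookup v b))"
    by (simp add: lookup_lin_ext coef_sum mult.commute)
  also have "\<dots> = (\<Sum>b\<in>keys v. coef n (lookup v b) * lookup (f b) c)"
  proof (intro sum.cong refl)
    fix b assume "b \<in> keys v"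
    then have "lookup (f b) c \<in> poly_ring S1" "lookup v b \<in> poly_ring S"
      using assms by (auto simp: free_mod_def)
    then show "coef n (lookup (f b) c * lookup v b) = coef n (lookup v b) * lookup (f b) c"
      by (subst coef_mult) (auto simp: mult.commute)
  qed
  also have "\<dots> = lookup (lin_ext f (coef_vec n v)) c"
    by (simp add: lin_ext_superset[OF finite_keys keys_coef_vec] lookup_sum)
  finally show "lookup (coef_vec n (lin_ext f v)) c = lookup (lin_ext f (coef_vec n v)) c" .
qed

lemma coef_aug_map:
  assumes "v \<in> free_mod S B" "\<And>b. b \<in> B \<Longrightarrow> a b \<in> poly_ring S1"
  shows "coef n (aug_map a v) = aug_map a (coef_vec n v)"
proof -
  have "coef n (aug_map a v) = (\<Sum>b\<in>keys v. coef n (a b * lookup v b))"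
    by (simp add: aug_map_def coef_sum mult.commute)
  also have "\<dots> = (\<Sum>b\<in>keys v. coef n (lookup v b) * a b)"
    by (intro sum.cong refl) (use assms in \<open>auto simp: free_mod_def coef_mult mult.commute\<close>)
  also have "\<dots> = aug_map a (coef_vec n v)"
    unfolding aug_map_def
    by (subst sum_keys_superset[where A = "keys v" and f = "\<lambda>b c. c * a b"])
       (auto simp: in_keys_iff)
  finally show ?thesis .
qed

definition Jvec :: "(nat \<Rightarrow>\<^sub>0 ('x, 'k::comm_ring_1) polynomial) set" where
  "Jvec = {v. \<forall>b. lookup v b \<in> J}"

lemma submodule_Jvec: "submodule S Jvec"
  by (auto simp: submodule_def Jvec_def lookup_add intro: J_ideal)

text \<open>Exactness survives the base change to \<open>K[S]/J\<close> because this is a free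
  module over \<open>K[S1]\<close>: every coefficient vector has a preimage, and the preimages are
  reassembled with the factors \<open>\<mu> n\<close>.\<close>

lemma extended_exactness:
  fixes v :: "nat \<Rightarrow>\<^sub>0 ('x, 'k::comm_ring_1) polynomial"
  assumes F: "resolution S1 I F"
    and v: "v \<in> free_mod S (gens F i)" "\<And>n. coef_vec n v \<in> syz S1 I F i"
  shows "\<exists>w\<in>free_mod S (gens F (Suc i)). v - lin_ext (bdry F i) w \<in> Jvec"
proof -
  interpret F: resolution S1 I F by fact
  have "\<forall>n. \<exists>w. w \<in> free_mod S1 (gens F (Suc i)) \<and> coef_vec n v = lin_ext (bdry F i) w"
    using v(2) unfolding F.syz_eq by blast
  from choice[OF this] obtain w where w:
    "\<forall>n. w n \<in> free_mod S1 (gens F (Suc i)) \<and> coef_vec n v = lin_ext (bdry F i) (w n)" ..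
  define T where "T = (\<Union>b\<in>keys v. t ` keys (lookup v b))"
  have T: "finite T" "t ` keys (lookup v b) \<subseteq> T" for b
  proof -
    show "finite T" by (simp add: T_def)
    show "t ` keys (lookup v b) \<subseteq> T"
      by (cases "b \<in> keys v") (auto simp: T_def in_keys_iff)
  qed
  have TS: "T \<subseteq> t ` {m. keys m \<subseteq> S}"
    using v(1) unfolding T_def free_mod_def poly_ring_def by blast
  let ?w = "\<Sum>n\<in>T. vec_scale (single (\<mu> n) 1) (w n)"
  have "?w \<in> free_mod S (gens F (Suc i))"
  proof (rule submodule_sum[OF submodule_free_mod])
    fix n assume "n \<in> T"
    then have "single (\<mu> n) (1 :: 'k) \<in> poly_ring S"
      using TS keys_\<mu> by (auto intro!: poly_ring_single)
    moreover have "w n \<in> free_mod S (gens F (Suc i))" using w free_mod_mono[OF S1] by blast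
    ultimately show "vec_scale (single (\<mu> n) 1) (w n) \<in> free_mod S (gens F (Suc i))"
      using submodule_free_mod unfolding submodule_def by blast
  qed
  moreover have "v - lin_ext (bdry F i) ?w \<in> Jvec"
    unfolding Jvec_def
  proof safe
    fix b
    have "lin_ext (bdry F i) ?w = (\<Sum>n\<in>T. vec_scale (single (\<mu> n) 1) (coef_vec n v))"
      using w by (simp add: lin_ext_sum lin_ext_scale)
    then have "lookup (v - lin_ext (bdry F i) ?w) b = lookup v b - (\<Sum>n\<in>T. single (\<mu> n)
        1 * coef n (lookup v b))"
      by (simp add: lookup_minus lookup_sum)
    also have "\<dots> \<in> J"
      by (rule normal_form[OF _ T TS]) (use v(1) in \<open>auto simp: free_mod_def\<close>)
    finally show "lookup (v - lin_ext (bdry F i) ?w) b \<in> J" .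
  qed
  ultimately show ?thesis by blast
qed

lemma coef_vec_syz_0:
  assumes "resolution S1 I F" "v \<in> free_mod S (gens F 0)" "\<And>n. coef n (aug_map (aug F) v) \<in> I"
  shows "coef_vec n v \<in> syz S1 I F 0"
proof -
  interpret resolution S1 I F by fact
  show ?thesis
    using assms(3)[of n] coef_vec_free_mod[OF assms(2)]
    by (simp add: syz_0 coef_aug_map[OF assms(2) aug_poly_ring])
qed

lemma coef_vec_syz_Suc:
  assumes "resolution S1 I F" "v \<in> free_mod S (gens F (Suc i))" "lin_ext (bdry F i) v \<in> Jvec"
  shows "coef_vec n v \<in> syz S1 I F (Suc i)"
proof -
  interpret resolution S1 I F by fact
  have "coef_vec n (lin_ext (bdry F i) v) = 0"
    using assms(3) by (intro poly_mapping_eqI) (auto simp: Jvec_def J_def)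
  then show ?thesis
    using coef_vec_free_mod[OF assms(2)] coef_vec_lin_ext[OF assms(2) bdry_free_mod]
    by (simp add: syz_Suc)
qed

end

section \<open>Toric ideals of edge splittings\<close>

text \<open>The exponent vector of the image of the monomial \<open>m\<close> under the edge
  homomorphism.\<close>

definition xdeg :: "('v set \<Rightarrow>\<^sub>0 nat) \<Rightarrow> ('v \<Rightarrow>\<^sub>0 nat)" where
  "xdeg m = (\<Sum>f\<in>keys m. \<Sum>v\<in>f. single v (lookup m f))"

lemma xdeg_zero [simp]: "xdeg 0 = 0"
  by (simp add: xdeg_def)

lemma xdeg_add: "xdeg (m + n) = xdeg m + xdeg n"
  unfolding xdeg_def
  by (rule setsum_keys_plus_distrib) (auto simp: single_add sum.distrib)

lemma xdeg_single: "xdeg (single f k) = (\<Sum>v\<in>f. single v k)"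
  by (auto simp: xdeg_def)

lemma prod_single: "(\<Prod>x\<in>A. single (g x) (1 :: 'k::comm_ring_1)) = single (\<Sum>x\<in>A. g x) 1"
  for g :: "'a \<Rightarrow> 'b \<Rightarrow>\<^sub>0 nat"
  by (induction A rule: infinite_finite_induct) (auto simp: mult_single)

lemma poly_var_power: "(poly_var v :: ('v, 'k::comm_ring_1) polynomial) ^ k = single (single v k) 1"
  by (induction k) (auto simp: poly_var_def mult_single simp flip: single_add)

lemma edge_hom_eq_push: "edge_hom p = push xdeg p"
  by (simp add: edge_hom_def push_def xdeg_def poly_const_def poly_var_power prod_single mult_single
      prod_power_distrib)

lemma toric_ideal_eq: "toric_ideal E = {p \<in> poly_ring E. push xdeg p = 0}"
  by (simp add: toric_ideal_def edge_hom_eq_push)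

lemma lookup_xdeg:
  assumes "\<And>f. f \<in> keys m \<Longrightarrow> finite f"
  shows "lookup (xdeg m) v = (\<Sum>f\<in>keys m. if v \<in> f then lookup m f else 0)"
  unfolding xdeg_def lookup_sum
proof (intro sum.cong refl)
  fix f assume "f \<in> keys m"
  then have "finite f" by (rule assms)
  then show "(\<Sum>u\<in>f. lookup (single u (lookup m f)) v) = (if v \<in> f then lookup m f else 0)"
    by (auto simp: lookup_single when_def)
qed

lemma monom_degree_sum: "monom_degree (sum g A) = (\<Sum>x\<in>A. monom_degree (g x))"
  by (induction A rule: infinite_finite_induct) (auto simp: monom_degree_add)

lemma monom_degree_xdeg:
  assumes "\<And>f. f \<in> keys m \<Longrightarrow> card f = 2"
  shows "monom_degree (xdeg m) = 2 * monom_degree m"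
  using assms by (simp add: xdeg_def monom_degree_sum monom_degree_def[of m] sum_distrib_left)

text \<open>Every edge has two ends, so the edge homomorphism doubles degrees, and homogeneous
  components of its kernel stay in the kernel.\<close>

lemma graded_ideal_toric_ideal:
  assumes "\<And>f. f \<in> E \<Longrightarrow> card f = 2"
  shows "graded_ideal E (toric_ideal E :: ('v set, 'k::comm_ring_1) polynomial set)"
  unfolding graded_ideal_def
proof (intro conjI ballI allI)
  show "toric_ideal E \<subseteq> poly_ring E" "0 \<in> toric_ideal E" by (auto simp: toric_ideal_eq)
next
  fix p q :: "('v set, 'k) polynomial" assume "p \<in> toric_ideal E" "q \<in> toric_ideal E"
  then show "p + q \<in> toric_ideal E" by (simp add: toric_ideal_eq push_add poly_ring_add)
next
  fix r p :: "('v set, 'k) polynomial" assume "r \<in> poly_ring E" "p \<in> toric_ideal E"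
  then show "r * p \<in> toric_ideal E"
    using push_eq_0_mult[of xdeg p E r] by (simp add: toric_ideal_eq poly_ring_mult xdeg_add)
next
  fix p :: "('v set, 'k) polynomial" and d assume p: "p \<in> toric_ideal E"
  have "push xdeg (restr (\<lambda>m. monom_degree m = d) p) = restr (\<lambda>y. monom_degree y = 2 * d)
      (push xdeg p)"
  proof (rule poly_mapping_eqI)
    fix y
    have deg: "monom_degree (xdeg m) = 2 * monom_degree m" if "m \<in> keys p" for m
      by (rule monom_degree_xdeg) (use p that assms in \<open>auto simp: toric_ideal_eq poly_ring_def\<close>)
    have "lookup (push xdeg (restr (\<lambda>m. monom_degree m = d) p)) y
        = (\<Sum>m\<in>keys p. if monom_degree m = d then if xdeg m = y then lookup p m else 0 else 0)"
      by (auto simp: lookup_push keys_restr sum.inter_filter intro!: sum.cong)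
    also have "\<dots> = (\<Sum>m\<in>keys p. if monom_degree y = 2 * d then if xdeg m =
        y then lookup p m else 0 else 0)"
      by (intro sum.cong refl) (auto simp: deg)
    also have "\<dots> = lookup (restr (\<lambda>y. monom_degree y = 2 * d) (push xdeg p)) y"
      by (simp add: lookup_push)
    finally show "lookup (push xdeg (restr (\<lambda>m. monom_degree m = d) p)) y
        = lookup (restr (\<lambda>y. monom_degree y = 2 * d) (push xdeg p)) y" .
  qed
  then show "restr (\<lambda>m. monom_degree m = d) p \<in> toric_ideal E"
    using p by (simp add: toric_ideal_eq restr_poly_ring)
qed

text \<open>Only the trivial monomial has vertex degree \<open>0\<close>. This supplies the
  assumption on \<open>I\<close> in \<open>minimal_resolution_exists\<close>.\<close>

lemma toric_ideal_lookup_0: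
  assumes "\<And>f. f \<in> E \<Longrightarrow> card f = 2" "p \<in> toric_ideal E"
  shows "lookup p 0 = 0"
proof -
  have "xdeg m = 0 \<longleftrightarrow> m = 0" if "m \<in> keys p" for m
  proof -
    have "monom_degree (xdeg m) = 2 * monom_degree m"
      by (rule monom_degree_xdeg) (use assms that in \<open>auto simp: toric_ideal_eq poly_ring_def\<close>)
    then show ?thesis by (metis monom_degree_eq_0_iff mult_eq_0_iff zero_neq_numeral)
  qed
  then have "lookup (push xdeg p) 0 = (\<Sum>m\<in>keys p. if m = 0 then lookup p m else 0)"
    unfolding lookup_push by (intro sum.cong refl) simp
  also have "\<dots> = lookup p 0" by (auto simp: in_keys_iff)
  finally show ?thesis using assms(2) by (simp add: toric_ideal_eq)
qed

text \<open>\<open>fibre\<close> is the form in which bipartiteness is used. Apart from it the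
  tensor product argument relies only on edges having two ends and on \<open>e\<close> being the one
  common edge.\<close>

locale edge_glueing =
  fixes E1 E2 :: "'v set set" and e :: "'v set"
  assumes card2: "\<And>f. f \<in> E1 \<union> E2 \<Longrightarrow> card f = 2" and e: "E1 \<inter> E2 = {e}"
    and fibre: "\<And>m m'. keys m \<subseteq> E1 \<union> E2 \<Longrightarrow> keys m' \<subseteq> E1 \<union> E2 \<Longrightarrow> xdeg m = xdeg m' \<Longrightarrow>
      \<exists>j j'. xdeg (restr (\<lambda>f. f \<in> E2) m) + xdeg (single e j) = xdeg (restr (\<lambda>f. f \<in> E2) m') +
          xdeg (single e j')"
begin

definition part2 :: "('v set \<Rightarrow>\<^sub>0 nat) \<Rightarrow> ('v set \<Rightarrow>\<^sub>0 nat)" where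
  "part2 m = restr (\<lambda>f. f \<in> E2) m"

definition part1 :: "('v set \<Rightarrow>\<^sub>0 nat) \<Rightarrow> ('v set \<Rightarrow>\<^sub>0 nat)" where
  "part1 m = restr (\<lambda>f. f \<notin> E2) m"

lemma part1_add: "part1 (m + n) = part1 m + part1 n"
  and part2_add: "part2 (m + n) = part2 m + part2 n"
  by (simp_all add: part1_def part2_def restr_add)

lemma part_sum: "part1 m + part2 m = m"
  by (rule poly_mapping_eqI) (simp add: part1_def part2_def lookup_add)

lemma keys_part2: "keys (part2 m) \<subseteq> E2"
  and keys_part1: "keys (part1 m) \<inter> E2 = {}"
  and keys_part1_subset: "keys (part1 m) \<subseteq> keys m"
  by (auto simp: part1_def part2_def keys_restr)

lemma part_E2:
  assumes "keys m \<subseteq> E2"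
  shows "part1 m = 0" "part2 m = m"
  using assms by (auto simp: part1_def part2_def in_keys_iff intro!: poly_mapping_eqI)

lemma part2_E1:
  assumes "keys m \<subseteq> E1"
  shows "part2 m = single e (lookup m e)"
proof (rule poly_mapping_eqI)
  fix f
  show "lookup (part2 m) f = lookup (single e (lookup m e)) f"
  proof (cases "f = e")
    case True
    then show ?thesis using e by (auto simp: part2_def)
  next
    case False
    then have "f \<in> E2 \<Longrightarrow> f \<notin> keys m" using assms e by blast
    then show ?thesis using False by (auto simp: part2_def lookup_single in_keys_iff)
  qed
qed

text \<open>\<open>K[E]\<close> is the polynomial ring over \<open>K[E2]\<close> in the edges
  outside \<open>E2\<close>. The common edge belongs to \<open>part2\<close>, and the monomials
  \<open>part1 m\<close> form a basis.\<close>

sublocale D2: monomial_decomp "E1 \<union> E2" E2 part2 part1 "\<lambda>n. n"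
proof
  fix a m :: "'v set \<Rightarrow>\<^sub>0 nat" assume a: "keys a \<subseteq> E2"
  show "part2 (a + m) = a + part2 m" "part1 (a + m) = part1 m"
    using part_E2[OF a] by (simp_all add: part1_add part2_add)
next
  fix m :: "'v set \<Rightarrow>\<^sub>0 nat" assume m: "keys m \<subseteq> E1 \<union> E2"
  show "keys (part2 m) \<subseteq> E2" by (rule keys_part2)
  show "keys (part1 m) \<subseteq> E1 \<union> E2" using m keys_part1_subset by blast
  show "part2 (part1 m) = 0" "part1 (part1 m) = part1 m"
    by (auto simp: part1_def part2_def intro!: poly_mapping_eqI)
next
  fix q m m' assume "part2 m = part2 m'" "part1 m = part1 m'"
  then have "m = m'" by (metis part_sum)
  then show "part2 (q + m) = part2 (q + m') \<and> part1 (q + m) = part1 (q + m')" by simp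
qed simp

text \<open>
  The vertex degrees of monomials in the edges of \<open>E2\<close> form a semigroup. Multiplication by \<open>e\<close>
  acts freely on it; \<open>core u\<close> generates the orbit of \<open>u\<close>, and \<open>mult u\<close> is the power of \<open>e\<close>
  leading to \<open>u\<close>.
\<close>

definition degs :: "('v \<Rightarrow>\<^sub>0 nat) set" where
  "degs = xdeg ` {m. keys m \<subseteq> E2}"

definition mult :: "('v \<Rightarrow>\<^sub>0 nat) \<Rightarrow> nat" where
  "mult u = (GREATEST j. \<exists>w\<in>degs. u = w + xdeg (single e j))"

definition core :: "('v \<Rightarrow>\<^sub>0 nat) \<Rightarrow> ('v \<Rightarrow>\<^sub>0 nat)" where
  "core u = u - xdeg (single e (mult u))"

lemma e_in: "e \<in> E1" "e \<in> E2" "card e = 2"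
  using e card2 by auto

text \<open>Since \<open>e\<close> has two ends, its \<open>j\<close>-th power contributes
  \<open>2 * j\<close> to the degree. The bound makes the greatest exponent in \<open>mult\<close>
  exist.\<close>

lemma mult_bound: "u = w + xdeg (single e j) \<Longrightarrow> j \<le> monom_degree u"
proof -
  have "monom_degree (xdeg (single e j)) = 2 * j"
    using monom_degree_xdeg[of "single e j"] e_in(3) by (cases "j = 0") auto
  then show "u = w + xdeg (single e j) \<Longrightarrow> j \<le> monom_degree u" by (simp add: monom_degree_add)
qed

lemma core:
  assumes "u \<in> degs"
  shows "core u \<in> degs" "core u + xdeg (single e (mult u)) = u"
proof -
  have "\<exists>w\<in>degs. u = w + xdeg (single e (mult u))"
    unfolding mult_def
    by (rule GreatestI_nat[where k = 0 and b = "monom_degree u"]) (use assms mult_bound in auto)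
  then obtain w where w: "w \<in> degs" "u = w + xdeg (single e (mult u))" by blast
  from w(2) have "core u = w" unfolding core_def by (metis add_diff_cancel_right')
  with w show "core u \<in> degs" "core u + xdeg (single e (mult u)) = u" by simp_all
qed

lemma le_mult: "w \<in> degs \<Longrightarrow> u = w + xdeg (single e j) \<Longrightarrow> j \<le> mult u"
  unfolding mult_def
  by (rule Greatest_le_nat[where b = "monom_degree u"]) (use mult_bound in auto)

lemma degs_add: "u \<in> degs \<Longrightarrow> u + xdeg (single e j) \<in> degs"
proof -
  assume "u \<in> degs"
  then obtain m where m: "keys m \<subseteq> E2" "u = xdeg m" by (auto simp: degs_def)
  have "keys (m + single e j) \<subseteq> E2"
    using keys_add[of m "single e j"] m e_in by (auto split: if_splits)
  then show ?thesis using m by (auto simp: degs_def xdeg_add intro!: image_eqI[where x = "m +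
      single e j"])
qed

text \<open>The largest power of \<open>e\<close> split off from the product contains the
  \<open>j\<close>-th power; cancelling that leaves a power split off from \<open>u\<close>, which
  is bounded by \<open>mult u\<close>.\<close>

lemma mult_core_add:
  assumes "u \<in> degs"
  shows "mult (u + xdeg (single e j)) = mult u + j" "core (u + xdeg (single e j)) = core u"
proof -
  let ?u = "u + xdeg (single e j)"
  have "?u = core u + xdeg (single e (mult u + j))"
    using core(2)[OF assms] by (simp add: single_add xdeg_add add.assoc[symmetric])
  then have ge: "mult u + j \<le> mult ?u" by (rule le_mult[OF core(1)[OF assms]])
  have c: "core ?u \<in> degs" "core ?u + xdeg (single e (mult ?u)) = ?u"
    using core degs_add assms by blast+
  obtain d where d: "mult ?u = d + j" using ge by (metis add.commute add_leD2 le_add_diff_inverse)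
  have "core ?u + xdeg (single e d) + xdeg (single e j) = u + xdeg (single e j)"
    using c(2) unfolding d by (simp add: single_add xdeg_add add.assoc)
  then have u: "u = core ?u + xdeg (single e d)" by simp
  then have "d \<le> mult u" using le_mult c(1) by blast
  then show m: "mult ?u = mult u + j" using ge d by simp
  then have "d = mult u" using d by simp
  then show "core ?u = core u" using u core(2)[OF assms] by (metis add_right_cancel)
qed

lemma core_core:
  assumes "u \<in> degs"
  shows "core (core u) = core u" "mult (core u) = 0"
  using mult_core_add[OF core(1)[OF assms], of "mult u"] core(2)[OF assms] by auto

lemma xdeg_part2_degs: "xdeg (part2 m) \<in> degs"
  using keys_part2 by (auto simp: degs_def)

text \<open>All powers of \<open>e\<close> that can be split off from the part over
  \<open>E2\<close> modulo \<open>I\<^sub>2\<close> are moved to the part over \<open>E1\<close>.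
  What remains is the orbit generator \<open>kind m\<close>, realised by the monomial
  \<open>rep (kind m)\<close>.\<close>

definition lead :: "('v set \<Rightarrow>\<^sub>0 nat) \<Rightarrow> ('v set \<Rightarrow>\<^sub>0 nat)" where
  "lead m = part1 m + single e (mult (xdeg (part2 m)))"

definition kind :: "('v set \<Rightarrow>\<^sub>0 nat) \<Rightarrow> ('v \<Rightarrow>\<^sub>0 nat)" where
  "kind m = core (xdeg (part2 m))"

definition rep :: "('v \<Rightarrow>\<^sub>0 nat) \<Rightarrow> ('v set \<Rightarrow>\<^sub>0 nat)" where
  "rep u = (SOME m. keys m \<subseteq> E2 \<and> xdeg m = u)"

lemma rep: "u \<in> degs \<Longrightarrow> keys (rep u) \<subseteq> E2 \<and> xdeg (rep u) = u"
  unfolding rep_def by (rule someI_ex) (auto simp: degs_def)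

lemma kind_degs: "kind m \<in> degs"
  unfolding kind_def by (rule core(1)[OF xdeg_part2_degs])

text \<open>\<open>part1\<close> contains no factor \<open>e\<close>, so the split-off power is
  recovered as the exponent of \<open>e\<close> in \<open>lead\<close>. The relation is thus
  congruence of monomials modulo the extension of \<open>I\<^sub>2\<close>.\<close>

lemma lead_kind_eq_iff:
  "lead m = lead m' \<and> kind m = kind m' \<longleftrightarrow> part1 m = part1 m' \<and> xdeg (part2 m) = xdeg (part2 m')"
proof
  assume eq: "lead m = lead m' \<and> kind m = kind m'"
  have "lookup (part1 m) e = 0" "lookup (part1 m') e = 0" using e_in by (simp_all add: part1_def)
  moreover have "lookup (lead m) e = lookup (lead m') e" using eq by simp
  ultimately have k: "mult (xdeg (part2 m)) = mult (xdeg (part2 m'))"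
      by (simp add: lead_def lookup_add)
  then have "part1 m = part1 m'" using eq by (simp add: lead_def)
  moreover have "xdeg (part2 m) = xdeg (part2 m')"
    using eq k core(2)[OF xdeg_part2_degs] unfolding kind_def by metis
  ultimately show "part1 m = part1 m' \<and> xdeg (part2 m) = xdeg (part2 m')" by simp
qed (simp add: lead_def kind_def)

text \<open>The quotient of \<open>K[E]\<close> by the extension of \<open>I\<^sub>2\<close> is free
  over \<open>K[E1]\<close>, with one basis element for each orbit of vertex degrees under
  \<open>e\<close>.\<close>

sublocale D1: monomial_decomp "E1 \<union> E2" E1 lead kind rep
proof
  fix a m :: "'v set \<Rightarrow>\<^sub>0 nat" assume a: "keys a \<subseteq> E1"
  have x: "xdeg (part2 (a + m)) = xdeg (part2 m) + xdeg (single e (lookup a e))"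
    by (simp add: part2_add xdeg_add part2_E1[OF a] add.commute)
  have "part1 a + single e (lookup a e) = a" using part_sum[of a] part2_E1[OF a] by simp
  then show "lead (a + m) = a + lead m"
    unfolding lead_def x mult_core_add[OF xdeg_part2_degs] part1_add
    by (metis (no_types, lifting) add.assoc add.commute single_add)
  show "kind (a + m) = kind m" unfolding kind_def x mult_core_add[OF xdeg_part2_degs] ..
next
  fix m :: "'v set \<Rightarrow>\<^sub>0 nat" assume m: "keys m \<subseteq> E1 \<union> E2"
  have "keys (lead m) \<subseteq> keys (part1 m) \<union> {e}"
    using keys_add[of "part1 m" "single e (mult (xdeg (part2 m)))"] unfolding lead_def
    by (auto split: if_splits)
  then show "keys (lead m) \<subseteq> E1" using keys_part1[of m] keys_part1_subset[of m] m e_in by blast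
  have r: "keys (rep (kind m)) \<subseteq> E2" "xdeg (rep (kind m)) = kind m" using rep[OF kind_degs] by auto
  then show "keys (rep (kind m)) \<subseteq> E1 \<union> E2" by blast
  show "lead (rep (kind m)) = 0"
    unfolding lead_def part_E2[OF r(1)] r(2) by (simp add: kind_def core_core[OF xdeg_part2_degs])
  show "kind (rep (kind m)) = kind m"
    unfolding kind_def[of "rep _"] part_E2[OF r(1)] r(2)
        by (simp add: kind_def core_core[OF xdeg_part2_degs])
next
  fix q m m' assume "lead m = lead m'" "kind m = kind m'"
  then have "part1 m = part1 m'" "xdeg (part2 m) = xdeg (part2 m')" using lead_kind_eq_iff by blast+
  then show "lead (q + m) = lead (q + m') \<and> kind (q + m) = kind (q + m')"
    unfolding lead_kind_eq_iff by (simp add: part1_add part2_add xdeg_add)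
qed simp

text \<open>By \<open>lead_kind_eq_iff\<close> the two sides are kernels of \<open>push\<close> maps
  that identify the same monomials. The right side describes the extension of
  \<open>I\<^sub>2\<close> by coefficients at monomials in the edges outside
  \<open>E2\<close>.\<close>

lemma D1_J_iff: "p \<in> D1.J \<longleftrightarrow> p \<in> poly_ring (E1 \<union> E2) \<and> (\<forall>n. D2.coef n p \<in> toric_ideal E2)"
proof -
  have "(\<forall>n. push xdeg (D2.coef n p) = 0) \<longleftrightarrow> (\<forall>n. D1.coef n p = 0)"
    unfolding D1.coef_eq_0_iff D2.push_coef_eq_0_iff
  proof
    assume "push (\<lambda>m. (xdeg (part2 m), part1 m)) p = 0"
    then show "push (\<lambda>m. (lead m, kind m)) p = 0"
      by (rule push_eq_0_factor) (simp add: lead_kind_eq_iff)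
  next
    assume "push (\<lambda>m. (lead m, kind m)) p = 0"
    then show "push (\<lambda>m. (xdeg (part2 m), part1 m)) p = 0"
      by (rule push_eq_0_factor) (simp add: lead_kind_eq_iff)
  qed
  then show ?thesis using D2.coef_poly_ring by (auto simp: D1.J_def toric_ideal_eq)
qed

text \<open>By \<open>fibre\<close>, monomials with equal vertex degrees have the same
  \<open>kind\<close>; cancelling it leaves leading parts with equal vertex degrees. In effect
  \<open>I\<close> is contained in the sum of the extensions of \<open>I\<^sub>1\<close> and
  \<open>I\<^sub>2\<close>.\<close>

lemma D1_coef_toric_ideal:
  assumes p: "p \<in> toric_ideal (E1 \<union> E2)"
  shows "D1.coef n p \<in> toric_ideal E1"
proof -
  have p': "p \<in> poly_ring (E1 \<union> E2)" "push xdeg p = 0" using p by (auto simp: toric_ideal_eq)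
  have "push (\<lambda>m. (xdeg (lead m), kind m)) p = 0"
  proof (rule push_eq_0_factor[OF p'(2)])
    fix m m' assume m: "m \<in> keys p" "m' \<in> keys p" "xdeg m = xdeg m'"
    have dec: "xdeg m = xdeg (lead m) + kind m" for m
    proof -
      have "xdeg m = xdeg (part1 m) + xdeg (part2 m)" by (metis part_sum xdeg_add)
      also have "xdeg (part2 m) = xdeg (single e (mult (xdeg (part2 m)))) + kind m"
        using core(2)[OF xdeg_part2_degs] unfolding kind_def by (metis add.commute)
      finally show ?thesis by (simp add: lead_def xdeg_add add.assoc)
    qed
    have "keys m \<subseteq> E1 \<union> E2" "keys m' \<subseteq> E1 \<union> E2" using m p' by (auto simp: poly_ring_def)
    then obtain j j' where "xdeg (part2 m) + xdeg (single e j) = xdeg (part2 m') +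
        xdeg (single e j')"
      using fibre m(3) unfolding part2_def by blast
    then have "kind m = kind m'"
      unfolding kind_def by (metis mult_core_add(2) xdeg_part2_degs)
    moreover from this have "xdeg (lead m) = xdeg (lead m')" using dec[of m] dec[of m'] m(3) by simp
    ultimately show "(xdeg (lead m), kind m) = (xdeg (lead m'), kind m')" by simp
  qed
  then have "push xdeg (D1.coef n p) = 0" using D1.push_coef_eq_0_iff by blast
  then show ?thesis using D1.coef_poly_ring[OF p'(1)] by (simp add: toric_ideal_eq)
qed

end

text \<open>
  On the part of a monomial over the bipartite graph, the vertex degrees of both sides have the
  same sum. Two monomials with equal vertex degrees therefore differ by the same amount at both
  ends of the common edge, and this difference is compensated by powers of \<open>e\<close>.
\<close>

lemma edge_glueing_of_splitting:
  assumes G: "simple_graph V E" and sp: "splitting_along_edge V E W1 W2 e"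
    and E1: "E1 = induced_edges E W1" and E2: "E2 = induced_edges E W2"
    and bip: "bipartite_graph W1 E1"
  shows "edge_glueing E1 E2 e" "E1 \<union> E2 = E"
proof -
  have W: "W1 \<subseteq> V" "W1 \<union> W2 = V" "W1 \<inter> W2 = e" "induced_edges E e = {e}"
    "\<And>u w. u \<in> W1 - e \<Longrightarrow> w \<in> W2 - e \<Longrightarrow> {u, w} \<notin> E"
    using sp by (auto simp: splitting_along_edge_def splitting_def)
  have edge: "f \<subseteq> V \<and> card f = 2" if "f \<in> E" for f using G that by (auto simp: simple_graph_def)
  have fin: "finite f" if "f \<in> E" for f
    using edge[OF that] G finite_subset by (auto simp: simple_graph_def)
  have sub: "f \<subseteq> W1" if "f \<in> E1" for f using that E1 by (auto simp: induced_edges_def)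
  have sub2: "f \<subseteq> W2" if "f \<in> E2" for f using that E2 by (auto simp: induced_edges_def)
  have "f \<in> E1 \<union> E2" if f: "f \<in> E" for f
  proof (rule ccontr)
    assume "f \<notin> E1 \<union> E2"
    then have "\<not> f \<subseteq> W1" "\<not> f \<subseteq> W2" using f by (auto simp: E1 E2 induced_edges_def)
    \<comment> \<open>An edge inside neither part joins a vertex outside \<open>W2\<close> to a
      vertex outside \<open>W1\<close>, which a splitting forbids.\<close>
    then obtain u w where uw: "w \<in> f" "w \<notin> W1" "u \<in> f" "u \<notin> W2" by blast
    then have uw': "u \<in> W1 - e" "w \<in> W2 - e" using edge[OF f] W by auto
    then have "u \<noteq> w" using uw by auto
    obtain x y where "f = {x, y}" using edge[OF f] by (auto simp: card_2_iff)
    then have "f = {u, w}" using uw \<open>u \<noteq> w\<close> by auto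
    then show False using W(5)[OF uw'] f by simp
  qed
  then show E: "E1 \<union> E2 = E" by (auto simp: E1 E2 induced_edges_def)
  have int: "E1 \<inter> E2 = {e}" using W(3,4) by (auto simp: E1 E2 induced_edges_def)
  then have eE1: "e \<in> E1" by auto
  obtain A B where AB: "A \<union> B = W1" "A \<inter> B = {}" "\<And>f. f \<in> E1 \<Longrightarrow> \<exists>a\<in>A. \<exists>b\<in>B. f = {a, b}"
    using bip by (auto simp: bipartite_graph_def)
  obtain a b where ab: "a \<in> A" "b \<in> B" "e = {a, b}" using AB(3)[OF eE1] by blast
  have finW: "finite A" "finite B" using AB(1) W(1)
      G finite_subset unfolding simple_graph_def by blast+
  \<comment> \<open>Each edge of \<open>E1\<close> has exactly one end in \<open>A\<close> and one
    in \<open>B\<close>, so either sum counts the edges with multiplicity.\<close>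
  have side: "(\<Sum>v\<in>A. lookup (xdeg r) v) = monom_degree r" "(\<Sum>v\<in>B. lookup (xdeg r) v) =
      monom_degree r"
    if r: "keys r \<subseteq> E1" for r
  proof -
    have finr: "finite f" if "f \<in> keys r" for f using r that fin E by blast
    have "(\<Sum>v\<in>C. lookup (xdeg r) v) = monom_degree r"
      if C: "finite C" "\<And>f. f \<in> E1 \<Longrightarrow> card (C \<inter> f) = 1" for C
    proof -
      have "(\<Sum>v\<in>C. lookup (xdeg r) v) = (\<Sum>f\<in>keys r. \<Sum>v\<in>C. if v \<in> f then lookup r f else 0)"
        by (simp add: lookup_xdeg[OF finr] sum.swap[of _ "keys r"])
      also have "\<dots> = (\<Sum>f\<in>keys r. card (C \<inter> f) * lookup r f)"
        using C(1) by (intro sum.cong refl) (simp flip: sum.inter_restrict)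
      also have "\<dots> = monom_degree r" unfolding monom_degree_def using r C(2)
          by (intro sum.cong refl) auto
      finally show ?thesis .
    qed note * = this
    have "card (A \<inter> f) = 1 \<and> card (B \<inter> f) = 1" if f: "f \<in> E1" for f
    proof -
      obtain x y where xy: "x \<in> A" "y \<in> B" "f = {x, y}" using AB(3)[OF f] by blast
      then have "A \<inter> f = {x}" "B \<inter> f = {y}" using AB(2) by auto
      then show ?thesis by simp
    qed
    then show "(\<Sum>v\<in>A. lookup (xdeg r) v) = monom_degree r" "(\<Sum>v\<in>B. lookup (xdeg r) v) =
        monom_degree r"
      using * finW by auto
  qed
  show "edge_glueing E1 E2 e"
  proof
    show "card f = 2" if "f \<in> E1 \<union> E2" for f using that E edge by auto
    show "E1 \<inter> E2 = {e}" by (rule int)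
    fix m m' assume m: "keys m \<subseteq> E1 \<union> E2" "keys m' \<subseteq> E1 \<union> E2" "xdeg m = xdeg m'"
    define r where "r m = restr (\<lambda>f. f \<notin> E2) m" for m :: "'a set \<Rightarrow>\<^sub>0 nat"
    define q where "q m = restr (\<lambda>f. f \<in> E2) m" for m :: "'a set \<Rightarrow>\<^sub>0 nat"
    have rq: "xdeg m = xdeg (r m) + xdeg (q m)" for m
    proof -
      have "m = r m + q m" by (rule poly_mapping_eqI) (simp add: r_def q_def lookup_add)
      then show ?thesis by (metis xdeg_add)
    qed
    have kr: "keys (r m) \<subseteq> E1" "keys (r m') \<subseteq> E1" using m by (auto simp: r_def keys_restr)
    have kq: "keys (q m) \<subseteq> E2" for m by (auto simp: q_def keys_restr)
    have q0: "lookup (xdeg (q m)) v = 0" if "v \<notin> W2" for m v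
    proof -
      have "lookup (xdeg (q m)) v = (\<Sum>f\<in>keys (q m). if v \<in> f then lookup (q m) f else 0)"
        by (rule lookup_xdeg) (use kq fin E in blast)
      also have "\<dots> = 0" using kq sub2 that by (intro sum.neutral) auto
      finally show ?thesis .
    qed
    have r0: "lookup (xdeg s) v = 0" if "v \<notin> W1" "keys s \<subseteq> E1" for s v
    proof -
      have "lookup (xdeg s) v = (\<Sum>f\<in>keys s. if v \<in> f then lookup s f else 0)"
        by (rule lookup_xdeg) (use that fin E in blast)
      also have "\<dots> = 0" using that sub by (intro sum.neutral) auto
      finally show ?thesis .
    qed
    have eq: "lookup (xdeg (r m)) v + lookup (xdeg (q m)) v = lookup (xdeg (r m')) v +
        lookup (xdeg (q m')) v" for v
      using m(3) rq[of m] rq[of m'] by (metis lookup_add)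
    have eq_r: "lookup (xdeg (r m)) v = lookup (xdeg (r m')) v" if "v \<in> W1 - e" for v
      using eq[of v] q0[of v] W that by auto
    have ba: "b \<notin> A" "a \<notin> B" using AB ab by auto
    have "(\<Sum>v\<in>A. lookup (xdeg (r m)) v) + lookup (xdeg (r m')) a = (\<Sum>v\<in>A. lookup (xdeg (r m')) v) +
        lookup (xdeg (r m)) a"
    proof -
      have "(\<Sum>v\<in>A - {a}. lookup (xdeg (r m)) v) = (\<Sum>v\<in>A - {a}. lookup (xdeg (r m')) v)"
        by (intro sum.cong refl eq_r) (use AB ab ba in auto)
      then show ?thesis by (simp add: sum.remove[OF finW(1) ab(1)])
    qed
    moreover have "(\<Sum>v\<in>B. lookup (xdeg (r m)) v) + lookup (xdeg (r m')) b =
        (\<Sum>v\<in>B. lookup (xdeg (r m')) v) + lookup (xdeg (r m)) b"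
    proof -
      have "(\<Sum>v\<in>B - {b}. lookup (xdeg (r m)) v) = (\<Sum>v\<in>B - {b}. lookup (xdeg (r m')) v)"
        by (intro sum.cong refl eq_r) (use AB ab ba in auto)
      then show ?thesis by (simp add: sum.remove[OF finW(2) ab(2)])
    qed
    \<comment> \<open>For each monomial the sums over \<open>A\<close> and \<open>B\<close> agree,
      and away from \<open>e\<close> the vertex degrees of the two \<open>E1\<close>-parts agree; so
      their discrepancy at \<open>a\<close> equals that at \<open>b\<close>.\<close>
    ultimately have bal: "lookup (xdeg (r m)) a + lookup (xdeg (r m')) b = lookup (xdeg (r m')) a +
        lookup (xdeg (r m)) b"
      by (simp add: side[OF kr(1)] side[OF kr(2)])
    have le: "lookup (xdeg (single e j)) v = (if v \<in> e then j else 0)" for j v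
      unfolding xdeg_single lookup_sum using fin[of e] E eE1
      by (auto simp: lookup_single when_def)
    have ends: "a \<in> e" "b \<in> e" using ab by auto
    \<comment> \<open>These exponents balance the two sides at \<open>a\<close>; by
      \<open>bal\<close> they do so at \<open>b\<close> too.\<close>
    let ?j = "lookup (xdeg (r m)) a" and ?j' = "lookup (xdeg (r m')) a"
    have "xdeg (q m) + xdeg (single e ?j) = xdeg (q m') + xdeg (single e ?j')"
    proof (rule poly_mapping_eqI)
      fix v
      consider "v = a" | "v = b" | "v \<notin> e" using ab by auto
      then show "lookup (xdeg (q m) + xdeg (single e ?j)) v = lookup (xdeg (q m') +
          xdeg (single e ?j')) v"
      proof cases
        case 1 then show ?thesis using eq[of a] ends by (simp add: lookup_add le)
      next
        case 2 then show ?thesis using eq[of b] bal ends by (simp add: lookup_add le)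
      next
        case 3
        have "lookup (xdeg (q m)) v = lookup (xdeg (q m')) v"
          by (cases "v \<in> W1") (use 3 eq[of v] eq_r[of v] r0[of v] kr in auto)
        then show ?thesis using 3 by (simp add: lookup_add le)
      qed
    qed
    then show "\<exists>j j'. xdeg (restr (\<lambda>f. f \<in> E2) m) + xdeg (single e j)
        = xdeg (restr (\<lambda>f. f \<in> E2) m') + xdeg (single e j')"
      unfolding q_def by blast
  qed
qed

section \<open>Tensor products of complexes\<close>

text \<open>Bases are sets of natural numbers, and bases in different homological degrees may
  overlap. The code of a basis element of \<open>F\<^sub>p \<otimes> G\<^sub>q\<close> therefore
  records \<open>p\<close>.\<close>

definition enc :: "nat \<Rightarrow> nat \<Rightarrow> nat \<Rightarrow> nat" where
  "enc p b b' = prod_encode (p, prod_encode (b, b'))"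

definition pos :: "nat \<Rightarrow> nat" where "pos c = fst (prod_decode c)"
definition left :: "nat \<Rightarrow> nat" where "left c = fst (prod_decode (snd (prod_decode c)))"
definition right :: "nat \<Rightarrow> nat" where "right c = snd (prod_decode (snd (prod_decode c)))"

lemma pos_enc [simp]: "pos (enc p b b') = p"
  and left_enc [simp]: "left (enc p b b') = b"
  and right_enc [simp]: "right (enc p b b') = b'"
  by (simp_all add: pos_def left_def right_def enc_def)

lemma enc_pos_left_right [simp]: "enc (pos c) (left c) (right c) = c"
  by (simp add: pos_def left_def right_def enc_def)

lemma enc_pos_eq: "pos c = p \<Longrightarrow> enc p (left c) (right c) = c"
  by auto

lemma eq_enc_iff: "c = enc p b b' \<longleftrightarrow> pos c = p \<and> left c = b \<and> right c = b'"
  by (metis enc_pos_left_right left_enc pos_enc right_enc)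

text \<open>The simple tensor in the summand \<open>F\<^sub>p \<otimes> G\<^sub>q\<close>. The
  tensor product over \<open>K[e]\<close> of free modules over \<open>R\<^sub>1\<close> and
  \<open>R\<^sub>2\<close> is free over \<open>R\<close> on the pairs of basis elements, so
  coordinates over \<open>R\<close> suffice.\<close>

definition ten :: "nat \<Rightarrow> (nat \<Rightarrow>\<^sub>0 'r::comm_ring_1) \<Rightarrow> (nat \<Rightarrow>\<^sub>0 'r) \<Rightarrow> (nat \<Rightarrow>\<^sub>0 'r)" where
  "ten p v u = lin_ext (\<lambda>b. lin_ext (\<lambda>b'. single (enc p b b') 1) u) v"

lemma lookup_ten: "lookup (ten p v u) c = (if pos c = p then lookup v (left c) * lookup u (right c)
    else 0)"
proof -
  have "lookup (ten p v u) c = (\<Sum>b\<in>keys v. \<Sum>b'\<in>keys u.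
      if b = left c then if b' = right c then if pos c = p
        then lookup v b * lookup u b' else 0 else 0 else 0)"
    unfolding ten_def lookup_lin_ext sum_distrib_left
    by (intro sum.cong refl) (auto simp: lookup_single when_def)
  also have "\<dots> = (\<Sum>b\<in>keys v. if b = left c then \<Sum>b'\<in>keys u.
      if b' = right c then if pos c = p then lookup v b * lookup u b' else 0 else 0 else 0)"
    by (intro sum.cong refl) auto
  also have "\<dots> = (if pos c = p then lookup v (left c) * lookup u (right c) else 0)"
    by (simp only: sum.delta finite_keys) (simp add: in_keys_iff)
  finally show ?thesis .
qed

lemma ten_zero_left [simp]: "ten p 0 u = 0" and ten_zero_right [simp]: "ten p v 0 = 0"
  by (auto intro!: poly_mapping_eqI simp: lookup_ten)

lemma ten_lin_ext_left: "ten p (lin_ext f v) u = lin_ext (\<lambda>b. ten p (f b) u) v"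
  by (simp add: ten_def lin_ext_lin_ext)

lemma ten_lin_ext_right: "ten p v (lin_ext f u) = lin_ext (\<lambda>b. ten p v (f b)) u"
  by (rule poly_mapping_eqI)
     (auto simp: lookup_ten lookup_lin_ext sum_distrib_left mult.left_commute intro!: sum.cong)

lemma lin_ext_ten: "lin_ext g (ten p v u) = lin_ext (\<lambda>b. lin_ext (\<lambda>b'. g (enc p b b')) u) v"
  by (simp add: ten_def lin_ext_lin_ext)

lemma ten_free_mod:
  assumes "v \<in> free_mod S B" "u \<in> free_mod S B'" "\<And>b b'. b \<in> B \<Longrightarrow> b' \<in> B' \<Longrightarrow> enc p b b' \<in> C"
  shows "ten p v u \<in> free_mod S C"
proof -
  have "c \<in> C" if c: "c \<in> keys (ten p v u)" for c
  proof -
    have pc: "pos c = p" and "left c \<in> keys v" "right c \<in> keys u"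
      using c by (auto simp: in_keys_iff lookup_ten split: if_splits)
    then have "left c \<in> B" "right c \<in> B'" using assms(1,2) by (auto simp: free_mod_def)
    then have "enc p (left c) (right c) \<in> C" by (rule assms(3))
    then show ?thesis by (simp flip: pc)
  qed
  then show ?thesis using assms by (auto simp: free_mod_def lookup_ten intro: poly_ring_mult)
qed

lemma ten_homogeneous:
  assumes "homogeneous_vec dg k v" "homogeneous_vec dg' l u"
    and "\<And>b b'. dg'' (enc p b b') = dg b + dg' b'"
  shows "homogeneous_vec dg'' (k + l) (ten p v u)"
  unfolding homogeneous_vec_iff
proof (intro allI ballI)
  fix c m assume m: "m \<in> keys (lookup (ten p v u) c)"
  then have c: "pos c = p" "m \<in> keys (lookup v (left c) * lookup u (right c))"
    by (auto simp: lookup_ten split: if_splits)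
  then obtain m1 m2 where m: "m = m1 + m2" "m1 \<in> keys (lookup v (left c))" "m2 \<in>
      keys (lookup u (right c))"
    using keys_mult by blast
  then have "dg (left c) + monom_degree m1 = k" "dg' (right c) + monom_degree m2 = l"
    using assms unfolding homogeneous_vec_iff by blast+
  moreover have "dg'' c = dg (left c) + dg' (right c)"
    using assms(3)[of "left c" "right c"] c(1) by (metis enc_pos_left_right)
  ultimately show "dg'' c + monom_degree m = k + l" by (simp add: m(1) monom_degree_add)
qed

lemma homogeneous_mult: "homogeneous k p \<Longrightarrow> homogeneous l q \<Longrightarrow> homogeneous (k + l) (p * q)"
proof -
  assume pq: "homogeneous k p" "homogeneous l q"
  have "monom_degree m = k + l" if m: "m \<in> keys (p * q)" for m
  proof -
    obtain a b where "m = a + b" "a \<in> keys p" "b \<in> keys q" using m keys_mult[of p q] by blast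
    then show ?thesis using pq by (auto simp: homogeneous_def monom_degree_add)
  qed
  then show ?thesis by (simp add: homogeneous_def)
qed

text \<open>
  Indexing boundary maps by their source, with value \<open>0\<close> in degree \<open>0\<close>, avoids case distinctions
  at the ends of the complexes.
\<close>

definition del :: "('x, 'k::comm_ring_1) free_complex \<Rightarrow> nat \<Rightarrow> nat \<Rightarrow> (nat \<Rightarrow>\<^sub>0 ('x, 'k) polynomial)"
    where
  "del F p = (case p of 0 \<Rightarrow> \<lambda>_. 0 | Suc p' \<Rightarrow> bdry F p')"

lemma del_0 [simp]: "del F 0 = (\<lambda>_. 0)" and del_Suc [simp]: "del F (Suc p) = bdry F p"
  by (simp_all add: del_def)

text \<open>The source lies in total degree \<open>Suc i\<close>, whence the position
  \<open>Suc i - pos c\<close> in \<open>G\<close>. For \<open>pos c = 0\<close> the truncated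
  \<open>pos c - 1\<close> is harmless since \<open>del F 0\<close> is zero.\<close>

definition total_bdry ::
    "('x, 'k::comm_ring_1) free_complex \<Rightarrow> ('x, 'k) free_complex \<Rightarrow> nat \<Rightarrow> nat \<Rightarrow> (nat \<Rightarrow>\<^sub>0 ('x, 'k)
        polynomial)" where
  "total_bdry F G i c =
     ten (pos c - 1) (del F (pos c) (left c)) (single (right c) 1) +
     vec_scale ((-1) ^ pos c) (ten (pos c) (single (left c) 1) (del G (Suc i - pos c) (right c)))"

definition total_gens :: "('x, 'k::comm_ring_1) free_complex \<Rightarrow> ('x, 'k) free_complex \<Rightarrow> nat \<Rightarrow>
    nat set" where
  "total_gens F G i = {c. pos c \<le> i \<and> left c \<in> gens F (pos c) \<and> right c \<in> gens G (i - pos c)}"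

definition total :: "('x, 'k::comm_ring_1) free_complex \<Rightarrow> ('x, 'k) free_complex \<Rightarrow> ('x, 'k)
    free_complex" where
  "total F G = \<lparr>gens = total_gens F G,
     gdeg = (\<lambda>i c. gdeg F (pos c) (left c) + gdeg G (i - pos c) (right c)),
     bdry = total_bdry F G, aug = (\<lambda>c. aug F (left c) * aug G (right c))\<rparr>"

lemma total_sel:
  "gens (total F G) = total_gens F G"
  "gdeg (total F G) i c = gdeg F (pos c) (left c) + gdeg G (i - pos c) (right c)"
  "bdry (total F G) = total_bdry F G"
  "aug (total F G) = (\<lambda>c. aug F (left c) * aug G (right c))"
  by (simp_all add: total_def)

lemma total_bdry_ten:
  "lin_ext (total_bdry F G i) (ten p v u) =
     ten (p - 1) (lin_ext (del F p) v) u + vec_scale ((-1) ^ p)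
         (ten p v (lin_ext (del G (Suc i - p)) u))"
proof -
  have "lin_ext (total_bdry F G i) (ten p v u) =
      lin_ext (\<lambda>b. lin_ext (\<lambda>b'. ten (p - 1) (del F p b) (single b' 1)) u) v +
      vec_scale ((-1) ^ p) (lin_ext (\<lambda>b. lin_ext (\<lambda>b'. ten p (single b 1) (del G (Suc i - p) b')) u)
          v)"
    by (simp add: lin_ext_ten total_bdry_def lin_ext_fun_add lin_ext_fun_scale)
  also have "\<dots> = ten (p - 1) (lin_ext (del F p) v) u + vec_scale ((-1) ^ p)
      (ten p v (lin_ext (del G (Suc i - p)) u))"
    by (simp flip: ten_lin_ext_right ten_lin_ext_left)
  finally show ?thesis .
qed

lemma aug_map_ten:
  "aug_map (aug (total F G)) (ten p v u) = aug_map (aug F) v * aug_map (aug G) u"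
proof -
  have "aug_map (aug (total F G)) (ten p v u) = aug_map (\<lambda>b. aug_map (\<lambda>b'. aug F b * aug G b') u) v"
    by (simp add: ten_def aug_map_lin_ext total_sel)
  also have "\<dots> = aug_map (\<lambda>b. aug F b * aug_map (aug G) u) v"
    by (simp add: aug_map_def sum_distrib_left mult.left_commute)
  also have "\<dots> = aug_map (aug F) v * aug_map (aug G) u"
    by (simp add: aug_map_def[of _ v] sum_distrib_right mult.assoc)
  finally show ?thesis .
qed

text \<open>Constant coefficients are multiplicative, and each tensor in the total boundary has as
  one factor a boundary value without constant coefficients.\<close>

lemma minimal_total:
  assumes "minimal F" "minimal G"
  shows "minimal (total F G)"
  unfolding minimal_def total_sel
proof (intro allI ballI)
  fix i c assume c: "c \<in> total_gens F G (Suc i)"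
  have F: "lookup (lookup (del F (pos c) (left c)) b) 0 = 0" for b
  proof (cases "pos c")
    case (Suc p)
    then have "const_vec (bdry F p (left c)) = 0" using assms c by (auto simp: minimal_def
        total_gens_def)
    then show ?thesis using Suc by (metis del_Suc lookup_const_vec lookup_zero)
  qed simp
  have G: "lookup (lookup (del G (Suc i - pos c) (right c)) b) 0 = 0" for b
  proof (cases "Suc i - pos c")
    case (Suc p)
    then have "const_vec (bdry G p (right c)) = 0" using assms c by (auto simp: minimal_def
        total_gens_def)
    then show ?thesis using Suc by (metis del_Suc lookup_const_vec lookup_zero)
  qed simp
  show "const_vec (total_bdry F G i c) = 0"
    by (rule poly_mapping_eqI) (simp add: total_bdry_def lookup_ten lookup_add lookup_mult_0 F G)
qed

text \<open>A basis element in total degree \<open>i\<close> is a position with a basis element of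
  either factor, and degrees add; the sums run over the ways to distribute \<open>i\<close> and
  \<open>j\<close>.\<close>

lemma card_total_gens:
  assumes "\<And>i d. finite {b \<in> gens F i. gdeg F i b = d}" "\<And>i d. finite {b \<in> gens G i. gdeg G i b =
      d}"
  shows "finite {c \<in> gens (total F G) i. gdeg (total F G) i c = j}"
    and "card {c \<in> gens (total F G) i. gdeg (total F G) i c = j} =
      (\<Sum>(i1, i2)\<in>{(a, b). a + b = i}. \<Sum>(j1, j2)\<in>{(a, b). a + b = j}.
         card {b \<in> gens F i1. gdeg F i1 b = j1} * card {b \<in> gens G i2. gdeg G i2 b = j2})"
proof -
  have fin: "finite {(a, b). a + b = (n :: nat)}" for n
    by (rule finite_subset[of _ "{..n} \<times> {..n}"]) auto
  let ?X = "SIGMA x:{(a, b). a + b = i}. SIGMA y:{(a, b). a + b = j}.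
    {b \<in> gens F (fst x). gdeg F (fst x) b = fst y} \<times> {b \<in> gens G (snd x). gdeg G (snd x) b = snd y}"
  let ?f = "\<lambda>(x, y, b, b'). enc (fst x) b b'"
  have eq: "{c \<in> gens (total F G) i. gdeg (total F G) i c = j} = ?f ` ?X"
  proof safe
    fix c assume c: "c \<in> gens (total F G) i" "j = gdeg (total F G) i c"
    show "c \<in> ?f ` (SIGMA x:{(a, b). a + b = i}. SIGMA y:{(a, b). a + b = gdeg (total F G) i c}.
        {b \<in> gens F (fst x). gdeg F (fst x) b = fst y} \<times> {b \<in> gens G (snd x). gdeg G (snd x) b =
            snd y})"
      by (rule image_eqI[where x = "((pos c, i - pos c), (gdeg F (pos c) (left c),
          gdeg G (i - pos c) (right c)), left c, right c)"])
         (use c in \<open>auto simp: total_sel total_gens_def\<close>)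
  qed (auto simp: total_sel total_gens_def)
  have inj: "inj_on ?f ?X"
    by (rule inj_onI) (auto dest!: arg_cong[of "enc _ _ _" _ "\<lambda>c. (pos c, left c, right c)"])
  show "finite {c \<in> gens (total F G) i. gdeg (total F G) i c = j}"
    unfolding eq by (intro finite_imageI finite_SigmaI fin finite_cartesian_product assms)
  have "card {c \<in> gens (total F G) i. gdeg (total F G) i c = j} = card ?X"
    unfolding eq by (rule card_image[OF inj])
  also have "\<dots> = (\<Sum>x\<in>{(a, b). a + b = i}. \<Sum>y\<in>{(a, b). a + b = j}.
      card {b \<in> gens F (fst x). gdeg F (fst x) b = fst y} * card {b \<in> gens G (snd x). gdeg G (snd x)
          b = snd y})"
    using fin assms by (simp add: card_SigmaI card_cartesian_product)
  finally show "card {c \<in> gens (total F G) i. gdeg (total F G) i c = j} =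
      (\<Sum>(i1, i2)\<in>{(a, b). a + b = i}. \<Sum>(j1, j2)\<in>{(a, b). a + b = j}.
         card {b \<in> gens F i1. gdeg F i1 b = j1} * card {b \<in> gens G i2. gdeg G i2 b = j2})"
    by (simp add: case_prod_beta)
qed

lemma toric_ideal_mono: "E \<subseteq> E' \<Longrightarrow> toric_ideal E \<subseteq> toric_ideal E'"
  using poly_ring_mono[of E E'] by (auto simp: toric_ideal_def)

lemma (in resolution) del_del:
  assumes "b \<in> gens F p"
  shows "lin_ext (del F (p - 1)) (del F p b) = 0"
proof (cases p)
  case (Suc q)
  then show ?thesis using assms bdry_bdry by (cases q) auto
qed simp

lemma (in resolution) del_free_mod: "b \<in> gens F p \<Longrightarrow> del F p b \<in> free_mod S (gens F (p - 1))"
  using bdry_free_mod by (cases p) auto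

lemma (in resolution) del_homogeneous: "b \<in> gens F p \<Longrightarrow> homogeneous_vec (gdeg F (p - 1)) (gdeg F p b)
    (del F p b)"
  using bdry_homogeneous by (cases p) auto

section \<open>The tensor product of two resolutions\<close>

locale glued_resolutions = edge_glueing E1 E2 e +
  F: resolution E1 "toric_ideal E1" F + G: resolution E2 "toric_ideal E2" G
  for E1 E2 :: "'v set set" and e and F G :: "('v set, 'k::comm_ring_1) free_complex"
begin

abbreviation "T \<equiv> total F G"
abbreviation "I \<equiv> toric_ideal (E1 \<union> E2) :: ('v set, 'k) polynomial set"
abbreviation "S \<equiv> E1 \<union> E2"

lemma I: "graded_ideal S I"
  by (rule graded_ideal_toric_ideal) (rule card2)

lemma sub_free_mod: "v \<in> free_mod E1 B \<Longrightarrow> v \<in> free_mod S B" "v \<in> free_mod E2 B \<Longrightarrow> v \<in> free_mod S B"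
  using free_mod_mono[of E1 S B B] free_mod_mono[of E2 S B B] by auto

section \<open>The total complex as a graded complex over \<open>R/I\<close>\<close>

lemma total_bdry_free_mod:
  assumes "c \<in> total_gens F G (Suc i)"
  shows "total_bdry F G i c \<in> free_mod S (total_gens F G i)"
proof -
  have c: "pos c \<le> Suc i" "left c \<in> gens F (pos c)" "right c \<in> gens G (Suc i - pos c)"
    using assms by (auto simp: total_gens_def)
  have 1: "ten (pos c - 1) (del F (pos c) (left c)) (single (right c) 1) \<in>
      free_mod S (total_gens F G i)"
  proof (cases "pos c")
    case 0
    then show ?thesis by simp
  next
    case (Suc p)
    show ?thesis
      by (rule ten_free_mod[OF sub_free_mod(1)[OF F.del_free_mod[OF c(2)]] free_mod_single[OF c(3)
          poly_ring_1]])
         (use Suc c in \<open>auto simp: total_gens_def\<close>)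
  qed
  have 2: "ten (pos c) (single (left c) 1) (del G (Suc i - pos c) (right c)) \<in>
      free_mod S (total_gens F G i)"
  proof (cases "Suc i - pos c")
    case 0
    then show ?thesis by simp
  next
    case (Suc q)
    then have "pos c \<le> i" "Suc i - pos c - 1 = i - pos c" by auto
    then show ?thesis
      by (intro ten_free_mod[OF free_mod_single[OF c(2)
          poly_ring_1] sub_free_mod(2)[OF G.del_free_mod[OF c(3)]]])
         (auto simp: total_gens_def)
  qed
  have "(-1) ^ pos c \<in> (poly_ring S :: ('v set, 'k) polynomial set)"
    by (cases "even (pos c)") (auto intro: poly_ring_uminus)
  then show ?thesis
    using 1 2 submodule_free_mod[of S "total_gens F G i"] unfolding total_bdry_def submodule_def by
        blast
qed

lemma total_bdry_homogeneous:
  assumes "c \<in> total_gens F G (Suc i)"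
  shows "homogeneous_vec (gdeg T i) (gdeg T (Suc i) c) (total_bdry F G i c)"
proof -
  have c: "pos c \<le> Suc i" "left c \<in> gens F (pos c)" "right c \<in> gens G (Suc i - pos c)"
    using assms by (auto simp: total_gens_def)
  have h1: "homogeneous_vec dg (dg b) (single b 1 :: nat \<Rightarrow>\<^sub>0 ('v set, 'k) polynomial)"
      for dg and b :: nat
    by (rule homogeneous_vec_single[where k = 0]) (auto simp: homogeneous_def)
  have 1: "homogeneous_vec (gdeg T i) (gdeg T (Suc i) c) (ten (pos c - 1) (del F (pos c) (left c))
      (single (right c) 1))"
  proof (cases "pos c")
    case (Suc p)
    show ?thesis unfolding total_sel(2)[of F G "Suc i" c]
      by (rule ten_homogeneous[OF F.del_homogeneous[OF c(2)] h1])
         (use Suc in \<open>simp add: total_sel\<close>)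
  qed simp
  have 2: "homogeneous_vec (gdeg T i) (gdeg T (Suc i) c) (ten (pos c) (single (left c) 1)
      (del G (Suc i - pos c) (right c)))"
  proof (cases "Suc i - pos c")
    case (Suc q)
    then have q: "i - pos c = Suc i - pos c - 1" by simp
    show ?thesis unfolding total_sel(2)[of F G "Suc i" c]
      by (rule ten_homogeneous[OF h1 G.del_homogeneous[OF c(3)]])
          (simp only: total_sel q pos_enc left_enc right_enc)
  qed simp
  have "homogeneous 0 ((-1) ^ pos c :: ('v set, 'k) polynomial)"
    by (cases "even (pos c)") (auto simp: homogeneous_def)
  from homogeneous_vec_scale[OF this 2] 1 show ?thesis
    unfolding total_bdry_def by (simp add: homogeneous_vec_add)
qed

lemma total_bdry_total_bdry:
  assumes "c \<in> total_gens F G (Suc (Suc i))"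
  shows "lin_ext (total_bdry F G i) (total_bdry F G (Suc i) c) = 0"
proof -
  let ?p = "pos c" and ?q = "Suc (Suc i) - pos c"
  have c: "?p \<le> Suc (Suc i)" "left c \<in> gens F ?p" "right c \<in> gens G ?q"
    using assms by (auto simp: total_gens_def)
  have "Suc i - ?p = ?q - 1" by simp
  then have GG: "lin_ext (del G (Suc i - ?p)) (del G ?q (right c)) = 0"
      using G.del_del[OF c(3)] by metis
  let ?X = "ten (?p - 1) (del F ?p (left c)) (del G ?q (right c))"
  \<comment> \<open>Terms with two boundaries of the same factor vanish. The two mixed terms have
    opposite signs, and for \<open>?p = 0\<close> both are zero.\<close>
  have "lin_ext (total_bdry F G i) (total_bdry F G (Suc i) c)
      = vec_scale ((-1) ^ (?p - 1)) (ten (?p - 1) (del F ?p (left c)) (del G (Suc i - (?p - 1))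
          (right c))) + vec_scale ((-1) ^ ?p) ?X"
    unfolding total_bdry_def[of F G "Suc i"] lin_ext_add lin_ext_scale total_bdry_ten
    by (simp add: F.del_del[OF c(2)] GG del: One_nat_def)
  also have "\<dots> = 0"
  proof (cases ?p)
    case (Suc p)
    then have "Suc i - (?p - 1) = ?q" by simp
    then show ?thesis using Suc by (simp flip: vec.scale_left_distrib)
  qed simp
  finally show ?thesis .
qed

lemma aug_total_bdry:
  assumes "c \<in> total_gens F G (Suc 0)"
  shows "aug_map (aug T) (total_bdry F G 0 c) \<in> I"
proof -
  have c: "pos c \<le> 1" "left c \<in> gens F (pos c)" "right c \<in> gens G (1 - pos c)"
    using assms by (auto simp: total_gens_def)
  have mono: "toric_ideal E1 \<subseteq> I" "toric_ideal E2 \<subseteq> I" by (auto intro!: toric_ideal_mono)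
  have ideal: "r * p \<in> I" if "r \<in> poly_ring S" "p \<in> I" for r p
    using I that by (simp add: graded_ideal_def)
  consider "pos c = 0" | "pos c = 1" using c by linarith
  then show ?thesis
  proof cases
    case 1
    have "aug_map (aug G) (bdry G 0 (right c)) \<in> I"
      using G.bdry_syz[of "right c" 0] 1 c mono by (auto simp: syz_0)
    moreover have "aug F (left c) \<in> poly_ring S"
      using F.aug_poly_ring[of "left c"] 1 c poly_ring_mono[of E1 S] by auto
    ultimately show ?thesis by (simp add: total_bdry_def 1 aug_map_ten ideal)
  next
    case 2
    have "aug_map (aug F) (bdry F 0 (left c)) \<in> I"
      using F.bdry_syz[of "left c" 0] 2 c mono by (auto simp: syz_0)
    moreover have "aug G (right c) \<in> poly_ring S"
      using G.aug_poly_ring[of "right c"] 2 c poly_ring_mono[of E2 S] by auto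
    ultimately show ?thesis by (simp add: total_bdry_def 2 aug_map_ten mult.commute ideal)
  qed
qed

lemma total_bdry_syz:
  assumes w: "w \<in> free_mod S (total_gens F G (Suc i))"
  shows "lin_ext (total_bdry F G i) w \<in> syz S I T i"
proof (rule submodule_lin_ext[OF submodule_syz[OF I]])
  fix c assume "c \<in> keys w"
  then have c: "c \<in> total_gens F G (Suc i)" using w by (auto simp: free_mod_def)
  show "total_bdry F G i c \<in> syz S I T i"
    using total_bdry_free_mod[OF c] total_bdry_total_bdry aug_total_bdry c
    by (cases i) (auto simp: syz_0 syz_Suc total_sel)
qed (use w in \<open>simp add: free_mod_def\<close>)

text \<open>The coefficient of the basis element \<open>b\<close> of \<open>F\<^sub>p\<close> in
  \<open>z\<close>, as a vector over a basis of \<open>G\<close>.\<close>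

definition slice :: "nat \<Rightarrow> nat \<Rightarrow> (nat \<Rightarrow>\<^sub>0 ('v set, 'k) polynomial) \<Rightarrow> (nat \<Rightarrow>\<^sub>0 ('v set, 'k)
    polynomial)" where
  "slice p b = lin_ext (\<lambda>c. if pos c = p \<and> left c = b then single (right c) 1 else 0)"

lemma lookup_slice: "lookup (slice p b z) b' = lookup z (enc p b b')"
proof -
  have "lookup (slice p b z) b' = (\<Sum>c\<in>keys z. if c = enc p b b' then lookup z c else 0)"
    unfolding slice_def lookup_lin_ext
    by (intro sum.cong refl) (auto simp: lookup_single when_def eq_enc_iff)
  also have "\<dots> = lookup z (enc p b b')" by (simp add: in_keys_iff)
  finally show ?thesis .
qed

lemma slice_free_mod:
  assumes "z \<in> free_mod S (total_gens F G i)"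
  shows "slice p b z \<in> free_mod S (gens G (i - p))"
proof -
  have "b' \<in> gens G (i - p)" if "b' \<in> keys (slice p b z)" for b'
  proof -
    have "enc p b b' \<in> keys z" using that by (simp add: in_keys_iff lookup_slice)
    then show ?thesis using assms by (auto simp: free_mod_def total_gens_def)
  qed
  then show ?thesis using assms by (auto simp: free_mod_def lookup_slice)
qed

text \<open>
  If \<open>z\<close> has no components beyond \<open>p\<close>, its component in \<open>F\<^sub>p \<otimes> G\<^sub>i\<^sub>-\<^sub>p\<close> is mapped by the
  boundary of \<open>G\<close> only.
\<close>

lemma slice_total_bdry:
  assumes z: "\<And>c. c \<in> keys z \<Longrightarrow> pos c \<le> p"
  shows "slice p b (lin_ext (total_bdry F G i) z) = vec_scale ((-1) ^ p)
      (lin_ext (del G (Suc i - p)) (slice p b z))"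
proof -
  have "slice p b (lin_ext (total_bdry F G i) z) = lin_ext (\<lambda>c. slice p b (total_bdry F G i c)) z"
    by (simp add: slice_def lin_ext_lin_ext)
  also have "\<dots> = lin_ext (\<lambda>c. vec_scale ((-1) ^ p) (lin_ext (del G (Suc i - p))
      (if pos c = p \<and> left c = b then single (right c) 1 else 0))) z"
  proof (rule lin_ext_cong, rule poly_mapping_eqI)
    fix c b' assume "c \<in> keys z"
    then have "pos c \<le> p" by (rule z)
    then have "pos c = 0 \<or> pos c - 1 \<noteq> p" by auto
    then have "lookup (ten (pos c - 1) (del F (pos c) (left c)) (single (right c) 1)) (enc p b b') =
        0"
      by (auto simp: lookup_ten)
    then show "lookup (slice p b (total_bdry F G i c)) b' = lookup (vec_scale ((-1) ^ p)
        (lin_ext (del G (Suc i - p))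
      (if pos c = p \<and> left c = b then single (right c) 1 else 0))) b'"
      by (auto simp: lookup_slice total_bdry_def lookup_add lookup_ten lookup_single when_def)
  qed
  also have "\<dots> = vec_scale ((-1) ^ p) (lin_ext (del G (Suc i - p)) (slice p b z))"
    by (simp add: slice_def lin_ext_lin_ext lin_ext_fun_scale)
  finally show ?thesis .
qed

text \<open>\<open>part1\<close> and \<open>part2\<close> together determine a monomial, so no two
  monomials are identified.\<close>

lemma D2_J: "p \<in> D2.J \<Longrightarrow> p = 0"
proof -
  assume "p \<in> D2.J"
  then have "push (\<lambda>m. (part2 m, part1 m)) p = 0" by (simp add: D2.J_def D2.coef_eq_0_iff)
  then have "push (\<lambda>m. m) p = 0" by (rule push_eq_0_factor) (metis Pair_inject part_sum)
  then show "p = 0" by (simp add: push_def flip: poly_mapping_expand)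
qed

section \<open>Exactness of the second resolution after extension to \<open>R\<close>, and of the
  total complex\<close>

lemma toric_ideal_E2_D1_J: "toric_ideal E2 \<subseteq> D1.J"
proof
  fix p :: "('v set, 'a) polynomial" assume p: "p \<in> toric_ideal E2"
  then have k: "\<And>m. m \<in> keys p \<Longrightarrow> keys m \<subseteq> E2" by (auto simp: toric_ideal_def poly_ring_def)
  have "push (\<lambda>m. (xdeg (part2 m), part1 m)) p = 0"
    by (rule push_eq_0_factor[of xdeg]) (use p k part_E2 in \<open>auto simp: toric_ideal_eq\<close>)
  moreover have "p \<in> poly_ring (E1 \<union> E2)"
    using p poly_ring_mono[of E2 "E1 \<union> E2"] by (auto simp: toric_ideal_def)
  ultimately show "p \<in> D1.J"
    unfolding D1_J_iff toric_ideal_eq using D2.push_coef_eq_0_iff[of xdeg p] D2.coef_poly_ring by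
        blast
qed

text \<open>\<open>R\<close> is free over \<open>K[E2]\<close>, and as \<open>D2.J\<close> is zero,
  preimages modulo \<open>D2.Jvec\<close> are actual preimages. The complex resolves the quotient by
  \<open>D1.J\<close>, which explains the condition in degree \<open>0\<close>.\<close>

lemma extended_exactness_G:
  assumes u: "u \<in> free_mod S (gens G q)" "q = 0 \<Longrightarrow> aug_map (aug G) u \<in> D1.J"
    "\<And>q'. q = Suc q' \<Longrightarrow> lin_ext (bdry G q') u = 0"
  shows "\<exists>w\<in>free_mod S (gens G (Suc q)). lin_ext (bdry G q) w = u"
proof -
  have "D2.coef_vec n u \<in> syz E2 (toric_ideal E2) G q" for n
  proof (cases q)
    case 0
    then show ?thesis using u D2.coef_vec_syz_0[OF G.resolution_axioms] by (auto simp: D1_J_iff)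
  next
    case (Suc q')
    have "(0 :: nat \<Rightarrow>\<^sub>0 ('v set, 'k) polynomial) \<in> D2.Jvec" by (simp add: D2.Jvec_def D2.J_ideal)
    then show ?thesis using u(1,3) D2.coef_vec_syz_Suc[OF G.resolution_axioms] Suc by auto
  qed
  from D2.extended_exactness[OF G.resolution_axioms u(1) this]
  obtain w where w: "w \<in> free_mod S (gens G (Suc q))" "u - lin_ext (bdry G q) w \<in> D2.Jvec" by blast
  have "lin_ext (bdry G q) w = u"
  proof (rule poly_mapping_eqI)
    fix b
    have "lookup (u - lin_ext (bdry G q) w) b = 0" using w(2) D2_J by (auto simp: D2.Jvec_def)
    then show "lookup (lin_ext (bdry G q) w) b = lookup u b" by (simp add: lookup_minus)
  qed
  with w show ?thesis by blast
qed

text \<open>The highest position in \<open>z\<close> is removed by subtracting a boundary: its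
  slices are cycles of the extended \<open>G\<close>, as no higher position contributes, so they
  lift. In position \<open>i\<close> the slices lie in \<open>G\<^sub>0\<close>, where lifting
  requires an augmentation in \<open>D1.J\<close>; hence the condition for
  \<open>P = Suc i\<close>.\<close>

lemma syz_reduction:
  assumes "z \<in> syz S I T i" "\<And>c. c \<in> keys z \<Longrightarrow> pos c < P" "P \<le> Suc i"
    and "P = Suc i \<Longrightarrow> \<forall>b. aug_map (aug G) (slice i b z) \<in> D1.J"
  shows "\<exists>w\<in>free_mod S (total_gens F G (Suc i)). lin_ext (total_bdry F G i) w = z"
  using assms
proof (induction P arbitrary: z)
  case 0
  then have "keys z = {}" by blast
  then have "z = 0" by simp
  then show ?case by (intro bexI[of _ 0]) auto
next
  case (Suc p)
  have z: "z \<in> free_mod S (total_gens F G i)" using syz_free_mod[OF Suc.prems(1)] by (simp add: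
      total_sel)
  have below: "pos c \<le> p" if "c \<in> keys z" for c using Suc.prems(2)[OF that] by simp
  have "\<forall>b. \<exists>u. u \<in> free_mod S (gens G (Suc (i - p))) \<and> lin_ext (bdry G (i - p)) u = slice p b z"
  proof
    fix b
    have "\<exists>w\<in>free_mod S (gens G (Suc (i - p))). lin_ext (bdry G (i - p)) w = slice p b z"
    proof (rule extended_exactness_G[OF slice_free_mod[OF z]])
      assume "i - p = 0"
      then have "p = i" using Suc.prems(3) by simp
      then show "aug_map (aug G) (slice p b z) \<in> D1.J" using Suc.prems(4) by simp
    next
      fix q' assume q': "i - p = Suc q'"
      then obtain i' where i': "i = Suc i'" by (cases i) auto
      have "lin_ext (total_bdry F G i') z = 0" using Suc.prems(1)
          i' by (simp add: syz_Suc total_sel)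
      then have "vec_scale ((-1) ^ p) (lin_ext (bdry G q') (slice p b z)) = 0"
        using slice_total_bdry[of z p b i', OF below] q' i' by (simp add: slice_def)
      then have "vec_scale ((-1) ^ p) (vec_scale ((-1) ^ p) (lin_ext (bdry G q') (slice p b z))) =
          0" by simp
      then show "lin_ext (bdry G q') (slice p b z) = 0"
        by (simp flip: power_add mult_2)
    qed
    then show "\<exists>u. u \<in> free_mod S (gens G (Suc (i - p))) \<and> lin_ext (bdry G (i - p)) u = slice p b z"
        by blast
  qed
  from choice[OF this] obtain u where
    u: "\<forall>b. u b \<in> free_mod S (gens G (Suc (i - p))) \<and> lin_ext (bdry G (i - p)) (u b) = slice p b z"
        ..
  define L where "L = left ` {c \<in> keys z. pos c = p}"
  have L: "finite L" "L \<subseteq> gens F p" using z by (auto simp: L_def free_mod_def total_gens_def)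
  have pi: "p \<le> i" "Suc i - p = Suc (i - p)" using Suc.prems(3) by auto
  \<comment> \<open>The sign cancels the one in the total boundary, so the \<open>G\<close>-part of
    the boundary of \<open>w\<close> reproduces the component of \<open>z\<close> in position
    \<open>p\<close>; the \<open>F\<close>-part lies in position \<open>p - 1\<close>.\<close>
  define w where "w = (\<Sum>b\<in>L. vec_scale ((-1) ^ p) (ten p (single b 1) (u b)))"
  have sgn: "(-1) ^ p \<in> (poly_ring S :: ('v set, 'k) polynomial set)"
    by (cases "even p") (auto intro: poly_ring_uminus)
  have w: "w \<in> free_mod S (total_gens F G (Suc i))"
    unfolding w_def
  proof (rule submodule_sum[OF submodule_free_mod])
    fix b assume "b \<in> L"
    then have "ten p (single b 1) (u b) \<in> free_mod S (total_gens F G (Suc i))"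
      by (intro ten_free_mod[of _ S "gens F p" _ "gens G (Suc (i - p))"] free_mod_single)
         (use u L pi in \<open>auto simp: total_gens_def\<close>)
    then show "vec_scale ((-1) ^ p) (ten p (single b 1) (u b)) \<in>
        free_mod S (total_gens F G (Suc i))"
      using sgn submodule_free_mod unfolding submodule_def by blast
  qed
  have Dw: "lin_ext (total_bdry F G i) w
      = (\<Sum>b\<in>L. vec_scale ((-1) ^ p) (ten (p - 1) (del F p b) (u b)) + ten p (single b 1)
          (slice p b z))"
    unfolding w_def lin_ext_sum lin_ext_scale total_bdry_ten
    by (intro sum.cong refl) (use u pi in \<open>simp add: vec.scale_right_distrib flip: power_add
        mult_2\<close>)
  have Dw_lookup: "lookup (lin_ext (total_bdry F G i) w) c = (if pos c = p then lookup z c else 0)"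
      if "p \<le> pos c" for c
  proof -
    have "p = 0 \<or> p - 1 \<noteq> pos c" using that by auto
    then have "lookup (lin_ext (total_bdry F G i) w) c
        = (\<Sum>b\<in>L. if b = left c then if pos c = p then lookup z c else 0 else 0)"
      unfolding Dw lookup_sum
      by (intro sum.cong refl) (auto simp: lookup_add lookup_ten lookup_single when_def lookup_slice
          enc_pos_eq)
    also have "\<dots> = (if left c \<in> L then if pos c = p then lookup z c else 0 else 0)"
      by (rule sum.delta[OF L(1)])
    also have "\<dots> = (if pos c = p then lookup z c else 0)"
      by (auto simp: L_def in_keys_iff)
    finally show ?thesis .
  qed
  let ?z = "z - lin_ext (total_bdry F G i) w"
  have "\<exists>w'\<in>free_mod S (total_gens F G (Suc i)). lin_ext (total_bdry F G i) w' = ?z"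
  proof (rule Suc.IH)
    show "?z \<in> syz S I T i"
      by (rule submodule_diff[OF submodule_syz[OF I] Suc.prems(1) total_bdry_syz[OF w]])
    show "pos c < p" if "c \<in> keys ?z" for c
    proof (rule ccontr)
      assume "\<not> pos c < p"
      then have pc: "p \<le> pos c" by simp
      have "lookup ?z c = 0"
      proof (cases "pos c = p")
        case False
        then have "c \<notin> keys z" using below[of c] pc by auto
        then show ?thesis using Dw_lookup[OF pc] False by (simp add: lookup_minus in_keys_iff)
      qed (use Dw_lookup[OF pc] in \<open>simp add: lookup_minus\<close>)
      then show False using that by (simp add: in_keys_iff)
    qed
  qed (use pi in auto)
  then obtain w' where w': "w' \<in> free_mod S (total_gens F G (Suc i))" "lin_ext (total_bdry F G i)
      w' = ?z" by blast
  have "w' + w \<in> free_mod S (total_gens F G (Suc i))"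
    using w w'(1) submodule_free_mod unfolding submodule_def by blast
  moreover have "lin_ext (total_bdry F G i) (w' + w) = z" by (simp add: lin_ext_add w'(2))
  ultimately show ?case by blast
qed

text \<open>
  The map \<open>F\<^sub>i \<otimes> G\<^sub>0 \<rightarrow> F\<^sub>i\<close> induced by the augmentation of \<open>G\<close>; modulo \<open>D1.J\<close> it is a chain map.
\<close>

definition edge_map :: "nat \<Rightarrow> (nat \<Rightarrow>\<^sub>0 ('v set, 'k) polynomial) \<Rightarrow> (nat \<Rightarrow>\<^sub>0 ('v set, 'k) polynomial)"
    where
  "edge_map i = lin_ext (\<lambda>c. if pos c = i then single (left c) (aug G (right c)) else 0)"

lemma lookup_edge_map: "lookup (edge_map i z) b = aug_map (aug G) (slice i b z)"
proof -
  have "lookup (edge_map i z) b = (\<Sum>c\<in>keys z. lookup z c * (if pos c = i \<and> left c =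
      b then aug G (right c) else 0))"
    unfolding edge_map_def lookup_lin_ext
    by (intro sum.cong refl) (auto simp: lookup_single when_def)
  also have "\<dots> = (\<Sum>c\<in>keys z. lookup z c * aug_map (aug G) (if pos c = i \<and> left c =
      b then single (right c) 1 else 0))"
    by (intro sum.cong refl) auto
  also have "\<dots> = aug_map (aug G) (slice i b z)"
    by (simp add: slice_def aug_map_lin_ext) (simp add: aug_map_def)
  finally show ?thesis .
qed

lemma edge_map_ten: "edge_map i (ten p v u) = (if p = i then vec_scale (aug_map (aug G) u)
    v else 0)"
proof (rule poly_mapping_eqI)
  fix b
  have "lookup (edge_map i (ten p v u)) b = (if p = i then aug_map (aug G) (vec_scale (lookup v b)
      u) else 0)"
  proof -
    have "slice i b (ten p v u) = (if p = i then vec_scale (lookup v b) u else 0)"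
      by (rule poly_mapping_eqI) (auto simp: lookup_slice lookup_ten)
    then show ?thesis by (simp add: lookup_edge_map)
  qed
  then show "lookup (edge_map i (ten p v u)) b = lookup (if p = i then vec_scale (aug_map (aug G) u)
      v else 0) b"
    by (simp add: aug_map_scale mult.commute)
qed

lemma edge_map_free_mod:
  assumes "z \<in> free_mod S (total_gens F G i)"
  shows "edge_map i z \<in> free_mod S (gens F i)"
  unfolding edge_map_def
proof (rule lin_ext_free_mod[OF assms])
  fix c assume "c \<in> total_gens F G i"
  then show "(if pos c = i then single (left c) (aug G (right c)) else 0) \<in> free_mod S (gens F i)"
    using G.aug_poly_ring poly_ring_mono[of E2 S] by (auto simp: total_gens_def intro!:
        free_mod_single)
qed

text \<open>In position \<open>Suc i\<close> the two composites agree. In position \<open>i\<close>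
  only the boundary \<open>G\<^sub>1 \<rightarrow> G\<^sub>0\<close> is left, whose augmentation
  lies in \<open>I\<^sub>2\<close> and so in \<open>D1.J\<close>. Lower positions contribute
  nothing.\<close>

lemma edge_map_total_bdry:
  assumes z: "z \<in> free_mod S (total_gens F G (Suc i))"
  shows "lin_ext (bdry F i) (edge_map (Suc i) z) - edge_map i (lin_ext (total_bdry F G i) z) \<in>
      D1.Jvec"
proof -
  have eq: "lin_ext (bdry F i) (edge_map (Suc i) z) - edge_map i (lin_ext (total_bdry F G i) z)
     = lin_ext (\<lambda>c. lin_ext (bdry F i) (if pos c = Suc i then single (left c) (aug G (right c))
         else 0)
         - edge_map i (total_bdry F G i c)) z"
    by (simp add: edge_map_def lin_ext_lin_ext lin_ext_fun_diff)
  show ?thesis unfolding eq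
  proof (rule submodule_lin_ext[OF D1.submodule_Jvec])
    show "lookup z b \<in> poly_ring S" for b using z by (simp add: free_mod_def)
    fix c assume "c \<in> keys z"
    then have c: "pos c \<le> Suc i" "left c \<in> gens F (pos c)" "right c \<in> gens G (Suc i - pos c)"
      using z by (auto simp: free_mod_def total_gens_def)
    have em: "edge_map i (total_bdry F G i c)
        = (if pos c - 1 = i then vec_scale (aug G (right c)) (del F (pos c) (left c)) else 0) +
          vec_scale ((-1) ^ pos c) (if pos c = i then vec_scale (aug_map (aug G)
              (del G (Suc i - pos c) (right c))) (single (left c) 1) else 0)"
      unfolding total_bdry_def
      using edge_map_ten by (simp add: edge_map_def lin_ext_add lin_ext_scale)
    consider "pos c = Suc i" | "pos c = i" | "pos c < i" using c(1) by linarith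
    then show "lin_ext (bdry F i) (if pos c = Suc i then single (left c) (aug G (right c)) else 0)
         - edge_map i (total_bdry F G i c) \<in> D1.Jvec"
    proof cases
      case 1
      then show ?thesis unfolding em by (simp add: D1.Jvec_def D1.J_ideal)
    next
      case 2
      then have r: "right c \<in> gens G (Suc 0)" using c by simp
      have J: "aug_map (aug G) (bdry G 0 (right c)) \<in> D1.J"
        using G.bdry_syz[OF r] toric_ideal_E2_D1_J by (auto simp: syz_0)
      have "(if pos c - 1 = i then vec_scale (aug G (right c)) (del F (pos c) (left c)) else 0) = 0"
        using 2 by (cases i) auto
      then have "lin_ext (bdry F i) (if pos c = Suc i then single (left c) (aug G (right c)) else 0)
         - edge_map i (total_bdry F G i c) = vec_scale (- ((-1) ^ i)) (single (left c)
             (aug_map (aug G) (bdry G 0 (right c))))"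
        unfolding em using 2 by (simp add: single_uminus)
      also have "\<dots> \<in> D1.Jvec"
      proof -
        have "- ((-1) ^ i) \<in> (poly_ring S :: ('v set, 'k) polynomial set)"
          by (cases "even i") (auto intro: poly_ring_uminus)
        moreover have "single (left c) (aug_map (aug G) (bdry G 0 (right c))) \<in> D1.Jvec"
          using J D1.J_ideal(1) by (auto simp: D1.Jvec_def lookup_single when_def)
        ultimately show ?thesis using D1.submodule_Jvec unfolding submodule_def by blast
      qed
      finally show ?thesis .
    next
      case 3
      then have "pos c - 1 \<noteq> i" "pos c \<noteq> i" "pos c \<noteq> Suc i" by auto
      then show ?thesis unfolding em by (simp add: D1.Jvec_def D1.J_ideal)
    qed
  qed
qed

text \<open>An augmentation is onto only modulo the ideal, so \<open>1\<close> is reached up to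
  \<open>I\<^sub>2\<close>. Tensoring with such a \<open>u\<close> lifts vectors over
  \<open>F\<close> to the total complex.\<close>

lemma aug_unit: "\<exists>u\<in>free_mod S (gens G 0). 1 - aug_map (aug G) u \<in> toric_ideal E2"
  using G.aug_surj[of 1] sub_free_mod(2) by force

text \<open>Under \<open>edge_map\<close> a cycle becomes, modulo \<open>D1.J\<close>, a cycle of
  the first resolution tensored with a free module, hence a boundary. Lifting the preimage with
  \<open>u\<close> and subtracting leaves a cycle with image in \<open>D1.Jvec\<close>, as
  \<open>syz_reduction\<close> asks in the top position.\<close>

lemma syz_total:
  assumes z: "z \<in> syz S I T i"
  shows "\<exists>w\<in>free_mod S (total_gens F G (Suc i)). lin_ext (total_bdry F G i) w = z"
proof -
  have zf: "z \<in> free_mod S (total_gens F G i)" using syz_free_mod[OF z] by (simp add: total_sel)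
  have "D1.coef_vec n (edge_map i z) \<in> syz E1 (toric_ideal E1) F i" for n
  proof (cases i)
    case 0
    have "aug_map (aug F) (edge_map 0 z) = aug_map (aug T) z"
    proof -
      have "aug_map (aug F) (edge_map 0 z)
          = aug_map (\<lambda>c. aug_map (aug F) (if pos c = 0 then single (left c) (aug G (right c))
              else 0)) z"
        by (simp add: edge_map_def aug_map_lin_ext)
      also have "\<dots> = aug_map (aug T) z"
        unfolding aug_map_def[of _ z]
        by (intro sum.cong refl) (use zf 0 in \<open>auto simp: free_mod_def total_gens_def total_sel
            mult.commute\<close>)
      finally show ?thesis .
    qed
    \<comment> \<open>In degree \<open>0\<close> a cycle has its augmentation in \<open>I\<close>.
      The bipartite hypothesis enters here, through \<open>fibre\<close>, to place the coefficients
      in \<open>I\<^sub>1\<close>.\<close>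
    then have "D1.coef n (aug_map (aug F) (edge_map 0 z)) \<in> toric_ideal E1" for n
      using z 0 by (intro D1_coef_toric_ideal) (simp add: syz_0)
    then show ?thesis
      using D1.coef_vec_syz_0[OF F.resolution_axioms,
          of "edge_map 0 z"] edge_map_free_mod[OF zf] 0 by simp
  next
    case (Suc i')
    have "lin_ext (total_bdry F G i') z = 0" using z Suc by (simp add: syz_Suc total_sel)
    then have "lin_ext (bdry F i') (edge_map (Suc i') z) \<in> D1.Jvec"
      using edge_map_total_bdry[of z i'] zf Suc by (simp add: edge_map_def[of i'])
    then show ?thesis
      using D1.coef_vec_syz_Suc[OF F.resolution_axioms] edge_map_free_mod[OF zf] Suc by simp
  qed
  from D1.extended_exactness[OF F.resolution_axioms edge_map_free_mod[OF zf] this]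
  obtain w where w: "w \<in> free_mod S (gens F (Suc i))" "edge_map i z - lin_ext (bdry F i) w \<in>
      D1.Jvec" by blast
  obtain u where u: "u \<in> free_mod S (gens G 0)" "1 - aug_map (aug G) u \<in> toric_ideal E2"
      using aug_unit by blast
  \<comment> \<open>The tensor of \<open>w\<close> with a lift of \<open>1\<close>:
    \<open>edge_map\<close> returns \<open>w\<close> up to a factor congruent to \<open>1\<close>
    modulo \<open>I\<^sub>2\<close>.\<close>
  define y where "y = ten (Suc i) w u"
  have y: "y \<in> free_mod S (total_gens F G (Suc i))"
    unfolding y_def by (rule ten_free_mod[OF w(1) u(1)]) (auto simp: total_gens_def)
  let ?D = "lin_ext (total_bdry F G i)"
  have wS: "lookup (lin_ext (bdry F i) w) b \<in> poly_ring S" for b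
  proof -
    have "lin_ext (bdry F i) w \<in> free_mod S (gens F i)"
      by (rule lin_ext_free_mod[OF w(1)]) (rule sub_free_mod(1)[OF F.bdry_free_mod])
    then show ?thesis by (simp add: free_mod_def)
  qed
  have "edge_map (Suc i) y = vec_scale (aug_map (aug G) u) w" by (simp add: y_def edge_map_ten)
  then have "lin_ext (bdry F i) w - lin_ext (bdry F i) (edge_map (Suc i) y)
      = vec_scale (1 - aug_map (aug G) u) (lin_ext (bdry F i) w)"
    by (simp add: lin_ext_scale vec.scale_left_diff_distrib)
  also have "\<dots> \<in> D1.Jvec"
    unfolding D1.Jvec_def
  proof safe
    fix b
    have "lookup (lin_ext (bdry F i) w) b * (1 - aug_map (aug G) u) \<in> D1.J"
      using u(2) toric_ideal_E2_D1_J by (intro D1.J_ideal(3) wS) blast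
    then show "lookup (vec_scale (1 - aug_map (aug G) u) (lin_ext (bdry F i) w)) b \<in> D1.J"
      by (simp add: mult.commute)
  qed
  finally have 1: "lin_ext (bdry F i) w - lin_ext (bdry F i) (edge_map (Suc i) y) \<in> D1.Jvec" .
  have "(edge_map i z - lin_ext (bdry F i) w) + ((lin_ext (bdry F i) w - lin_ext (bdry F i)
      (edge_map (Suc i) y)) +
      (lin_ext (bdry F i) (edge_map (Suc i) y) - edge_map i (?D y))) \<in> D1.Jvec"
    using w(2) 1 edge_map_total_bdry[OF y] D1.submodule_Jvec unfolding submodule_def by blast
  then have J: "edge_map i (z - ?D y) \<in> D1.Jvec" by (simp add: edge_map_def lin_ext_diff)
  have syz: "z - ?D y \<in> syz S I T i"
    by (rule submodule_diff[OF submodule_syz[OF I] z total_bdry_syz[OF y]])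
  have "\<exists>w'\<in>free_mod S (total_gens F G (Suc i)). ?D w' = z - ?D y"
  proof (rule syz_reduction[OF syz])
    show "pos c < Suc i" if "c \<in> keys (z - ?D y)" for c
      using syz_free_mod[OF syz] that by (auto simp: free_mod_def total_sel total_gens_def)
    show "\<forall>b. aug_map (aug G) (slice i b (z - ?D y)) \<in> D1.J"
      using J by (simp add: D1.Jvec_def lookup_edge_map)
  qed simp
  then obtain w' where w': "w' \<in> free_mod S (total_gens F G (Suc i))" "?D w' = z - ?D y" by blast
  have "w' + y \<in> free_mod S (total_gens F G (Suc i))"
    using y w'(1) submodule_free_mod unfolding submodule_def by blast
  moreover have "?D (w' + y) = z" by (simp add: lin_ext_add w'(2))
  ultimately show ?thesis by blast
qed

lemma total_resolution: "graded_free_resolution S I T"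
proof -
  have exact: "syz S I T i = lin_ext (bdry T i) ` free_mod S (gens T (Suc i))" for i
    using syz_total total_bdry_syz unfolding total_sel by blast
  show ?thesis
    unfolding graded_free_resolution_def
  proof (intro conjI allI ballI)
    fix i d show "finite {b \<in> gens T i. gdeg T i b = d}"
      by (rule card_total_gens(1)[OF F.finite_gens G.finite_gens])
  next
    fix i c assume c: "c \<in> gens T (Suc i)"
    then show "bdry T i c \<in> free_mod S (gens T i)" by (simp add: total_sel total_bdry_free_mod)
    show "homogeneous_vec (gdeg T i) (gdeg T (Suc i) c) (bdry T i c)"
      using c total_bdry_homogeneous[of c i] by (simp add: total_sel(1,3))
  next
    fix c assume c: "c \<in> gens T 0"
    then show "aug T c \<in> poly_ring S"
      using F.aug_poly_ring G.aug_poly_ring poly_ring_mono[of E1 S] poly_ring_mono[of E2 S]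
      by (auto simp: total_sel total_gens_def intro!: poly_ring_mult)
    show "homogeneous (gdeg T 0 c) (aug T c)"
      using c F.aug_homogeneous G.aug_homogeneous by (auto simp: total_sel total_gens_def intro!:
          homogeneous_mult)
  next
    fix p :: "('v set, 'k) polynomial" assume p: "p \<in> poly_ring S"
    obtain v where v: "v \<in> free_mod E1 (gens F 0)" "1 - aug_map (aug F) v \<in> toric_ideal E1"
      using F.aug_surj[of 1] by auto
    obtain u where u: "u \<in> free_mod S (gens G 0)" "1 - aug_map (aug G) u \<in> toric_ideal E2"
        using aug_unit by blast
    let ?x = "aug_map (aug F) v" and ?y = "aug_map (aug G) u"
    have x: "?x \<in> poly_ring S"
      by (rule aug_map_poly_ring[OF sub_free_mod(1)[OF v(1)]])
         (use F.aug_poly_ring poly_ring_mono[of E1 S] in auto)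
    have "1 - ?x \<in> I" "1 - ?y \<in> I"
      using v(2) u(2) toric_ideal_mono[of E1 S] toric_ideal_mono[of E2 S] by auto
    \<comment> \<open>The product of the two lifts of \<open>1\<close> is again one, since
      \<open>1 - x * y = (1 - x) + x * (1 - y)\<close>.\<close>
    then have "p * ((1 - ?x) + ?x * (1 - ?y)) \<in> I"
      using I p x unfolding graded_ideal_def by blast
    moreover have "p - aug_map (aug T) (vec_scale p (ten 0 v u)) = p * ((1 - ?x) + ?x * (1 - ?y))"
      by (simp add: aug_map_scale aug_map_ten algebra_simps)
    moreover have "vec_scale p (ten 0 v u) \<in> free_mod S (gens T 0)"
    proof -
      have "ten 0 v u \<in> free_mod S (gens T 0)"
        by (rule ten_free_mod[OF sub_free_mod(1)[OF v(1)] u(1)])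
            (auto simp: total_sel total_gens_def)
      then show ?thesis using p submodule_free_mod unfolding submodule_def by blast
    qed
    ultimately show "\<exists>w\<in>free_mod S (gens T 0). p - aug_map (aug T) w \<in> I" by metis
  next
    show "{v \<in> free_mod S (gens T 0). aug_map (aug T) v \<in> I} = lin_ext (bdry T 0)
        ` free_mod S (gens T 1)"
      using exact[of 0] by (simp add: syz_0)
  next
    fix i show "{v \<in> free_mod S (gens T (Suc i)). lin_ext (bdry T i) v = 0}
        = lin_ext (bdry T (Suc i)) ` free_mod S (gens T (i + 2))"
      using exact[of "Suc i"] by (simp add: syz_Suc)
  qed
qed

end

theorem theorem4p11:
  fixes V W1 W2 e :: "'v set"
    and E E1 E2 :: "'v set set"
    and I I1 I2 :: "('v set, 'k::{alg_closed_field, field_char_0}) polynomial set"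
    and i j :: nat
  assumes "simple_graph V E"
    and "splitting_along_edge V E W1 W2 e"
    and "E1 = induced_edges E W1"
    and "E2 = induced_edges E W2"
    and "bipartite_graph W1 E1"
    and "I = toric_ideal E"
    and "I1 = toric_ideal E1"
    and "I2 = toric_ideal E2"
  shows "graded_betti E I i j =
    (\<Sum>(i1, i2) \<in> {(a, b). a + b = i}. \<Sum>(j1, j2) \<in> {(a, b). a + b = j}.
       graded_betti E1 I1 i1 j1 * graded_betti E2 I2 i2 j2)"
proof -
  interpret edge_glueing E1 E2 e
    by (rule edge_glueing_of_splitting(1)) (use assms in auto)
  have E: "E1 \<union> E2 = E" by (rule edge_glueing_of_splitting(2)) (use assms in auto)
  have "E \<subseteq> Pow V" "finite V" using assms(1) by (auto simp: simple_graph_def)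
  then have fin: "finite E1" "finite E2" using E finite_subset[of E "Pow V"] by auto
  have id1: "graded_ideal E1 I1" and id2: "graded_ideal E2 I2"
    unfolding assms using card2 by (auto intro!: graded_ideal_toric_ideal simp: assms)
  obtain F where F: "graded_free_resolution E1 I1 F" "minimal F"
    using minimal_resolution_exists[OF fin(1) id1] toric_ideal_lookup_0[of E1] card2 assms(7)
        by blast
  obtain G where G: "graded_free_resolution E2 I2 G" "minimal G"
    using minimal_resolution_exists[OF fin(2) id2] toric_ideal_lookup_0[of E2] card2 assms(8)
        by blast
  interpret glued_resolutions E1 E2 e F G
    using F G id1 id2 unfolding assms(7,8) by unfold_locales
  have "graded_betti E I i j = tor_dim (total F G) i j"
    using graded_betti_eq[OF I total_resolution] unfolding E assms(6) .
  also have "\<dots> = card {c \<in> gens (total F G) i. gdeg (total F G) i c = j}"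
    by (intro tor_dim_minimal minimal_total F G card_total_gens(1) F.finite_gens G.finite_gens)
  also have "\<dots> = (\<Sum>(i1, i2) \<in> {(a, b). a + b = i}. \<Sum>(j1, j2) \<in> {(a, b). a + b = j}.
       card {b \<in> gens F i1. gdeg F i1 b = j1} * card {b \<in> gens G i2. gdeg G i2 b = j2})"
    by (rule card_total_gens(2)[OF F.finite_gens G.finite_gens])
  also have "\<dots> = (\<Sum>(i1, i2) \<in> {(a, b). a + b = i}. \<Sum>(j1, j2) \<in> {(a, b). a + b = j}.
       graded_betti E1 I1 i1 j1 * graded_betti E2 I2 i2 j2)"
    by (simp add: graded_betti_eq[OF id1 F(1)] graded_betti_eq[OF id2 G(1)]
        tor_dim_minimal[OF F(2) F.finite_gens] tor_dim_minimal[OF G(2) G.finite_gens])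
  finally show ?thesis .
qed

end
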